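(* Let $n\ge 2$ and $\mathtt{x}=(x_0,\dots,x_n)$. Let $K/\mathbb{Q}$ be a totally imaginary number field of degree $d\ge 4$ such that the action of $\mathrm{Gal}(\overline{\mathbb{Q}}/\mathbb{Q})$ on the set $\mathrm{Hom}(K,\overline{\mathbb{Q}})$ of embeddings is $2$-transitive. Let $l\in K[\mathtt{x}]$ be a linear form such that the $d$ Galois conjugates of the hyperplane $l=0$ are in general position, and let $f=N_{K/\mathbb{Q}}(l)\in\mathbb{Q}[\mathtt{x}]$. For a form $g\in\mathbb{Q}[\mathtt{x}]$ of degree $2d-2$, the following conditions are equivalent: (i) $g$ is divisible by $f$ and is a sum of squares of forms in $\mathbb{Q}[\mathtt{x}]$; (ii) there exist $r\ge 1$ and elements $a_1,\dots,a_r\in K$ with $a_1^2+\cdots+a_r^2=0$ such that $$g=\sum_{\nu=1}^r\Bigl(\mathrm{tr}_{K/\mathbb{Q}}\Bigl(\frac{a_\nu f}{l}\Bigr)\Bigr)^2.$$ Moreover, if (i) and (ii) hold, then conversely every sum of squares representation $g=g_1^2+\cdots+g_r^2$ of $g$ in $\mathbb{Q}[\mathtt{x}]$ has the form stated in (ii), i.e. $g_\nu=\mathrm{tr}_{K/\mathbb{Q}}(a_\nu f/l)$ for suitable $a_\nu\in K$ with $\sum_\nu a_\nu^2=0$.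
   Context: A form is a homogeneous polynomial. $\overline{\mathbb{Q}}$ is the algebraic closure of $\mathbb{Q}$ in $\mathbb{C}$; $\mathrm{Gal}(\overline{\mathbb{Q}}/\mathbb{Q})$ acts on $\mathrm{Hom}(K,\overline{\mathbb{Q}})$ (a set of $d$ elements) by composition. For $\varphi\in\mathrm{Hom}(K,\overline{\mathbb{Q}})$ and $p\in K[\mathtt{x}]$ let ${}^\varphi p$ be obtained by applying $\varphi$ to the coefficients of $p$. The Galois conjugates of the hyperplane $l=0$ are the $d$ hyperplanes ${}^\varphi l=0$ in $\mathbb{P}^n$, and $N_{K/\mathbb{Q}}(l)=\prod_{\varphi}{}^\varphi l$; in particular $l$ divides $f$ in $K[\mathtt{x}]$, so $af/l\in K[\mathtt{x}]$ for $a\in K$. For $p\in K[\mathtt{x}]$, $\mathrm{tr}_{K/\mathbb{Q}}(p)=\sum_\varphi {}^\varphi p\in\mathbb{Q}[\mathtt{x}]$ is the coefficientwise trace. The hyperplanes are in general position if the intersection of any $r\le n+1$ of them has codimension $r$ (the empty set being assigned codimension $n+1$). *)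

theory Defs
  imports "HOL-Analysis.Analysis" "HOL-Library.Poly_Mapping"
    "HOL-Computational_Algebra.Polynomial"
begin

section \<open>Polynomials and forms\<close>

text \<open>
  \<open>('i, 'a) mpoly\<close> is the polynomial ring over \<open>'a\<close> in variables indexed by \<open>'i\<close>, as a monoid
  algebra: a finitely supported map from exponent vectors to coefficients. For a finite linear
  order \<open>'i\<close> with \<open>n + 1\<close> elements the variables are \<open>x\<^sub>0, \<dots>, x\<^sub>n\<close>. (The order on the
  indices plays no mathematical role; the library uses it for the instance \<open>idom\<close>.)
\<close>

type_synonym ('i, 'a) mpoly = "('i \<Rightarrow>\<^sub>0 nat) \<Rightarrow>\<^sub>0 'a"

abbreviation const_mpoly :: "'a::zero \<Rightarrow> ('i, 'a) mpoly" where
  "const_mpoly c \<equiv> Poly_Mapping.single 0 c"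

text \<open>Only used for maps with \<open>h 0 = 0\<close>.\<close>
abbreviation map_mpoly :: "('a::zero \<Rightarrow> 'b::zero) \<Rightarrow> ('i, 'a) mpoly \<Rightarrow> ('i, 'b) mpoly" where
  "map_mpoly h p \<equiv> Poly_Mapping.map h p"

definition eval_mpoly :: "('i::finite, 'a::comm_semiring_1) mpoly \<Rightarrow> 'a ^ 'i \<Rightarrow> 'a" where
  "eval_mpoly p v =
     (\<Sum>m\<in>Poly_Mapping.keys p. Poly_Mapping.lookup p m * (\<Prod>i\<in>UNIV. (v $ i) ^ Poly_Mapping.lookup m i))"

text \<open>The zero polynomial is homogeneous of every degree.\<close>
definition homogeneous :: "nat \<Rightarrow> ('i::finite, 'a::zero) mpoly \<Rightarrow> bool" where
  "homogeneous k p \<longleftrightarrow>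
     (\<forall>m\<in>Poly_Mapping.keys p. (\<Sum>i\<in>UNIV. Poly_Mapping.lookup m i) = k)"

definition is_form :: "('i::finite, 'a::zero) mpoly \<Rightarrow> bool" where
  "is_form p \<longleftrightarrow> (\<exists>k. homogeneous k p)"

text \<open>The exact quotient \<open>p / q\<close>, for \<open>q \<noteq> 0\<close> dividing \<open>p\<close>.\<close>
definition mpoly_quot :: "('i, 'a::comm_ring_1) mpoly \<Rightarrow> ('i, 'a) mpoly \<Rightarrow> ('i, 'a) mpoly" where
  "mpoly_quot p q = (THE h. h * q = p)"


section \<open>Number fields and their embeddings\<close>

abbreviation rat_scale :: "rat \<Rightarrow> 'k \<Rightarrow> 'k::field_char_0" where
  "rat_scale q x \<equiv> of_rat q * x"

interpretation rat: vector_space "rat_scale :: rat \<Rightarrow> 'k \<Rightarrow> 'k::field_char_0"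
  by unfold_locales (simp_all add: algebra_simps of_rat_add of_rat_mult)

definition number_field :: "'k::field_char_0 itself \<Rightarrow> bool" where
  "number_field _ \<longleftrightarrow> (\<exists>B :: 'k set. finite B \<and> rat.span B = UNIV)"

definition field_degree :: "'k::field_char_0 itself \<Rightarrow> nat" where
  "field_degree _ = rat.dim (UNIV :: 'k set)"

definition Qbar :: "complex set" where
  "Qbar = {z. algebraic z}"

definition field_hom :: "('k::field \<Rightarrow> 'l::field) \<Rightarrow> bool" where
  "field_hom \<phi> \<longleftrightarrow> \<phi> 1 = 1 \<and> (\<forall>x y. \<phi> (x + y) = \<phi> x + \<phi> y) \<and> (\<forall>x y. \<phi> (x * y) = \<phi> x * \<phi> y)"

definition embeddings :: "('k::field \<Rightarrow> complex) set" where
  "embeddings = {\<phi>. field_hom \<phi> \<and> range \<phi> \<subseteq> Qbar}"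

definition totally_imaginary :: "'k::field itself \<Rightarrow> bool" where
  "totally_imaginary _ \<longleftrightarrow> (\<forall>\<phi> :: 'k \<Rightarrow> complex. field_hom \<phi> \<longrightarrow> \<not> range \<phi> \<subseteq> \<real>)"

text \<open>
  Automorphisms of \<open>Qbar\<close> are functions on \<open>complex\<close> that take the value \<open>undefined\<close> outside
  \<open>Qbar\<close>, so that each automorphism is represented exactly once.
\<close>
definition Gal_Qbar :: "(complex \<Rightarrow> complex) set" where
  "Gal_Qbar = {\<sigma> \<in> extensional Qbar. bij_betw \<sigma> Qbar Qbar \<and> (\<forall>x\<in>\<rat>. \<sigma> x = x) \<and>
     (\<forall>x\<in>Qbar. \<forall>y\<in>Qbar. \<sigma> (x + y) = \<sigma> x + \<sigma> y \<and> \<sigma> (x * y) = \<sigma> x * \<sigma> y)}"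

definition two_transitive :: "('g \<Rightarrow> 'x \<Rightarrow> 'x) \<Rightarrow> 'g set \<Rightarrow> 'x set \<Rightarrow> bool" where
  "two_transitive act G X \<longleftrightarrow>
     (\<forall>x\<in>X. \<forall>x'\<in>X. \<forall>y\<in>X. \<forall>y'\<in>X. x \<noteq> x' \<longrightarrow> y \<noteq> y' \<longrightarrow>
        (\<exists>g\<in>G. act g x = y \<and> act g x' = y'))"


section \<open>Norm and trace of polynomials\<close>

text \<open>The polynomial over \<open>\<rat>\<close> whose image over \<open>\<complex>\<close> is \<open>P\<close>, if \<open>P\<close> has rational coefficients.\<close>
definition rational_mpoly :: "('i, complex) mpoly \<Rightarrow> ('i, rat) mpoly" where
  "rational_mpoly P = (THE p. map_mpoly of_rat p = P)"

definition norm_mpoly :: "('i, 'k::field_char_0) mpoly \<Rightarrow> ('i, rat) mpoly" where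
  "norm_mpoly p = rational_mpoly (\<Prod>\<phi>\<in>embeddings. map_mpoly \<phi> p)"

definition trace_mpoly :: "('i, 'k::field_char_0) mpoly \<Rightarrow> ('i, rat) mpoly" where
  "trace_mpoly p = rational_mpoly (\<Sum>\<phi>\<in>embeddings. map_mpoly \<phi> p)"


section \<open>Hyperplanes in projective space\<close>

text \<open>Points of \<open>\<P>\<^sup>n\<close> are the lines through the origin in \<open>complex ^ 'i\<close>, where \<open>CARD('i) = n + 1\<close>.\<close>
definition proj_points :: "(complex ^ 'i::finite) set set" where
  "proj_points = {L. vec.subspace L \<and> vec.dim L = 1}"

definition proj_zeros :: "('i::finite, complex) mpoly \<Rightarrow> (complex ^ 'i) set set" where
  "proj_zeros p = {L \<in> proj_points. \<forall>v\<in>L. eval_mpoly p v = 0}"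

text \<open>
  Codimension in \<open>\<P>\<^sup>n\<close> of a projective linear subspace \<open>X\<close>: if \<open>X\<close> is nonempty then its dimension
  is \<open>vec.dim (\<Union>X) - 1\<close>, so its codimension is \<open>n - (vec.dim (\<Union>X) - 1)\<close>; the empty set gets
  codimension \<open>n + 1\<close>.
\<close>
definition proj_codim :: "(complex ^ 'i::finite) set set \<Rightarrow> nat" where
  "proj_codim X = CARD('i) - vec.dim (\<Union>X)"

text \<open>
  A family, not a set, of hyperplanes: taking two members shows that the \<open>H \<phi>\<close> are pairwise distinct.
\<close>
definition general_position :: "'e set \<Rightarrow> ('e \<Rightarrow> (complex ^ 'i::finite) set set) \<Rightarrow> bool" where
  "general_position E H \<longleftrightarrow>
     (\<forall>S\<subseteq>E. finite S \<longrightarrow> card S \<le> CARD('i) \<longrightarrow>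
        proj_codim (proj_points \<inter> (\<Inter>\<phi>\<in>S. H \<phi>)) = card S)"

end

theory Submission
  imports Defs "HOL-Computational_Algebra.Fundamental_Theorem_Algebra"
begin

text \<open>
  Over \<open>\<complex>\<close> the polynomial \<open>f\<close> is the product of the conjugate linear forms \<open>l\<^sub>\<phi>\<close>, one for each embedding
  \<open>\<phi>\<close>. Put \<open>p\<^sub>\<phi> = f / l\<^sub>\<phi>\<close>. The trace of \<open>a f / l\<close> is \<open>\<Sum>\<^sub>\<phi> \<phi>(a) p\<^sub>\<phi>\<close> (\<open>trace_form_complex\<close>). As \<open>f\<close>
  divides \<open>p\<^sub>\<phi> p\<^sub>\<psi>\<close> for \<open>\<phi> \<noteq> \<psi>\<close>, the sum of the squares of the traces of \<open>a\<^sub>\<nu> f / l\<close> is congruent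
  to \<open>\<Sum>\<^sub>\<phi> \<phi>(\<Sum>\<^sub>\<nu> a\<^sub>\<nu>\<^sup>2) p\<^sub>\<phi>\<^sup>2\<close> modulo \<open>f\<close>. So it is divisible by \<open>f\<close> as soon as \<open>\<Sum>\<^sub>\<nu> a\<^sub>\<nu>\<^sup>2 = 0\<close>
  (\<open>f_dvd_sum_trace_form_squares\<close>).

  For the converse let \<open>f\<close> divide \<open>g = \<Sum>\<^sub>\<nu> g\<^sub>\<nu>\<^sup>2\<close>, of degree \<open>2d - 2\<close>. Extreme monomials of the \<open>g\<^sub>\<nu>\<close>
  cannot cancel in a sum of squares, so the \<open>g\<^sub>\<nu>\<close> are forms of degree \<open>d - 1\<close>. At a real point with
  \<open>l\<^sub>\<phi> = 0\<close> a sum of real squares vanishes, hence so does every \<open>g\<^sub>\<nu>\<close>. The real points are Zariski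
  dense in the subspace \<open>l\<^sub>\<phi> = l\<^sub>\<psi> = 0\<close> if \<open>\<psi>\<close> is the complex conjugate of \<open>\<phi>\<close>, and then \<open>\<phi> \<noteq> \<psi>\<close>
  because \<open>K\<close> is totally imaginary. By \<open>2\<close>-transitivity the \<open>g\<^sub>\<nu>\<close> therefore vanish on
  \<open>l\<^sub>\<phi> = l\<^sub>\<psi> = 0\<close> for all \<open>\<phi> \<noteq> \<psi>\<close> (\<open>vanishes_on_pairwise_intersections\<close>).

  Inside the hyperplane \<open>l\<^sub>\<phi> = 0\<close> the form \<open>g\<^sub>\<nu>\<close> thus vanishes on the \<open>d - 1\<close> distinct hyperplanes
  \<open>l\<^sub>\<psi> = 0\<close>, and having degree \<open>d - 1\<close> it is a constant multiple of \<open>p\<^sub>\<phi>\<close> there. The constant can be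
  read off at \<open>\<phi>(v)\<close>, for a point \<open>v\<close> over \<open>K\<close> with \<open>l(v) = 0\<close> and \<open>(f / l)(v) \<noteq> 0\<close>: it is \<open>\<phi>(a)\<close>
  for \<open>a = g\<^sub>\<nu>(v) / (f / l)(v)\<close>, the same element of \<open>K\<close> for every \<open>\<phi>\<close>. The difference of \<open>g\<^sub>\<nu>\<close> and
  \<open>\<Sum>\<^sub>\<phi> \<phi>(a) p\<^sub>\<phi>\<close> has degree \<open>d - 1\<close> and vanishes on \<open>d\<close> hyperplanes, so it is zero
  (\<open>trace_form_if_zero_on_intersections\<close>). Finally \<open>g(v) = 0\<close> says that \<open>\<Sum>\<^sub>\<nu> a\<^sub>\<nu>\<^sup>2 = 0\<close>.

  The geometry is done pointwise, by restriction to lines: a polynomial in one variable has no more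
  roots than its degree. The algebraic input is that \<open>K\<close> has exactly \<open>d\<close> embeddings
  (\<open>card_embeddings\<close>), that norms and traces are rational, and that quotients of polynomials over a
  subfield of \<open>\<complex>\<close> again have coefficients in the subfield (\<open>divisibility_descends\<close>).
\<close>

section \<open>Evaluation of polynomials\<close>

definition mdeg :: "('i::finite \<Rightarrow>\<^sub>0 nat) \<Rightarrow> nat" where
  "mdeg m = (\<Sum>i\<in>UNIV. Poly_Mapping.lookup m i)"

definition mval :: "('i::finite \<Rightarrow>\<^sub>0 nat) \<Rightarrow> 'a::comm_semiring_1 ^ 'i \<Rightarrow> 'a" where
  "mval m v = (\<Prod>i\<in>UNIV. (v $ i) ^ Poly_Mapping.lookup m i)"

lemma mdeg_add: "mdeg (m + m') = mdeg m + mdeg m'"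
  by (simp add: mdeg_def lookup_add sum.distrib)

lemma mval_add: "mval (m + m') v = mval m v * mval m' v"
  by (simp add: mval_def lookup_add power_add prod.distrib)

lemma homogeneous_iff: "homogeneous k p \<longleftrightarrow> (\<forall>m\<in>Poly_Mapping.keys p. mdeg m = k)"
  by (simp add: homogeneous_def mdeg_def)

text \<open>
  Additive maps need only be computed on monomials, which is how products are handled below.
\<close>
lemma mpoly_as_sum:
  "p = (\<Sum>m\<in>Poly_Mapping.keys p. Poly_Mapping.single m (Poly_Mapping.lookup p m))"
proof (rule poly_mapping_eqI)
  fix k
  have "(\<Sum>m\<in>Poly_Mapping.keys p. Poly_Mapping.lookup (Poly_Mapping.single m (Poly_Mapping.lookup p m)) k)
      = (\<Sum>m\<in>Poly_Mapping.keys p. if m = k then Poly_Mapping.lookup p m else 0)"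
    by (intro sum.cong) (auto simp: lookup_single when_def)
  also have "\<dots> = Poly_Mapping.lookup p k"
    by (simp add: in_keys_iff)
  finally show "Poly_Mapping.lookup p k = Poly_Mapping.lookup
      (\<Sum>m\<in>Poly_Mapping.keys p. Poly_Mapping.single m (Poly_Mapping.lookup p m)) k"
    by (simp add: lookup_sum)
qed

lemma mult_as_sum:
  fixes p q :: "('i, 'a::comm_semiring_1) mpoly"
  shows "p * q = (\<Sum>m\<in>Poly_Mapping.keys p. \<Sum>m'\<in>Poly_Mapping.keys q.
    Poly_Mapping.single (m + m') (Poly_Mapping.lookup p m * Poly_Mapping.lookup q m'))"
  by (subst (1) mpoly_as_sum[of p], subst (1) mpoly_as_sum[of q])
     (simp add: sum_product mult_single)

lemma eval_mpoly_superset: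
  assumes "finite M" "Poly_Mapping.keys p \<subseteq> M"
  shows "eval_mpoly p v = (\<Sum>m\<in>M. Poly_Mapping.lookup p m * mval m v)"
  unfolding eval_mpoly_def mval_def
  by (rule sum.mono_neutral_left) (use assms in \<open>auto simp: in_keys_iff\<close>)

lemma eval_mpoly_zero [simp]: "eval_mpoly 0 v = 0"
  by (simp add: eval_mpoly_def)

lemma eval_mpoly_single: "eval_mpoly (Poly_Mapping.single m c) v = c * mval m v"
  by (subst eval_mpoly_superset[of "{m}"]) auto

lemma eval_mpoly_const [simp]: "eval_mpoly (const_mpoly c) v = c"
  by (simp add: eval_mpoly_single mval_def)

lemma eval_mpoly_one [simp]: "eval_mpoly 1 v = 1"
  using eval_mpoly_const[of 1 v] by (simp del: eval_mpoly_const)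

lemma eval_mpoly_add: "eval_mpoly (p + q) v = eval_mpoly p v + eval_mpoly q v"
proof -
  let ?M = "Poly_Mapping.keys p \<union> Poly_Mapping.keys q"
  have "Poly_Mapping.keys (p + q) \<subseteq> ?M" by (rule Poly_Mapping.keys_add)
  then show ?thesis
    by (subst (1 2 3) eval_mpoly_superset[of ?M])
       (auto simp: lookup_add algebra_simps sum.distrib)
qed

lemma eval_mpoly_sum: "eval_mpoly (\<Sum>x\<in>A. p x) v = (\<Sum>x\<in>A. eval_mpoly (p x) v)"
  by (induction A rule: infinite_finite_induct) (auto simp: eval_mpoly_add)

lemma eval_mpoly_mult: "eval_mpoly (p * q) v = eval_mpoly p v * eval_mpoly q v"
proof -
  have "eval_mpoly (p * q) v = (\<Sum>m\<in>Poly_Mapping.keys p. \<Sum>m'\<in>Poly_Mapping.keys q.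
     Poly_Mapping.lookup p m * Poly_Mapping.lookup q m' * mval (m + m') v)"
    by (subst mult_as_sum) (simp add: eval_mpoly_sum eval_mpoly_single)
  also have "\<dots> = eval_mpoly p v * eval_mpoly q v"
    by (simp add: eval_mpoly_superset[OF finite_keys subset_refl] sum_product mval_add mult_ac)
  finally show ?thesis .
qed

lemma eval_mpoly_power: "eval_mpoly (p ^ n) v = eval_mpoly p v ^ n"
  by (induction n) (auto simp: eval_mpoly_mult)

lemma eval_mpoly_prod: "eval_mpoly (\<Prod>x\<in>A. p x) v = (\<Prod>x\<in>A. eval_mpoly (p x) v)"
  by (induction A rule: infinite_finite_induct) (auto simp: eval_mpoly_mult)

lemma eval_mpoly_diff:
  fixes p q :: "('i::finite, 'a::comm_ring_1) mpoly"
  shows "eval_mpoly (p - q) v = eval_mpoly p v - eval_mpoly q v"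
  using eval_mpoly_add[of "p - q" q v] by (simp add: algebra_simps)

lemma homogeneous_zero [simp]: "homogeneous k 0"
  by (simp add: homogeneous_def)

lemma homogeneous_add: "homogeneous k p \<Longrightarrow> homogeneous k q \<Longrightarrow> homogeneous k (p + q)"
  unfolding homogeneous_iff using Poly_Mapping.keys_add[of p q] by blast

lemma homogeneous_diff:
  fixes p q :: "('i::finite, 'a::ab_group_add) mpoly"
  shows "homogeneous k p \<Longrightarrow> homogeneous k q \<Longrightarrow> homogeneous k (p - q)"
  unfolding homogeneous_iff by (auto simp: in_keys_iff lookup_minus)

lemma homogeneous_sum: "(\<And>x. x \<in> A \<Longrightarrow> homogeneous k (p x)) \<Longrightarrow> homogeneous k (\<Sum>x\<in>A. p x)"
  by (induction A rule: infinite_finite_induct) (auto intro: homogeneous_add)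

lemma homogeneous_mult:
  "homogeneous a p \<Longrightarrow> homogeneous b q \<Longrightarrow> homogeneous (a + b) (p * q)"
  unfolding homogeneous_iff using Poly_Mapping.keys_mult[of p q] by (fastforce simp: mdeg_add)

lemma homogeneous_const: "homogeneous 0 (const_mpoly c)"
  by (simp add: homogeneous_def)

lemma homogeneous_prod:
  "finite A \<Longrightarrow> (\<And>x. x \<in> A \<Longrightarrow> homogeneous 1 (p x)) \<Longrightarrow> homogeneous (card A) (\<Prod>x\<in>A. p x)"
proof (induction A rule: finite_induct)
  case empty
  then show ?case by (metis homogeneous_const single_one card.empty prod.empty)
next
  case (insert x A)
  then show ?case using homogeneous_mult[of 1 "p x" "card A" "\<Prod>x\<in>A. p x"] by simp
qed

section \<open>Field homomorphisms\<close>

lemma field_hom_of_rat: "field_hom (of_rat :: rat \<Rightarrow> 'k::field_char_0)"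
  by (simp add: field_hom_def of_rat_add of_rat_mult)

context
  fixes \<phi> :: "'k::field \<Rightarrow> 'l::field"
  assumes hom: "field_hom \<phi>"
begin

lemma hom_add: "\<phi> (x + y) = \<phi> x + \<phi> y" and hom_mult: "\<phi> (x * y) = \<phi> x * \<phi> y"
  and hom_one: "\<phi> 1 = 1"
  using hom by (auto simp: field_hom_def)

lemma hom_zero: "\<phi> 0 = 0"
  by (metis add.right_neutral add_left_imp_eq hom_add)

lemma hom_uminus: "\<phi> (- x) = - \<phi> x"
  using hom_add[of x "- x"] by (simp add: hom_zero add_eq_0_iff)

lemma hom_diff: "\<phi> (x - y) = \<phi> x - \<phi> y"
  using hom_add[of x "- y"] by (simp add: hom_uminus)

lemma hom_sum: "\<phi> (\<Sum>x\<in>A. g x) = (\<Sum>x\<in>A. \<phi> (g x))"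
  by (induction A rule: infinite_finite_induct) (auto simp: hom_zero hom_add)

lemma hom_prod: "\<phi> (\<Prod>x\<in>A. g x) = (\<Prod>x\<in>A. \<phi> (g x))"
  by (induction A rule: infinite_finite_induct) (auto simp: hom_one hom_mult)

lemma hom_power: "\<phi> (x ^ n) = \<phi> x ^ n"
  by (induction n) (auto simp: hom_one hom_mult)

lemma hom_eq_0_iff: "\<phi> x = 0 \<longleftrightarrow> x = 0"
proof
  assume *: "\<phi> x = 0"
  show "x = 0"
  proof (rule ccontr)
    assume "x \<noteq> 0"
    then have "\<phi> x * \<phi> (inverse x) = 1" by (simp flip: hom_mult add: hom_one)
    with * show False by simp
  qed
qed (simp add: hom_zero)

lemma hom_inj: "\<phi> x = \<phi> y \<longleftrightarrow> x = y"
  using hom_eq_0_iff[of "x - y"] by (simp add: hom_diff)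

lemma hom_divide: "\<phi> (x / y) = \<phi> x / \<phi> y"
proof (cases "y = 0")
  case False
  then have "\<phi> (x / y) * \<phi> y = \<phi> x" by (simp flip: hom_mult)
  with False show ?thesis by (simp add: hom_eq_0_iff field_simps)
qed (simp add: hom_zero)

lemma lookup_map_mpoly: "Poly_Mapping.lookup (map_mpoly \<phi> p) m = \<phi> (Poly_Mapping.lookup p m)"
  by (simp add: Poly_Mapping.map.rep_eq when_def hom_zero)

lemma keys_map_mpoly: "Poly_Mapping.keys (map_mpoly \<phi> p) = Poly_Mapping.keys p"
  by (auto simp: in_keys_iff lookup_map_mpoly hom_eq_0_iff)

lemma map_mpoly_inj: "map_mpoly \<phi> p = map_mpoly \<phi> q \<longleftrightarrow> p = q"
  by (metis hom_inj lookup_map_mpoly poly_mapping_eqI)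

lemma map_mpoly_zero: "map_mpoly \<phi> 0 = 0"
  by (rule poly_mapping_eqI) (simp add: lookup_map_mpoly hom_zero)

lemma map_mpoly_eq_0_iff: "map_mpoly \<phi> p = 0 \<longleftrightarrow> p = 0"
  using map_mpoly_inj[of p 0] by (simp add: map_mpoly_zero)

lemma map_mpoly_add: "map_mpoly \<phi> (p + q) = map_mpoly \<phi> p + map_mpoly \<phi> q"
  by (rule poly_mapping_eqI) (simp add: lookup_map_mpoly lookup_add hom_add)

lemma map_mpoly_sum: "map_mpoly \<phi> (\<Sum>x\<in>A. p x) = (\<Sum>x\<in>A. map_mpoly \<phi> (p x))"
  by (induction A rule: infinite_finite_induct) (auto simp: map_mpoly_zero map_mpoly_add)

lemma map_mpoly_single: "map_mpoly \<phi> (Poly_Mapping.single m c) = Poly_Mapping.single m (\<phi> c)"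
  by (rule poly_mapping_eqI) (simp add: lookup_map_mpoly lookup_single when_def hom_zero)

lemma map_mpoly_mult:
  fixes p q :: "('i::finite, 'k) mpoly"
  shows "map_mpoly \<phi> (p * q) = map_mpoly \<phi> p * map_mpoly \<phi> q"
  unfolding mult_as_sum[of p q] mult_as_sum[of "map_mpoly \<phi> p"]
  by (simp add: keys_map_mpoly lookup_map_mpoly map_mpoly_sum map_mpoly_single hom_mult)

lemma map_mpoly_power2:
  fixes p :: "('i::finite, 'k) mpoly"
  shows "map_mpoly \<phi> (p\<^sup>2) = (map_mpoly \<phi> p)\<^sup>2"
  by (simp add: power2_eq_square map_mpoly_mult)

lemma homogeneous_map_mpoly:
  fixes p :: "('i::finite, 'k) mpoly"
  shows "homogeneous k (map_mpoly \<phi> p) \<longleftrightarrow> homogeneous k p"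
  by (simp add: homogeneous_def keys_map_mpoly)

lemma eval_map_mpoly:
  "eval_mpoly (map_mpoly \<phi> p) (\<chi> i. \<phi> (v $ i)) = \<phi> (eval_mpoly p v)"
  by (simp add: eval_mpoly_def keys_map_mpoly lookup_map_mpoly hom_sum hom_prod hom_mult hom_power)

end

lemma hom_of_rat:
  fixes \<phi> :: "'k::field_char_0 \<Rightarrow> 'l::field_char_0"
  assumes "field_hom \<phi>"
  shows "\<phi> (of_rat q) = of_rat q"
proof -
  have nat: "\<phi> (of_nat n) = of_nat n" for n
    by (induction n) (simp_all add: hom_zero[OF assms] hom_one[OF assms] hom_add[OF assms])
  have int: "\<phi> (of_int n) = of_int n" for n
    by (cases n rule: int_cases2) (simp_all add: nat hom_uminus[OF assms])
  show ?thesis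
    by (cases q) (simp add: of_rat_rat int hom_divide[OF assms])
qed

lemma map_mpoly_of_rat:
  fixes \<phi> :: "'k::field_char_0 \<Rightarrow> 'l::field_char_0"
  assumes "field_hom \<phi>"
  shows "map_mpoly \<phi> (map_mpoly of_rat p) = map_mpoly of_rat p"
  by (rule poly_mapping_eqI)
     (simp add: lookup_map_mpoly[OF assms] lookup_map_mpoly[OF field_hom_of_rat] hom_of_rat[OF assms])

section \<open>Descent of coefficients to a subfield\<close>

text \<open>
  Functionals of this kind replace the Galois group as a test for membership in the subfield
  \<open>\<phi>(K)\<close>: they are linear over it, so they can be applied to an identity coefficient by coefficient.
  One exists for every \<open>c\<close> outside the subfield because \<open>1\<close> and \<open>c\<close> are then linearly independent.
\<close>
lemma exists_linear_functional_off_subfield: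
  fixes \<phi> :: "'k::field \<Rightarrow> complex"
  assumes hom: "field_hom \<phi>" and c: "c \<notin> range \<phi>"
  shows "\<exists>\<tau> :: complex \<Rightarrow> complex. (\<forall>x y. \<tau> (x + y) = \<tau> x + \<tau> y) \<and>
    (\<forall>k z. \<tau> (\<phi> k * z) = \<phi> k * \<tau> z) \<and> \<tau> 1 = 0 \<and> \<tau> c = 1"
proof -
  interpret V: vector_space "\<lambda>k z. \<phi> k * z"
    by unfold_locales (simp_all add: algebra_simps hom_add[OF hom] hom_mult[OF hom] hom_one[OF hom])
  interpret VV: vector_space_pair "\<lambda>k z. \<phi> k * z" "\<lambda>k z. \<phi> k * z" ..
  have "c \<notin> V.span {1}"
    using c by (auto simp: V.span_singleton)
  then have "V.independent {c, 1}"
    by (simp add: V.independent_insert V.dependent_single)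
  then obtain \<tau> where \<tau>: "Vector_Spaces.linear (\<lambda>k z. \<phi> k * z) (\<lambda>k z. \<phi> k * z) \<tau>"
      and val: "\<forall>x\<in>{c,1}. \<tau> x = (if x = 1 then 0 else 1)"
    using VV.linear_independent_extend[of "{c,1}" "\<lambda>x. if x = 1 then 0 else 1"] by blast
  have "c \<noteq> 1" using c hom_one[OF hom] by (metis rangeI)
  interpret L: Vector_Spaces.linear "\<lambda>k z. \<phi> k * z" "\<lambda>k z. \<phi> k * z" \<tau> by (rule \<tau>)
  show ?thesis
    by (rule exI[of _ \<tau>]) (use val \<open>c \<noteq> 1\<close> L.add L.scale in auto)
qed

lemma subfield_coeffs_if_functionals_vanish:
  fixes \<phi> :: "'k::field \<Rightarrow> complex" and P :: "('i::finite, complex) mpoly"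
  assumes hom: "field_hom \<phi>"
    and vanish: "\<And>\<tau> m. (\<And>x y. \<tau> (x + y) = \<tau> x + \<tau> y) \<Longrightarrow> (\<And>k z. \<tau> (\<phi> k * z) = \<phi> k * \<tau> z) \<Longrightarrow>
      \<tau> 1 = 0 \<Longrightarrow> \<tau> (Poly_Mapping.lookup P m) = 0"
  obtains p where "P = map_mpoly \<phi> p"
proof -
  have *: "\<exists>k. Poly_Mapping.lookup P m = \<phi> k" for m
  proof (rule ccontr)
    assume "\<not> ?thesis"
    then have "Poly_Mapping.lookup P m \<notin> range \<phi>" by blast
    then obtain \<tau> :: "complex \<Rightarrow> complex" where t: "\<And>x y. \<tau> (x + y) = \<tau> x + \<tau> y" "\<And>k z. \<tau> (\<phi> k * z) = \<phi> k * \<tau> z" "\<tau> 1 = 0"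
      "\<tau> (Poly_Mapping.lookup P m) = 1"
      using exists_linear_functional_off_subfield[OF hom] by blast
    then show False using vanish[OF t(1,2,3)] by simp
  qed
  define p where "p = (\<Sum>m\<in>Poly_Mapping.keys P.
     Poly_Mapping.single m (SOME k. Poly_Mapping.lookup P m = \<phi> k))"
  have "map_mpoly \<phi> p = (\<Sum>m\<in>Poly_Mapping.keys P. Poly_Mapping.single m (Poly_Mapping.lookup P m))"
    unfolding p_def using someI_ex[OF *]
    by (simp add: map_mpoly_sum[OF hom] map_mpoly_single[OF hom])
  then show ?thesis using that mpoly_as_sum[of P] by metis
qed

lemma map_functional_mult:
  fixes \<phi> :: "'k::field \<Rightarrow> complex" and h :: "('i::finite, complex) mpoly"
  assumes hom: "field_hom \<phi>"
    and \<tau>: "\<And>x y. \<tau> (x + y) = \<tau> x + \<tau> y" "\<And>k z. \<tau> (\<phi> k * z) = \<phi> k * \<tau> z"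
  shows "map_mpoly \<tau> (h * map_mpoly \<phi> q) = map_mpoly \<tau> h * map_mpoly \<phi> q"
proof -
  have \<tau>0: "\<tau> 0 = 0" using \<tau>(1)[of 0 0] by simp
  have look: "Poly_Mapping.lookup (map_mpoly \<tau> p) m = \<tau> (Poly_Mapping.lookup p m)"
    for p :: "('i, complex) mpoly" and m
    by (simp add: Poly_Mapping.map.rep_eq when_def \<tau>0)
  have add: "map_mpoly \<tau> (p + p') = map_mpoly \<tau> p + map_mpoly \<tau> p'"
    for p p' :: "('i, complex) mpoly"
    by (rule poly_mapping_eqI) (simp add: look lookup_add \<tau>)
  have zero: "map_mpoly \<tau> 0 = (0 :: ('i, complex) mpoly)"
    by (rule poly_mapping_eqI) (simp add: look \<tau>0)
  have sum: "map_mpoly \<tau> (\<Sum>x\<in>A. p x) = (\<Sum>x\<in>A. map_mpoly \<tau> (p x))"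
    for A :: "('i \<Rightarrow>\<^sub>0 nat) set" and p :: "_ \<Rightarrow> ('i, complex) mpoly"
    by (induction A rule: infinite_finite_induct) (auto simp: zero add)
  have single: "map_mpoly \<tau> (Poly_Mapping.single m c) = Poly_Mapping.single m (\<tau> c)" for m c
    by (rule poly_mapping_eqI) (simp add: look lookup_single when_def \<tau>0)
  have \<tau>2: "\<tau> (z * \<phi> k) = \<tau> z * \<phi> k" for z k using \<tau>(2)[of k z] by (simp add: mult.commute)
  have "map_mpoly \<tau> h * map_mpoly \<phi> q = (\<Sum>m\<in>Poly_Mapping.keys h. Poly_Mapping.single m (\<tau> (Poly_Mapping.lookup h m)))
     * (\<Sum>m\<in>Poly_Mapping.keys q. Poly_Mapping.single m (\<phi> (Poly_Mapping.lookup q m)))"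
    by (subst (1) mpoly_as_sum[of h], subst (1) mpoly_as_sum[of q])
       (simp add: sum single map_mpoly_sum[OF hom] map_mpoly_single[OF hom])
  then show ?thesis
    by (subst mult_as_sum)
       (simp add: keys_map_mpoly[OF hom] lookup_map_mpoly[OF hom] sum single sum_product mult_single \<tau>2)
qed

text \<open>
  A functional \<open>\<tau>\<close> that is linear over the subfield and kills \<open>1\<close> kills the coefficients of \<open>p\<close>.
  Applied to the coefficients in \<open>h q = p\<close> it gives \<open>\<tau>(h) q = 0\<close>, so \<open>\<tau>\<close> kills the coefficients
  of \<open>h\<close>.
\<close>
lemma divisibility_descends:
  fixes \<phi> :: "'k::field \<Rightarrow> complex" and h :: "('i::{finite,linorder}, complex) mpoly"
  assumes hom: "field_hom \<phi>" and q: "q \<noteq> 0" and eq: "h * map_mpoly \<phi> q = map_mpoly \<phi> p"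
  obtains h' where "h = map_mpoly \<phi> h'" "h' * q = p"
proof -
  obtain h' where h': "h = map_mpoly \<phi> h'"
  proof (rule subfield_coeffs_if_functionals_vanish[OF hom])
    fix \<tau> m
    assume \<tau>: "\<And>x y. \<tau> (x + y) = \<tau> x + \<tau> y" "\<And>k z. \<tau> (\<phi> k * z) = \<phi> k * \<tau> z" "\<tau> 1 = (0::complex)"
    have \<tau>0: "\<tau> 0 = 0" using \<tau>(1)[of 0 0] by simp
    have "\<tau> (\<phi> k) = 0" for k using \<tau>(2)[of k 1] \<tau>(3) by simp
    then have "map_mpoly \<tau> (map_mpoly \<phi> p) = 0"
      by (intro poly_mapping_eqI) (simp add: Poly_Mapping.map.rep_eq when_def \<tau>0)
    then have "map_mpoly \<tau> h * map_mpoly \<phi> q = 0"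
      by (simp flip: eq add: map_functional_mult[OF hom \<tau>(1,2)])
    then have "map_mpoly \<tau> h = 0"
      using q by (simp add: map_mpoly_eq_0_iff[OF hom])
    then have "Poly_Mapping.lookup (map_mpoly \<tau> h) m = 0" by simp
    then show "\<tau> (Poly_Mapping.lookup h m) = 0"
      by (simp add: Poly_Mapping.map.rep_eq when_def \<tau>0 split: if_splits)
  qed auto
  have "h' * q = p"
    using eq by (simp add: h' map_mpoly_inj[OF hom] flip: map_mpoly_mult[OF hom])
  with h' show ?thesis using that by blast
qed

section \<open>Polynomials vanishing at rational points\<close>

lemma univariate_zero_if_zero_on_Rats:
  fixes p :: "'a::field_char_0 poly"
  assumes "\<And>q. poly p (of_rat q) = 0"
  shows "p = 0"
proof (rule ccontr)
  assume "p \<noteq> 0"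
  then have "finite {x. poly p x = 0}" by (rule poly_roots_finite)
  moreover have "range of_rat \<subseteq> {x. poly p x = 0}" using assms by auto
  ultimately have "finite (range (of_rat :: rat \<Rightarrow> 'a))" by (rule finite_subset[rotated])
  then show False
    using finite_imageD[of "of_rat :: rat \<Rightarrow> 'a" UNIV] infinite_UNIV_char_0
    by (metis inj_def of_rat_eq_iff)
qed

text \<open>
  Induction on the set \<open>A\<close> of variables: collecting the powers of one variable gives a polynomial in
  that variable whose coefficients involve only the others. Injectivity expresses that the
  monomials in \<open>M\<close> are still distinct when restricted to \<open>A\<close>.
\<close>
lemma monomial_sum_zero_imp_coeffs_zero:
  fixes c :: "('i \<Rightarrow>\<^sub>0 nat) \<Rightarrow> 'a::field_char_0"
  assumes "finite A" "finite M" "inj_on (\<lambda>m. restrict (Poly_Mapping.lookup m) A) M"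
    and "\<And>x :: 'i \<Rightarrow> rat. (\<Sum>m\<in>M. c m * (\<Prod>i\<in>A. of_rat (x i) ^ Poly_Mapping.lookup m i)) = 0"
  shows "\<forall>m\<in>M. c m = 0"
  using assms
proof (induction A arbitrary: M c rule: finite_induct)
  case empty
  show ?case
  proof
    fix m assume m: "m \<in> M"
    have "m' = m" if "m' \<in> M" for m'
      using empty.prems(2) that m by (auto simp: inj_on_def)
    with m have "M = {m}" by blast
    then show "c m = 0" using empty.prems(3) by simp
  qed
next
  case (insert a A)
  show ?case
  proof
    fix m0 assume m0: "m0 \<in> M"
    define k where "k = Poly_Mapping.lookup m0 a"
    define M' where "M' = {m\<in>M. Poly_Mapping.lookup m a = k}"
    have "\<forall>m\<in>M'. c m = 0"
    proof (rule insert.IH)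
      show "finite M'" using insert.prems by (simp add: M'_def)
      show "inj_on (\<lambda>m. restrict (Poly_Mapping.lookup m) A) M'"
      proof (rule inj_onI)
        fix m m' assume m: "m \<in> M'" "m' \<in> M'"
          and eq: "restrict (Poly_Mapping.lookup m) A = restrict (Poly_Mapping.lookup m') A"
        have "Poly_Mapping.lookup m i = Poly_Mapping.lookup m' i" if "i \<in> insert a A" for i
          using that m fun_cong[OF eq, of i] by (auto simp: M'_def)
        then have "restrict (Poly_Mapping.lookup m) (insert a A) = restrict (Poly_Mapping.lookup m') (insert a A)"
          by (auto simp: restrict_def fun_eq_iff)
        then show "m = m'" by (rule inj_onD[OF insert.prems(2)]) (use m in \<open>auto simp: M'_def\<close>)
      qed
      fix x :: "'i \<Rightarrow> rat"
      define e where "e m = c m * (\<Prod>i\<in>A. of_rat (x i) ^ Poly_Mapping.lookup m i)" for m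
      define p where "p = (\<Sum>m\<in>M. monom (e m) (Poly_Mapping.lookup m a))"
      have "p = 0"
      proof (rule univariate_zero_if_zero_on_Rats)
        fix q
        have *: "(\<Prod>i\<in>A. of_rat ((x(a := q)) i) ^ Poly_Mapping.lookup m i) =
           (\<Prod>i\<in>A. of_rat (x i) ^ Poly_Mapping.lookup m i :: 'a)" for m
          using insert.hyps by (intro prod.cong) auto
        have "poly p (of_rat q) = (\<Sum>m\<in>M. e m * of_rat q ^ Poly_Mapping.lookup m a)"
          by (simp add: p_def poly_sum poly_monom)
        also have "\<dots> = (\<Sum>m\<in>M. c m * (\<Prod>i\<in>insert a A. of_rat ((x(a := q)) i) ^ Poly_Mapping.lookup m i))"
          unfolding e_def prod.insert[OF insert.hyps] *
          by (simp add: mult_ac)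
        also have "\<dots> = 0" by (rule insert.prems(3))
        finally show "poly p (of_rat q) = 0" .
      qed
      then have "0 = coeff p k" by simp
      also have "\<dots> = (\<Sum>m\<in>M. if Poly_Mapping.lookup m a = k then e m else 0)"
        by (simp add: p_def coeff_sum)
      also have "\<dots> = (\<Sum>m\<in>M'. e m)"
        unfolding M'_def using insert.prems(1) by (simp add: sum.inter_filter)
      finally show "(\<Sum>m\<in>M'. c m * (\<Prod>i\<in>A. of_rat (x i) ^ Poly_Mapping.lookup m i)) = 0"
        by (simp add: e_def)
    qed
    then show "c m0 = 0" using m0 by (simp add: M'_def k_def)
  qed
qed

text \<open>
  The two uses are \<open>\<tau>\<close> the identity (a polynomial that vanishes at all rational points is zero) and
  \<open>\<tau>\<close> a functional that kills \<open>\<rat>\<close> (a polynomial with rational values has rational coefficients).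
\<close>
lemma functional_vanishes_on_coeffs:
  fixes P :: "('i::finite, complex) mpoly" and \<tau> :: "complex \<Rightarrow> complex"
  assumes \<tau>: "\<And>x y. \<tau> (x + y) = \<tau> x + \<tau> y" "\<And>q z. \<tau> (of_rat q * z) = of_rat q * \<tau> z"
    and vanish: "\<And>x :: rat ^ 'i. \<tau> (eval_mpoly P (\<chi> i. of_rat (x $ i))) = 0"
  shows "\<tau> (Poly_Mapping.lookup P m) = 0"
proof -
  have \<tau>0: "\<tau> 0 = 0" using \<tau>(1)[of 0 0] by simp
  have \<tau>sum: "\<tau> (\<Sum>m\<in>M. g m) = (\<Sum>m\<in>M. \<tau> (g m))" for M :: "('i \<Rightarrow>\<^sub>0 nat) set" and g
    by (rule additive.sum) (rule additive.intro, rule \<tau>(1))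
  have "\<forall>m\<in>Poly_Mapping.keys P. \<tau> (Poly_Mapping.lookup P m) = 0"
  proof (rule monomial_sum_zero_imp_coeffs_zero[of UNIV])
    show "inj_on (\<lambda>m. restrict (Poly_Mapping.lookup m) UNIV) (Poly_Mapping.keys P)"
      by (rule inj_onI) (metis poly_mapping_eqI restrict_UNIV)
    fix x :: "'i \<Rightarrow> rat"
    have rat: "mval m (\<chi> i. of_rat (x i)) = (of_rat (\<Prod>i\<in>UNIV. x i ^ Poly_Mapping.lookup m i) :: complex)" for m
      by (simp add: mval_def hom_prod[OF field_hom_of_rat] of_rat_power)
    have rat': "(\<Prod>i\<in>UNIV. of_rat (x i) ^ Poly_Mapping.lookup m i) = (of_rat (\<Prod>i\<in>UNIV. x i ^ Poly_Mapping.lookup m i) :: complex)" for m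
      by (simp add: hom_prod[OF field_hom_of_rat] of_rat_power)
    have "0 = \<tau> (eval_mpoly P (\<chi> i. of_rat (x i)))"
      using vanish[of "\<chi> i. x i"] by simp
    also have "\<dots> = (\<Sum>m\<in>Poly_Mapping.keys P. \<tau> (of_rat (\<Prod>i\<in>UNIV. x i ^ Poly_Mapping.lookup m i) * Poly_Mapping.lookup P m))"
      unfolding eval_mpoly_superset[OF finite_keys subset_refl] rat \<tau>sum
      by (simp only: mult.commute)
    also have "\<dots> = (\<Sum>m\<in>Poly_Mapping.keys P. \<tau> (Poly_Mapping.lookup P m) *
        (\<Prod>i\<in>UNIV. of_rat (x i) ^ Poly_Mapping.lookup m i))"
      unfolding \<tau>(2) rat' by (simp only: mult.commute)
    finally show "(\<Sum>m\<in>Poly_Mapping.keys P. \<tau> (Poly_Mapping.lookup P m) *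
        (\<Prod>i\<in>UNIV. of_rat (x i) ^ Poly_Mapping.lookup m i)) = 0" by simp
  qed auto
  then show ?thesis by (cases "m \<in> Poly_Mapping.keys P") (auto simp: in_keys_iff \<tau>0)
qed

lemma mpoly_zero_if_zero_at_rational_points:
  fixes P :: "('i::finite, complex) mpoly"
  assumes "\<And>x :: rat ^ 'i. eval_mpoly P (\<chi> i. of_rat (x $ i)) = 0"
  shows "P = 0"
  by (rule poly_mapping_eqI) (use functional_vanishes_on_coeffs[of "\<lambda>x. x" P] assms in auto)

lemma rational_coeffs_if_rational_values:
  fixes P :: "('i::finite, complex) mpoly"
  assumes "\<And>x :: rat ^ 'i. eval_mpoly P (\<chi> i. of_rat (x $ i)) \<in> \<rat>"
  obtains p where "P = map_mpoly of_rat p"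
proof (rule subfield_coeffs_if_functionals_vanish[OF field_hom_of_rat])
  fix \<tau> :: "complex \<Rightarrow> complex" and m
  assume \<tau>: "\<And>x y. \<tau> (x + y) = \<tau> x + \<tau> y" "\<And>k z. \<tau> (of_rat k * z) = of_rat k * \<tau> z" "\<tau> 1 = 0"
  have "\<tau> (of_rat k) = 0" for k using \<tau>(2)[of k 1] \<tau>(3) by simp
  then have "\<tau> z = 0" if "z \<in> \<rat>" for z using that by (auto elim: Rats_cases)
  then show "\<tau> (Poly_Mapping.lookup P m) = 0"
    using functional_vanishes_on_coeffs[OF \<tau>(1,2)] assms by blast
qed auto

lemma rational_mpoly_map_of_rat: "rational_mpoly (map_mpoly of_rat p) = p"
  unfolding rational_mpoly_def
  by (rule the_equality) (simp_all add: map_mpoly_inj[OF field_hom_of_rat])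

section \<open>Homogeneous sums of squares\<close>

text \<open>
  The hypothesis says that \<open>m\<close> is a vertex of the support of \<open>p\<close>: only \<open>m + m\<close> itself contributes
  to the coefficient of \<open>m + m\<close> in the square.
\<close>
lemma lookup_square_extreme:
  fixes p :: "('i::finite, 'a::comm_semiring_1) mpoly"
  assumes ext: "\<And>a b. a \<in> Poly_Mapping.keys p \<Longrightarrow> b \<in> Poly_Mapping.keys p \<Longrightarrow> a + b = m + m \<Longrightarrow> a = m \<and> b = m"
  shows "Poly_Mapping.lookup (p\<^sup>2) (m + m) = (Poly_Mapping.lookup p m)\<^sup>2"
proof -
  let ?K = "Poly_Mapping.keys p"
  have "Poly_Mapping.lookup (p\<^sup>2) (m + m) = (\<Sum>a\<in>?K. \<Sum>b\<in>?K.
      if a + b = m + m then Poly_Mapping.lookup p a * Poly_Mapping.lookup p b else 0)"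
    unfolding power2_eq_square by (subst mult_as_sum) (simp add: lookup_sum lookup_single when_def)
  also have "\<dots> = (\<Sum>a\<in>?K. \<Sum>b\<in>?K.
      if a = m then if b = m then Poly_Mapping.lookup p a * Poly_Mapping.lookup p b else 0 else 0)"
    by (intro sum.cong refl) (auto dest: ext)
  also have "\<dots> = (\<Sum>a\<in>?K. if a = m then \<Sum>b\<in>?K. if b = m then Poly_Mapping.lookup p a * Poly_Mapping.lookup p b else 0 else 0)"
    by (intro sum.cong refl) auto
  also have "\<dots> = (Poly_Mapping.lookup p m)\<^sup>2"
    by (simp add: in_keys_iff power2_eq_square)
  finally show ?thesis .
qed

text \<open>
  Among the monomials of maximal degree in all the \<open>G \<nu>\<close>, the largest one in the monomial order
  is extreme, so its double occurs in the sum of squares with a sum of squares of coefficients,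
  which is positive. So the maximal degree is \<open>k\<close>. The same holds for the minimal degree.
\<close>
lemma sum_of_squares_summands_homogeneous:
  fixes G :: "'n \<Rightarrow> ('i::{finite,linorder}, 'a::linordered_field) mpoly"
  assumes fin: "finite N" and hom: "homogeneous (2 * k) (\<Sum>\<nu>\<in>N. (G \<nu>)\<^sup>2)" and "\<nu> \<in> N"
  shows "homogeneous k (G \<nu>)"
proof -
  define M where "M = (\<Union>\<nu>\<in>N. Poly_Mapping.keys (G \<nu>))"
  have finM: "finite M" using fin by (simp add: M_def)
  \<comment> \<open>The condition on \<open>m\<close> holds for both a maximal and a minimal degree: two degrees with
    average \<open>mdeg m\<close> are then both equal to it.\<close>
  have key: "mdeg m = k" if m: "m \<in> M" and top: "\<And>a b. a \<in> M \<Longrightarrow> b \<in> M \<Longrightarrow> mdeg a + mdeg b = 2 * mdeg m \<Longrightarrow>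
      a \<in> {a\<in>M. mdeg a = mdeg m}" for m
  proof -
    let ?M = "{a\<in>M. mdeg a = mdeg m}"
    define m' where "m' = Max ?M"
    have fin': "finite ?M" "?M \<noteq> {}" using finM m by auto
    have m': "m' \<in> ?M" "\<And>a. a \<in> ?M \<Longrightarrow> a \<le> m'"
      unfolding m'_def using Max_in[OF fin'] Max_ge[OF fin'(1)] by blast+
    have ext: "a = m' \<and> b = m'" if a: "a \<in> M" and b: "b \<in> M" and eq: "a + b = m' + m'" for a b
    proof -
      have "mdeg a + mdeg b = 2 * mdeg m"
        using arg_cong[OF eq, of mdeg] m'(1) by (simp add: mdeg_add)
      then have "a \<le> m'" "b \<le> m'"
        using top[of a b] top[of b a] a b m'(2) by (auto simp: add.commute)
      then show ?thesis using eq
        by (metis add_le_cancel_right add_left_cancel add_left_mono add_right_cancel order_antisym)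
    qed
    have "Poly_Mapping.lookup (\<Sum>\<nu>\<in>N. (G \<nu>)\<^sup>2) (m' + m') = (\<Sum>\<nu>\<in>N. (Poly_Mapping.lookup (G \<nu>) m')\<^sup>2)"
      unfolding lookup_sum
      by (intro sum.cong refl lookup_square_extreme) (use ext in \<open>auto simp: M_def\<close>)
    moreover have "(\<Sum>\<nu>\<in>N. (Poly_Mapping.lookup (G \<nu>) m')\<^sup>2) \<noteq> 0"
      using m'(1) fin by (auto simp: sum_nonneg_eq_0_iff M_def in_keys_iff)
    ultimately have "m' + m' \<in> Poly_Mapping.keys (\<Sum>\<nu>\<in>N. (G \<nu>)\<^sup>2)" by (simp add: in_keys_iff)
    then have "mdeg (m' + m') = 2 * k" using hom by (simp add: homogeneous_iff)
    then show ?thesis using m'(1) by (simp add: mdeg_add)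
  qed
  have "mdeg m = k" if m: "m \<in> M" for m
  proof -
    have ne: "mdeg ` M \<noteq> {}" and finI: "finite (mdeg ` M)" using m finM by auto
    obtain u where u: "u \<in> M" "mdeg u = Max (mdeg ` M)" using Max_in[OF finI ne] by auto
    obtain w where w: "w \<in> M" "mdeg w = Min (mdeg ` M)" using Min_in[OF finI ne] by auto
    have ub: "mdeg a \<le> mdeg u" if "a \<in> M" for a using that finI u by simp
    have lb: "mdeg w \<le> mdeg a" if "a \<in> M" for a using that finI w by simp
    have "mdeg u = k"
    proof (rule key[OF u(1)])
      fix a b assume "a \<in> M" "b \<in> M" "mdeg a + mdeg b = 2 * mdeg u"
      then show "a \<in> {a\<in>M. mdeg a = mdeg u}" using ub[of a] ub[of b] by simp
    qed
    moreover have "mdeg w = k"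
    proof (rule key[OF w(1)])
      fix a b assume "a \<in> M" "b \<in> M" "mdeg a + mdeg b = 2 * mdeg w"
      then show "a \<in> {a\<in>M. mdeg a = mdeg w}" using lb[of a] lb[of b] by simp
    qed
    ultimately show ?thesis using ub[OF m] lb[OF m] by simp
  qed
  then show ?thesis using assms(3) by (auto simp: homogeneous_iff M_def)
qed

section \<open>Linear systems and independence of field homomorphisms\<close>

lemma underdetermined_system:
  fixes A :: "'e \<Rightarrow> 'b \<Rightarrow> 'f::field"
  assumes "finite E" "finite B" "card E < card B"
  obtains x where "\<exists>b\<in>B. x b \<noteq> 0" "\<And>e. e \<in> E \<Longrightarrow> (\<Sum>b\<in>B. A e b * x b) = 0"
proof -
  have "\<exists>x. (\<exists>b\<in>B. x b \<noteq> 0) \<and> (\<forall>e\<in>E. (\<Sum>b\<in>B. A e b * x b) = 0)"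
    using assms
  proof (induction E arbitrary: B A rule: finite_induct)
    case empty
    then obtain b where "b \<in> B" by (metis card.empty equals0I less_irrefl)
    then show ?case by (intro exI[of _ "\<lambda>_. 1"]) auto
  next
    case (insert e E)
    show ?case
    proof (cases "\<forall>b\<in>B. A e b = 0")
      case True
      have "card E < card B" using insert.prems insert.hyps by simp
      then obtain x where "\<exists>b\<in>B. x b \<noteq> 0" "\<forall>e\<in>E. (\<Sum>b\<in>B. A e b * x b) = 0"
        using insert.IH[of B A] insert.prems by blast
      with True show ?thesis by (intro exI[of _ x]) simp
    next
      case False
      then obtain c where c: "c \<in> B" "A e c \<noteq> 0" by blast
      define B' where "B' = B - {c}"
      have finB': "finite B'" and cB': "c \<notin> B'" and BB': "B = insert c B'"
        using insert.prems c by (auto simp: B'_def)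
      have "card E < card B'"
        using insert.prems insert.hyps finB' cB' by (simp add: BB')
      then obtain x where x: "\<exists>b\<in>B'. x b \<noteq> 0"
        "\<And>e'. e' \<in> E \<Longrightarrow> (\<Sum>b\<in>B'. (A e' b - A e' c * A e b / A e c) * x b) = 0"
        using insert.IH[of B' "\<lambda>e' b. A e' b - A e' c * A e b / A e c"] finB' by blast
      define y where "y = x(c := - (\<Sum>b\<in>B'. A e b * x b) / A e c)"
      have sum: "(\<Sum>b\<in>B. A e' b * y b) = A e' c * y c + (\<Sum>b\<in>B'. A e' b * x b)" for e'
      proof -
        have "(\<Sum>b\<in>B'. A e' b * y b) = (\<Sum>b\<in>B'. A e' b * x b)"
          using cB' by (intro sum.cong) (auto simp: y_def)
        then show ?thesis using finB' cB' by (simp add: BB')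
      qed
      have "(\<Sum>b\<in>B. A e' b * y b) = 0" if "e' \<in> insert e E" for e'
      proof (cases "e' = e")
        case True
        show ?thesis unfolding True sum using c by (simp add: y_def)
      next
        case False
        then have "0 = (\<Sum>b\<in>B'. (A e' b - A e' c * A e b / A e c) * x b)" using x(2) that by simp
        also have "\<dots> = (\<Sum>b\<in>B'. A e' b * x b - (A e' c / A e c) * (A e b * x b))"
          by (intro sum.cong) (auto simp: algebra_simps)
        also have "\<dots> = (\<Sum>b\<in>B'. A e' b * x b) - (A e' c / A e c) * (\<Sum>b\<in>B'. A e b * x b)"
          by (simp add: sum_subtractf sum_distrib_left)
        also have "\<dots> = (\<Sum>b\<in>B. A e' b * y b)" unfolding sum by (simp add: y_def)
        finally show ?thesis by simp
      qed
      moreover have "\<exists>b\<in>B. y b \<noteq> 0" using x(1) cB' by (auto simp: BB' y_def)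
      ultimately show ?thesis by blast
    qed
  qed
  then show ?thesis using that by blast
qed

text \<open>
  Dedekind's argument: subtracting \<open>\<psi>(y)\<close> times a relation from its translate by \<open>y\<close> removes the
  term of \<open>\<psi>\<close> and keeps that of every \<open>\<theta>\<close> with \<open>\<theta>(y) \<noteq> \<psi>(y)\<close>.
\<close>
lemma field_homs_independent:
  fixes x :: "('k::field \<Rightarrow> 'l::field) \<Rightarrow> 'l"
  assumes "finite S" "\<And>\<phi>. \<phi> \<in> S \<Longrightarrow> field_hom \<phi>" "\<And>z. (\<Sum>\<phi>\<in>S. x \<phi> * \<phi> z) = 0"
  shows "\<forall>\<phi>\<in>S. x \<phi> = 0"
  using assms
proof (induction S arbitrary: x rule: finite_induct)
  case (insert \<psi> S)
  have homS: "field_hom \<phi>" if "\<phi> \<in> insert \<psi> S" for \<phi> using that insert.prems(1) by blast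
  have xS: "x \<theta> = 0" if \<theta>: "\<theta> \<in> S" for \<theta>
  proof -
    have "\<theta> \<noteq> \<psi>" using \<theta> insert.hyps by blast
    then obtain y where y: "\<theta> y \<noteq> \<psi> y" by blast
    have "\<forall>\<phi>\<in>S. x \<phi> * (\<phi> y - \<psi> y) = 0"
    proof (rule insert.IH)
      fix z
      have "0 = (\<Sum>\<phi>\<in>insert \<psi> S. x \<phi> * \<phi> (y * z)) - \<psi> y * (\<Sum>\<phi>\<in>insert \<psi> S. x \<phi> * \<phi> z)"
        using insert.prems(2) by simp
      also have "\<dots> = (\<Sum>\<phi>\<in>insert \<psi> S. x \<phi> * (\<phi> y - \<psi> y) * \<phi> z)"
        unfolding sum_distrib_left sum_subtractf[symmetric]
        by (intro sum.cong) (auto simp: hom_mult[OF homS] algebra_simps)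
      also have "\<dots> = (\<Sum>\<phi>\<in>S. x \<phi> * (\<phi> y - \<psi> y) * \<phi> z)"
        using insert.hyps by simp
      finally show "(\<Sum>\<phi>\<in>S. x \<phi> * (\<phi> y - \<psi> y) * \<phi> z) = 0" by simp
    qed (use homS in auto)
    then have "x \<theta> * (\<theta> y - \<psi> y) = 0" using \<theta> by blast
    with y show ?thesis by simp
  qed
  moreover have "x \<psi> = 0"
    using insert.prems(2)[of 1] insert.hyps xS hom_one[OF homS[of \<psi>]] by simp
  ultimately show ?case by blast
qed auto

section \<open>Minimal polynomials over the rationals\<close>

definition rpoly :: "rat poly \<Rightarrow> 'a::field_char_0 \<Rightarrow> 'a" where
  "rpoly p x = poly (map_poly of_rat p) x"

lemma rpoly_0 [simp]: "rpoly 0 x = 0" by (simp add: rpoly_def)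

lemma rpoly_pCons: "rpoly (pCons c p) x = of_rat c + x * rpoly p x"
  by (cases "p = 0 \<and> c = 0") (auto simp: rpoly_def map_poly_pCons)

lemma rpoly_add: "rpoly (p + q) x = rpoly p x + rpoly q x"
proof -
  have "map_poly of_rat (p + q) = map_poly of_rat p + (map_poly of_rat q :: 'a poly)"
    by (rule poly_eqI) (simp add: coeff_map_poly of_rat_add)
  then show ?thesis by (simp add: rpoly_def)
qed

lemma rpoly_smult: "rpoly (smult c p) x = of_rat c * rpoly p x"
proof -
  have "map_poly of_rat (smult c p) = smult (of_rat c) (map_poly of_rat p :: 'a poly)"
    by (rule poly_eqI) (simp add: coeff_map_poly of_rat_mult)
  then show ?thesis by (simp add: rpoly_def)
qed

lemma rpoly_mult: "rpoly (p * q) x = rpoly p x * rpoly q x"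
  by (induction p) (simp_all add: rpoly_pCons rpoly_add rpoly_smult algebra_simps)

lemma rpoly_sum: "rpoly (\<Sum>i\<in>I. p i) x = (\<Sum>i\<in>I. rpoly (p i) x)"
  by (induction I rule: infinite_finite_induct) (auto simp: rpoly_add)

lemma rpoly_monom: "rpoly (monom c n) x = of_rat c * x ^ n"
  by (simp add: rpoly_def map_poly_monom poly_monom)

lemma rpoly_altdef: "rpoly p x = (\<Sum>i\<le>degree p. of_rat (coeff p i) * x ^ i)"
  unfolding rpoly_def poly_altdef by (simp add: coeff_map_poly degree_map_poly)

lemma hom_rpoly:
  fixes \<phi> :: "'k::field_char_0 \<Rightarrow> 'l::field_char_0"
  assumes "field_hom \<phi>"
  shows "\<phi> (rpoly p x) = rpoly p (\<phi> x)"
  by (simp add: rpoly_altdef hom_sum[OF assms] hom_mult[OF assms] hom_power[OF assms] hom_of_rat[OF assms])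

lemma algebraic_iff_rpoly: "algebraic (x::'a::field_char_0) \<longleftrightarrow> (\<exists>p. p \<noteq> 0 \<and> rpoly p x = 0)"
proof
  assume "\<exists>p. p \<noteq> 0 \<and> rpoly p x = 0"
  then obtain p where p: "p \<noteq> 0" "rpoly p x = 0" by blast
  then have "map_poly of_rat p \<noteq> (0 :: 'a poly)" by (simp add: map_poly_eq_0_iff)
  with p show "algebraic x"
    unfolding algebraic_altdef by (intro exI[of _ "map_poly of_rat p"]) (auto simp: coeff_map_poly rpoly_def)
next
  assume "algebraic x"
  then obtain p where p: "\<And>i. coeff p i \<in> \<int>" "p \<noteq> 0" "poly p x = 0" by (auto simp: algebraic_def)
  have "\<exists>r. coeff p i = of_rat r" for i
    using p(1)[of i] by (auto elim!: Ints_cases intro: exI[of _ "of_int _"])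
  then obtain r where r: "\<And>i. coeff p i = of_rat (r i)" by metis
  define q where "q = (\<Sum>i\<le>degree p. monom (r i) i)"
  have "rpoly q x = poly p x"
    by (simp add: q_def rpoly_sum rpoly_monom poly_altdef r)
  moreover have "q \<noteq> 0"
  proof
    assume "q = 0"
    then have "coeff q (degree p) = 0" by simp
    then have "r (degree p) = 0" by (simp add: q_def coeff_sum)
    then have "lead_coeff p = 0" by (simp add: r)
    with p show False by simp
  qed
  ultimately show "\<exists>p. p \<noteq> 0 \<and> rpoly p x = 0" using p by auto
qed

lemma minimal_polynomial_exists:
  fixes a :: "'a::field_char_0"
  assumes "algebraic a"
  obtains p where "p \<noteq> 0" "rpoly p a = 0" "\<And>q. q \<noteq> 0 \<Longrightarrow> rpoly q a = 0 \<Longrightarrow> degree p \<le> degree q"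
proof -
  define P where "P p \<longleftrightarrow> p \<noteq> 0 \<and> rpoly p a = 0" for p
  have "\<exists>p. P p" using assms by (simp add: algebraic_iff_rpoly P_def)
  then obtain p where "P p" "\<And>q. P q \<Longrightarrow> degree p \<le> degree q"
    using ex_has_least_nat[of P _ degree] by blast
  then show ?thesis using that by (auto simp: P_def)
qed

lemma rpoly_zero_imp_degree_pos: "p \<noteq> 0 \<Longrightarrow> rpoly p x = 0 \<Longrightarrow> degree p > 0"
  by (rule ccontr) (auto elim!: degree_eq_zeroE simp: rpoly_pCons)

lemma minimal_polynomial_dvd:
  assumes "p \<noteq> 0" "rpoly p a = 0" "\<And>q. q \<noteq> 0 \<Longrightarrow> rpoly q a = 0 \<Longrightarrow> degree p \<le> degree q"
    and "rpoly q a = 0"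
  shows "p dvd q"
proof -
  have "rpoly (q div p * p + q mod p) a = 0" using assms(4) by simp
  then have "rpoly (q mod p) a = 0" using assms(2) by (simp only: rpoly_add rpoly_mult) simp
  then have "q mod p = 0"
    using assms(3)[of "q mod p"] degree_mod_less[OF assms(1), of q] by fastforce
  then show ?thesis by (simp add: mod_eq_0_iff_dvd)
qed

text \<open>
  A common root \<open>z\<close> of \<open>p\<close> and its derivative would make the minimal polynomial \<open>r\<close> of \<open>z\<close> a proper
  divisor of \<open>p\<close>. But \<open>a\<close> is a root of \<open>r\<close> or of \<open>p / r\<close>, against the minimality of \<open>p\<close>. The
  numbers \<open>a\<close> and \<open>z\<close> may live in different fields.
\<close>
lemma minimal_polynomial_separable:
  fixes a :: "'k::field_char_0" and z :: "'l::field_char_0"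
  assumes p: "p \<noteq> 0" "rpoly p a = 0" "\<And>q. q \<noteq> 0 \<Longrightarrow> rpoly q a = 0 \<Longrightarrow> degree p \<le> degree q"
    and z: "rpoly p z = 0" "rpoly (pderiv p) z = 0"
  shows False
proof -
  have "algebraic z" using p z by (auto simp: algebraic_iff_rpoly)
  then obtain r where r: "r \<noteq> 0" "rpoly r z = 0" "\<And>q. q \<noteq> 0 \<Longrightarrow> rpoly q z = 0 \<Longrightarrow> degree r \<le> degree q"
    by (rule minimal_polynomial_exists) blast
  have degp: "degree p > 0" using rpoly_zero_imp_degree_pos p by blast
  have degr: "degree r > 0" using rpoly_zero_imp_degree_pos r by blast
  have "pderiv p \<noteq> 0" using degp by (simp add: pderiv_eq_0_iff)
  then have "degree r < degree p"
    using r(3)[OF _ z(2)] degp by (simp add: degree_pderiv)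
  obtain s where s: "p = r * s" using minimal_polynomial_dvd[OF r z(1)] by blast
  then have "s \<noteq> 0" and deg: "degree p = degree r + degree s"
    using p(1) by (auto simp: degree_mult_eq)
  have "rpoly r a = 0 \<or> rpoly s a = 0" using p(2) by (simp add: s rpoly_mult)
  then show False
    using p(3)[OF r(1)] p(3)[OF \<open>s \<noteq> 0\<close>] \<open>degree r < degree p\<close> degr deg by fastforce
qed

section \<open>Algebraic numbers\<close>

text \<open>
  Among the first \<open>card B + 1\<close> powers of \<open>x\<close>, written in terms of \<open>B\<close>, there is a linear relation.
\<close>
lemma algebraic_if_stable_span:
  fixes x :: "'a::field_char_0"
  assumes fin: "finite B" and one: "1 \<in> rat.span B" and stable: "\<And>y. y \<in> rat.span B \<Longrightarrow> x * y \<in> rat.span B"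
  shows "algebraic x"
proof -
  have "x ^ i \<in> rat.span B" for i
    by (induction i) (auto simp: one intro: stable)
  then have "\<exists>c. x ^ i = (\<Sum>b\<in>B. of_rat (c b) * b)" for i
    using rat.span_finite[OF fin] by auto
  then obtain c where c: "\<And>i. x ^ i = (\<Sum>b\<in>B. of_rat (c i b) * b)" by metis
  obtain u :: "nat \<Rightarrow> rat" where u: "\<exists>i\<in>{..card B}. u i \<noteq> 0" "\<And>b. b \<in> B \<Longrightarrow> (\<Sum>i\<le>card B. c i b * u i) = 0"
    using underdetermined_system[of B "{..card B}" "\<lambda>b i. c i b"] fin by auto
  define p where "p = (\<Sum>i\<le>card B. monom (u i) i)"
  have "rpoly p x = (\<Sum>i\<le>card B. of_rat (u i) * x ^ i)"
    by (simp add: p_def rpoly_sum rpoly_monom)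
  also have "\<dots> = (\<Sum>i\<le>card B. \<Sum>b\<in>B. of_rat (c i b * u i) * b)"
    unfolding c sum_distrib_left by (intro sum.cong) (auto simp: of_rat_mult mult_ac)
  also have "\<dots> = (\<Sum>b\<in>B. of_rat (\<Sum>i\<le>card B. c i b * u i) * b)"
    by (subst sum.swap) (simp add: hom_sum[OF field_hom_of_rat] sum_distrib_right)
  also have "\<dots> = 0" using u(2) by simp
  finally have "rpoly p x = 0" .
  moreover have "p \<noteq> 0"
  proof
    assume "p = 0"
    have "coeff p i = u i" if "i \<le> card B" for i using that by (simp add: p_def coeff_sum)
    with u(1) \<open>p = 0\<close> show False by fastforce
  qed
  ultimately show ?thesis by (auto simp: algebraic_iff_rpoly)
qed

lemma mult_in_span:
  assumes "\<And>b. b \<in> B \<Longrightarrow> x * b \<in> rat.span C" "y \<in> rat.span B"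
  shows "x * y \<in> rat.span C"
  using assms(2)
proof (induction rule: rat.span_induct_alt)
  case base then show ?case by (simp add: rat.span_zero)
next
  case (step c b y)
  have "x * (of_rat c * b + y) = of_rat c * (x * b) + x * y" by (simp add: algebra_simps)
  then show ?case using step assms(1) by (simp add: rat.span_add rat.span_scale)
qed

lemma algebraic_stable_span_exists:
  fixes x :: "'a::field_char_0"
  assumes "algebraic x"
  obtains B where "finite B" "1 \<in> rat.span B" "\<And>b. b \<in> B \<Longrightarrow> x * b \<in> rat.span B"
proof -
  obtain p where p: "p \<noteq> 0" "rpoly p x = 0" using assms by (auto simp: algebraic_iff_rpoly)
  define B where "B = (\<lambda>i. x ^ i) ` {..<degree p}"
  have degp: "degree p > 0" using rpoly_zero_imp_degree_pos p by blast
  have span: "rpoly f x \<in> rat.span B" for f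
  proof -
    have "rpoly f x = rpoly (f div p * p + f mod p) x" by simp
    also have "\<dots> = rpoly (f mod p) x" using p(2) by (simp only: rpoly_add rpoly_mult) simp
    also have "\<dots> = (\<Sum>i\<le>degree (f mod p). of_rat (coeff (f mod p) i) * x ^ i)" by (rule rpoly_altdef)
    also have "\<dots> \<in> rat.span B"
    proof (intro rat.span_sum rat.span_scale rat.span_base)
      fix i assume "i \<in> {..degree (f mod p)}"
      moreover have "degree (f mod p) < degree p"
        using degree_mod_less[OF p(1), of f] degp by auto
      ultimately show "x ^ i \<in> B" by (auto simp: B_def)
    qed
    finally show ?thesis .
  qed
  have pow: "x ^ i \<in> rat.span B" for i
    using span[of "monom 1 i"] by (simp add: rpoly_monom)
  show ?thesis
  proof (rule that[of B])
    show "finite B" by (simp add: B_def)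
    show "1 \<in> rat.span B" using pow[of 0] by simp
    show "x * b \<in> rat.span B" if "b \<in> B" for b
      using that pow[of "Suc _"] by (auto simp: B_def)
  qed
qed

text \<open>
  If multiplication by \<open>x\<close> preserves a finite-dimensional space and multiplication by \<open>y\<close> another
  one, then both preserve the space spanned by the products.
\<close>
lemma algebraic_add_mult:
  fixes x y :: "'a::field_char_0"
  assumes "algebraic x" "algebraic y"
  shows "algebraic (x + y)" "algebraic (x * y)"
proof -
  obtain B where B: "finite B" "1 \<in> rat.span B" "\<And>b. b \<in> B \<Longrightarrow> x * b \<in> rat.span B"
    using algebraic_stable_span_exists[OF assms(1)] by blast
  obtain C where C: "finite C" "1 \<in> rat.span C" "\<And>b. b \<in> C \<Longrightarrow> y * b \<in> rat.span C"
    using algebraic_stable_span_exists[OF assms(2)] by blast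
  define D where "D = (\<lambda>(b, c). b * c) ` (B \<times> C)"
  have prod: "u * v \<in> rat.span D" if u: "u \<in> rat.span B" and v: "v \<in> rat.span C" for u v
  proof (rule mult_in_span[OF _ v])
    fix c assume c: "c \<in> C"
    have "c * u \<in> rat.span D"
    proof (rule mult_in_span[OF _ u])
      fix b assume "b \<in> B"
      with c have "b * c \<in> D" by (auto simp: D_def)
      then show "c * b \<in> rat.span D" by (subst mult.commute) (rule rat.span_base)
    qed
    then show "u * c \<in> rat.span D" by (subst mult.commute)
  qed
  have finD: "finite D" using B C by (simp add: D_def)
  have one: "1 \<in> rat.span D" using prod[OF B(2) C(2)] by simp
  have x: "x * z \<in> rat.span D" if "z \<in> rat.span D" for z
  proof (rule mult_in_span[OF _ that])
    fix b assume "b \<in> D"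
    then obtain u v where "b = u * v" "u \<in> B" "v \<in> C" by (auto simp: D_def)
    then show "x * b \<in> rat.span D" using prod[OF B(3), of u v] by (simp add: rat.span_base mult.assoc)
  qed
  have y: "y * z \<in> rat.span D" if "z \<in> rat.span D" for z
  proof (rule mult_in_span[OF _ that])
    fix b assume "b \<in> D"
    then obtain u v where b: "b = u * v" "u \<in> B" "v \<in> C" by (auto simp: D_def)
    have yb: "y * b = u * (y * v)" by (simp add: b(1) mult_ac)
    show "y * b \<in> rat.span D" unfolding yb by (rule prod[OF rat.span_base C(3)]) (use b in auto)
  qed
  show "algebraic (x + y)" "algebraic (x * y)"
    by (rule algebraic_if_stable_span[OF finD one]; simp add: distrib_right rat.span_add x y mult.assoc)+
qed

lemma Qbar_of_rat: "of_rat q \<in> Qbar"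
  unfolding Qbar_def by (auto simp: algebraic_iff_rpoly intro!: exI[of _ "[:-q, 1:]"] simp: rpoly_pCons of_rat_minus)

lemma Qbar_add: "x \<in> Qbar \<Longrightarrow> y \<in> Qbar \<Longrightarrow> x + y \<in> Qbar"
  and Qbar_mult: "x \<in> Qbar \<Longrightarrow> y \<in> Qbar \<Longrightarrow> x * y \<in> Qbar"
  by (auto simp: Qbar_def algebraic_add_mult)

lemma Qbar_0: "0 \<in> Qbar" and Qbar_1: "1 \<in> Qbar"
  using Qbar_of_rat[of 0] Qbar_of_rat[of 1] by auto

lemma Qbar_diff: "x \<in> Qbar \<Longrightarrow> y \<in> Qbar \<Longrightarrow> x - y \<in> Qbar"
  using Qbar_add[of x "of_rat (-1) * y"] Qbar_mult[OF Qbar_of_rat[of "-1"], of y] by simp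

lemma Qbar_sum: "(\<And>x. x \<in> A \<Longrightarrow> g x \<in> Qbar) \<Longrightarrow> (\<Sum>x\<in>A. g x) \<in> Qbar"
  by (induction A rule: infinite_finite_induct) (auto simp: Qbar_0 Qbar_add)

lemma Qbar_prod: "(\<And>x. x \<in> A \<Longrightarrow> g x \<in> Qbar) \<Longrightarrow> (\<Prod>x\<in>A. g x) \<in> Qbar"
  by (induction A rule: infinite_finite_induct) (auto simp: Qbar_1 Qbar_mult)

lemma Qbar_power: "x \<in> Qbar \<Longrightarrow> x ^ n \<in> Qbar"
  by (induction n) (auto simp: Qbar_1 Qbar_mult)

text \<open>
  Elements of the Galois group are functions on all of \<open>\<complex>\<close> that respect the operations only on
  \<open>Qbar\<close>, so membership in \<open>Qbar\<close> has to be carried along.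
\<close>

context
  fixes \<sigma> assumes \<sigma>: "\<sigma> \<in> Gal_Qbar"
begin

lemma Gal_add: "x \<in> Qbar \<Longrightarrow> y \<in> Qbar \<Longrightarrow> \<sigma> (x + y) = \<sigma> x + \<sigma> y"
  and Gal_mult: "x \<in> Qbar \<Longrightarrow> y \<in> Qbar \<Longrightarrow> \<sigma> (x * y) = \<sigma> x * \<sigma> y"
  and Gal_of_rat: "\<sigma> (of_rat q) = of_rat q"
  and Gal_in_Qbar: "x \<in> Qbar \<Longrightarrow> \<sigma> x \<in> Qbar"
  and Gal_inj: "inj_on \<sigma> Qbar"
  using \<sigma> by (auto simp: Gal_Qbar_def bij_betw_def)

lemma Gal_0: "\<sigma> 0 = 0" and Gal_1: "\<sigma> 1 = 1"
  using Gal_of_rat[of 0] Gal_of_rat[of 1] by auto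

lemma Gal_sum: "(\<And>x. x \<in> A \<Longrightarrow> g x \<in> Qbar) \<Longrightarrow> \<sigma> (\<Sum>x\<in>A. g x) = (\<Sum>x\<in>A. \<sigma> (g x))"
  by (induction A rule: infinite_finite_induct) (auto simp: Gal_0 Gal_add Qbar_sum)

lemma Gal_prod: "(\<And>x. x \<in> A \<Longrightarrow> g x \<in> Qbar) \<Longrightarrow> \<sigma> (\<Prod>x\<in>A. g x) = (\<Prod>x\<in>A. \<sigma> (g x))"
  by (induction A rule: infinite_finite_induct) (auto simp: Gal_1 Gal_mult Qbar_prod)

lemma Gal_power: "x \<in> Qbar \<Longrightarrow> \<sigma> (x ^ n) = \<sigma> x ^ n"
  by (induction n) (auto simp: Gal_1 Gal_mult Qbar_power)

lemma Gal_eval_rational: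
  fixes G :: "('i::finite, rat) mpoly"
  assumes "\<And>i. w $ i \<in> Qbar"
  shows "\<sigma> (eval_mpoly (map_mpoly of_rat G) w) = eval_mpoly (map_mpoly of_rat G) (\<chi> i. \<sigma> (w $ i))"
proof -
  have 1: "(w $ i) ^ n \<in> Qbar" for i n using assms by (simp add: Qbar_power)
  then have 2: "(\<Prod>i\<in>UNIV. (w $ i) ^ n i) \<in> Qbar" for n by (simp add: Qbar_prod)
  show ?thesis
    unfolding eval_mpoly_def keys_map_mpoly[OF field_hom_of_rat] lookup_map_mpoly[OF field_hom_of_rat]
    by (simp add: Gal_sum Gal_mult Gal_prod Gal_power Gal_of_rat Qbar_mult Qbar_of_rat assms 1 2)
qed

lemma Gal_comp_embedding:
  assumes "\<phi> \<in> embeddings"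
  shows "\<sigma> \<circ> \<phi> \<in> embeddings"
proof -
  have hom: "field_hom \<phi>" and Q: "\<phi> x \<in> Qbar" for x using assms by (auto simp: embeddings_def)
  then show ?thesis
    by (auto simp: embeddings_def field_hom_def[of "\<sigma> \<circ> \<phi>"] Gal_add Gal_mult Gal_1 Gal_in_Qbar
        hom_add[OF hom] hom_mult[OF hom] hom_one[OF hom])
qed

end

section \<open>Embeddings of a number field\<close>

lemma number_field_basis:
  assumes "number_field TYPE('k::field_char_0)"
  obtains B :: "'k::field_char_0 set" where "finite B" "rat.independent B" "rat.span B = UNIV" "card B = field_degree TYPE('k)"
proof -
  obtain S :: "'k set" where S: "finite S" "rat.span S = UNIV" using assms by (auto simp: number_field_def)
  obtain B :: "'k set" where B: "rat.independent B" "UNIV \<subseteq> rat.span B" "card B = rat.dim (UNIV :: 'k set)"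
    using rat.basis_exists by blast
  have "finite B" using rat.independent_span_bound[OF S(1) B(1)] S(2) by simp
  with B that show ?thesis by (auto simp: field_degree_def)
qed

lemma number_field_algebraic:
  assumes "number_field TYPE('k::field_char_0)"
  shows "algebraic (a::'k)"
proof -
  obtain S :: "'k set" where "finite S" "rat.span S = UNIV" using assms by (auto simp: number_field_def)
  then show ?thesis by (intro algebraic_if_stable_span[of S]) auto
qed

lemma field_hom_in_embeddings:
  assumes "number_field TYPE('k::field_char_0)" "field_hom (\<phi> :: 'k \<Rightarrow> complex)"
  shows "\<phi> \<in> embeddings"
proof -
  have "\<phi> x \<in> Qbar" for x
  proof -
    obtain p where p: "p \<noteq> 0" "rpoly p x = 0"
      using number_field_algebraic[OF assms(1)] by (auto simp: algebraic_iff_rpoly)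
    then have "rpoly p (\<phi> x) = 0"
      using hom_rpoly[OF assms(2), of p x] by (simp add: hom_zero[OF assms(2)])
    with p show ?thesis by (auto simp: Qbar_def algebraic_iff_rpoly)
  qed
  with assms(2) show ?thesis by (auto simp: embeddings_def)
qed

lemma embeddingsD: "\<phi> \<in> embeddings \<Longrightarrow> field_hom \<phi>"
  by (simp add: embeddings_def)

definition Q_linear :: "('k::field_char_0 \<Rightarrow> complex) \<Rightarrow> bool" where
  "Q_linear \<omega> \<longleftrightarrow> (\<forall>x y. \<omega> (x + y) = \<omega> x + \<omega> y) \<and> (\<forall>q x. \<omega> (of_rat q * x) = of_rat q * \<omega> x)"

text \<open>
  The \<open>K\<close>-linear structure of \<open>Hom\<^sub>\<rat>(K, \<complex>)\<close>, in which \<open>a\<close> acts by \<open>\<omega> \<mapsto> \<omega>(a \<cdot>)\<close>: this is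
  \<open>q(a) \<omega>\<close> for a complex polynomial \<open>q\<close>.
\<close>
definition poly_act :: "complex poly \<Rightarrow> 'k \<Rightarrow> ('k \<Rightarrow> complex) \<Rightarrow> 'k::field_char_0 \<Rightarrow> complex" where
  "poly_act q a \<omega> x = (\<Sum>i\<le>degree q. coeff q i * \<omega> (a ^ i * x))"

lemma poly_act_superset:
  assumes "degree q \<le> n"
  shows "poly_act q a \<omega> x = (\<Sum>i\<le>n. coeff q i * \<omega> (a ^ i * x))"
  unfolding poly_act_def
  by (rule sum.mono_neutral_left) (use assms in \<open>auto simp: coeff_eq_0\<close>)

lemma poly_act_linear_factor:
  "poly_act ([:-r, 1:] * q) a \<omega> x = poly_act q a (\<lambda>y. \<omega> (a * y) - r * \<omega> y) x"
proof -
  define n where "n = Suc (degree q)"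
  have "degree ([:-r, 1:] * q) \<le> degree [:-r, 1:] + degree q" by (rule degree_mult_le)
  then have d: "degree ([:-r, 1:] * q) \<le> n" by (simp add: n_def)
  have c: "coeff ([:-r, 1:] * q) i = (case i of 0 \<Rightarrow> 0 | Suc j \<Rightarrow> coeff q j) - r * coeff q i" for i
    by (simp add: coeff_pCons algebra_simps split: nat.split)
  have "poly_act ([:-r, 1:] * q) a \<omega> x =
     (\<Sum>i\<le>n. (case i of 0 \<Rightarrow> 0 | Suc j \<Rightarrow> coeff q j) * \<omega> (a ^ i * x)) - r * (\<Sum>i\<le>n. coeff q i * \<omega> (a ^ i * x))"
    unfolding poly_act_superset[OF d] c by (simp add: sum_subtractf sum_distrib_left algebra_simps)
  also have "(\<Sum>i\<le>n. (case i of 0 \<Rightarrow> 0 | Suc j \<Rightarrow> coeff q j) * \<omega> (a ^ i * x)) =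
     (\<Sum>i\<le>degree q. coeff q i * \<omega> (a * (a ^ i * x)))"
    unfolding n_def by (subst sum.atMost_Suc_shift) (simp add: mult_ac)
  also have "(\<Sum>i\<le>n. coeff q i * \<omega> (a ^ i * x)) = (\<Sum>i\<le>degree q. coeff q i * \<omega> (a ^ i * x))"
    by (simp add: n_def coeff_eq_0)
  also have "(\<Sum>i\<le>degree q. coeff q i * \<omega> (a * (a ^ i * x))) - r * (\<Sum>i\<le>degree q. coeff q i * \<omega> (a ^ i * x))
     = poly_act q a (\<lambda>y. \<omega> (a * y) - r * \<omega> y) x"
    unfolding poly_act_def by (simp add: sum_subtractf sum_distrib_left algebra_simps)
  finally show ?thesis .
qed

text \<open>
  The step of a simultaneous diagonalization: \<open>U\<close> is to be a joint eigenspace of the operators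
  diagonalized before, and it splits further because \<open>a\<close> commutes with them and is annihilated by a
  product of distinct linear factors.
\<close>
lemma eigen_decomposition:
  fixes a :: "'k::field_char_0" and U :: "('k \<Rightarrow> complex) set"
  assumes "finite S" "\<omega> \<in> U"
    and "\<And>x. poly_act (\<Prod>r\<in>S. [:-r, 1:]) a \<omega> x = 0"
    and comb: "\<And>\<mu> \<nu> c. \<mu> \<in> U \<Longrightarrow> \<nu> \<in> U \<Longrightarrow> (\<lambda>x. \<mu> x + c * \<nu> x) \<in> U"
    and stable: "\<And>\<mu>. \<mu> \<in> U \<Longrightarrow> (\<lambda>x. \<mu> (a * x)) \<in> U"
  shows "\<exists>\<mu>. (\<forall>r\<in>S. \<mu> r \<in> U \<and> (\<forall>x. \<mu> r (a * x) = r * \<mu> r x)) \<and> (\<forall>x. \<omega> x = (\<Sum>r\<in>S. \<mu> r x))"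
  using assms(1-3)
proof (induction S arbitrary: \<omega> rule: finite_induct)
  case empty
  then show ?case by (simp add: poly_act_def)
next
  case (insert s S)
  have sumU: "(\<lambda>x. \<nu> x + (\<Sum>r\<in>T. c r * \<mu> r x)) \<in> U" if "finite T" "\<nu> \<in> U" "\<forall>r\<in>T. \<mu> r \<in> U" for T \<nu> c and \<mu> :: "complex \<Rightarrow> _"
    using that
  proof (induction T rule: finite_induct)
    case (insert t T)
    then show ?case using comb[of "\<lambda>x. \<nu> x + (\<Sum>r\<in>T. c r * \<mu> r x)" "\<mu> t" "c t"]
      by (simp add: algebra_simps)
  qed simp
  define \<omega>' where "\<omega>' = (\<lambda>x. \<omega> (a * x) - s * \<omega> x)"
  have "\<omega>' \<in> U" using comb[OF stable, OF insert.prems(1) insert.prems(1), of "-s"] by (simp add: \<omega>'_def)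
  moreover have "poly_act (\<Prod>r\<in>S. [:-r, 1:]) a \<omega>' x = 0" for x
    using insert.prems(2)[of x] insert.hyps
    by (simp only: prod.insert[OF insert.hyps] poly_act_linear_factor \<omega>'_def)
  ultimately obtain \<mu> where \<mu>: "\<forall>r\<in>S. \<mu> r \<in> U \<and> (\<forall>x. \<mu> r (a * x) = r * \<mu> r x)"
    "\<And>x. \<omega>' x = (\<Sum>r\<in>S. \<mu> r x)" using insert.IH by blast
  \<comment> \<open>On the \<open>r\<close>-eigenspace the operator \<open>a - s\<close> is multiplication by \<open>r - s\<close>, so this correction
    makes \<open>a - s\<close> kill the remainder.\<close>
  define \<kappa> where "\<kappa> r = (\<lambda>x. 1 / (r - s) * \<mu> r x)" for r
  define \<kappa>s where "\<kappa>s = (\<lambda>x. \<omega> x + (\<Sum>r\<in>S. (-1 / (r - s)) * \<mu> r x))"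
  have sub: "\<kappa>s x = \<omega> x - (\<Sum>r\<in>S. \<kappa> r x)" for x
    by (simp add: \<kappa>s_def \<kappa>_def sum_negf)
  have zero: "(\<lambda>x. 0) \<in> U" using comb[OF insert.prems(1) insert.prems(1), of "-1"] by simp
  have "\<kappa> r \<in> U" if "r \<in> S" for r
    using comb[OF zero, of "\<mu> r" "1 / (r - s)"] \<mu>(1) that by (simp add: \<kappa>_def)
  moreover have "\<kappa> r (a * x) = r * \<kappa> r x" if "r \<in> S" for r x
    using \<mu>(1) that by (simp add: \<kappa>_def)
  moreover have "\<kappa>s \<in> U" unfolding \<kappa>s_def using insert \<mu>(1) by (intro sumU) auto
  moreover have "\<kappa>s (a * x) = s * \<kappa>s x" for x
  proof -
    have "(\<Sum>r\<in>S. \<kappa> r (a * x)) - s * (\<Sum>r\<in>S. \<kappa> r x) = (\<Sum>r\<in>S. \<mu> r x)"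
      unfolding sum_distrib_left sum_subtractf[symmetric]
    proof (intro sum.cong refl)
      fix r assume r: "r \<in> S"
      then have "r - s \<noteq> 0" using insert.hyps by auto
      then show "\<kappa> r (a * x) - s * \<kappa> r x = \<mu> r x"
      proof -
        have 1: "\<mu> r (a * x) = r * \<mu> r x" using \<mu>(1) r by blast
        have "\<kappa> r (a * x) - s * \<kappa> r x = ((r - s) * (1 / (r - s))) * \<mu> r x"
          unfolding \<kappa>_def 1 by (simp only: algebra_simps)
        with \<open>r - s \<noteq> 0\<close> show ?thesis by simp
      qed
    qed
    then show ?thesis using \<mu>(2)[of x] by (simp add: sub \<omega>'_def algebra_simps)
  qed
  moreover have "\<omega> x = (\<Sum>r\<in>insert s S. (\<kappa>(s := \<kappa>s)) r x)" for x
  proof -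
    have "(\<Sum>r\<in>S. (\<kappa>(s := \<kappa>s)) r x) = (\<Sum>r\<in>S. \<kappa> r x)"
      using insert.hyps by (intro sum.cong) auto
    then show ?thesis using insert.hyps by (simp add: sub)
  qed
  ultimately show ?case by (intro exI[of _ "\<kappa>(s := \<kappa>s)"]) auto
qed

text \<open>
  The minimal polynomial of \<open>a\<close> is separable, and being rational it kills every rational-linear map.
\<close>
lemma annihilating_product:
  fixes a :: "'k::field_char_0"
  assumes "algebraic a"
  obtains S where "finite S" "\<And>\<omega> x. Q_linear \<omega> \<Longrightarrow> poly_act (\<Prod>r\<in>S. [:-r, 1:]) a \<omega> x = 0"
proof -
  obtain p where p: "p \<noteq> 0" "rpoly p a = 0" "\<And>q. q \<noteq> 0 \<Longrightarrow> rpoly q a = 0 \<Longrightarrow> degree p \<le> degree q"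
    using minimal_polynomial_exists[OF assms] by blast
  define P :: "complex poly" where "P = map_poly of_rat p"
  have P0: "P \<noteq> 0" using p(1) by (simp add: P_def map_poly_eq_0_iff)
  have "pderiv P = map_poly of_rat (pderiv p)"
    by (rule poly_eqI) (simp add: P_def coeff_pderiv coeff_map_poly of_rat_mult of_rat_add)
  then have "rsquarefree P"
    using minimal_polynomial_separable[OF p, where ?'l = complex]
    by (auto simp: rsquarefree_roots P_def rpoly_def)
  then have dec: "smult (lead_coeff P) (\<Prod>r | poly P r = 0. [:-r, 1:]) = P"
    by (rule complex_poly_decompose_rsquarefree)
  have "poly_act (\<Prod>r | poly P r = 0. [:-r, 1:]) a \<omega> x = 0" (is "poly_act ?q a \<omega> x = 0") if \<omega>: "Q_linear \<omega>" for \<omega> x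
  proof -
    have sum: "\<omega> (\<Sum>i\<in>I. g i) = (\<Sum>i\<in>I. \<omega> (g i))" if "finite I" for g and I :: "nat set"
    proof -
      have "\<omega> 0 = 0" using \<omega> unfolding Q_linear_def by (metis mult_zero_left of_rat_0)
      with that \<omega> show ?thesis by (induction I rule: finite_induct) (auto simp: Q_linear_def)
    qed
    have "lead_coeff P * poly_act ?q a \<omega> x = poly_act (smult (lead_coeff P) ?q) a \<omega> x"
      using P0 by (simp add: poly_act_def sum_distrib_left mult_ac)
    also have "\<dots> = poly_act P a \<omega> x" by (simp only: dec)
    also have "\<dots> = (\<Sum>i\<le>degree p. \<omega> (of_rat (coeff p i) * (a ^ i * x)))"
      using \<omega> by (simp add: poly_act_def P_def coeff_map_poly degree_map_poly Q_linear_def)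
    also have "\<dots> = \<omega> (rpoly p a * x)"
      by (simp add: sum[symmetric] rpoly_altdef sum_distrib_right mult.assoc)
    also have "\<dots> = \<omega> (of_rat 0 * x)" by (simp add: p(2))
    also have "\<dots> = 0" using \<omega> by (simp only: Q_linear_def) simp
    finally show ?thesis using P0 by simp
  qed
  then show ?thesis using that[of "{r. poly P r = 0}"] poly_roots_finite[OF P0] by blast
qed

text \<open>
  The eigenvalues of the elements of \<open>K\<close> on a joint eigenfunction depend on the element additively
  and multiplicatively, so they form an embedding.
\<close>
lemma joint_eigenfunction_is_embedding:
  fixes \<mu> :: "'k::field_char_0 \<Rightarrow> complex"
  assumes nf: "number_field TYPE('k)" and span: "rat.span B = (UNIV :: 'k set)"
    and lin: "Q_linear \<mu>" and eig: "\<And>b. b \<in> B \<Longrightarrow> \<exists>r. \<forall>x. \<mu> (b * x) = r * \<mu> x" and nz: "\<mu> x0 \<noteq> 0"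
  obtains \<phi> where "\<phi> \<in> embeddings" "\<And>x. \<mu> x = \<mu> 1 * \<phi> x"
proof -
  have all: "\<exists>r. \<forall>x. \<mu> (y * x) = r * \<mu> x" for y
  proof -
    have "y \<in> rat.span B" using span by simp
    then show ?thesis
    proof (induction rule: rat.span_induct_alt)
      case base
      have "\<mu> 0 = 0" using lin unfolding Q_linear_def by (metis mult_zero_left of_rat_0)
      then show ?case by (intro exI[of _ 0]) simp
    next
      case (step c b y)
      obtain r where r: "\<And>x. \<mu> (b * x) = r * \<mu> x" using eig[OF step(1)] by blast
      obtain s where s: "\<And>x. \<mu> (y * x) = s * \<mu> x" using step(2) by blast
      have "\<mu> ((of_rat c * b + y) * x) = (of_rat c * r + s) * \<mu> x" for x
      proof -
        have "(of_rat c * b + y) * x = of_rat c * (b * x) + y * x" by (simp add: algebra_simps)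
        then have "\<mu> ((of_rat c * b + y) * x) = of_rat c * \<mu> (b * x) + \<mu> (y * x)"
          using lin by (simp add: Q_linear_def)
        then show ?thesis by (simp add: r s distrib_right mult.assoc)
      qed
      then show ?case by blast
    qed
  qed
  then obtain r where r: "\<And>y x. \<mu> (y * x) = r y * \<mu> x" by metis
  have m1: "\<mu> 1 \<noteq> 0" using nz r[of x0 1] by auto
  have rr: "\<mu> y = r y * \<mu> 1" for y using r[of y 1] by simp
  have "field_hom r"
    unfolding field_hom_def
  proof (intro conjI allI)
    show "r 1 = 1" using rr[of 1] m1 by simp
    fix x y
    have "r (x + y) * \<mu> 1 = (r x + r y) * \<mu> 1"
      using lin by (simp add: Q_linear_def rr[symmetric] distrib_right)
    then show "r (x + y) = r x + r y" using m1 by simp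
    have "r (x * y) * \<mu> 1 = (r x * r y) * \<mu> 1"
      using r[of x y] by (simp add: rr[symmetric] mult.assoc)
    then show "r (x * y) = r x * r y" using m1 by simp
  qed
  then have "r \<in> embeddings" by (rule field_hom_in_embeddings[OF nf])
  moreover have "\<mu> x = \<mu> 1 * r x" for x using rr[of x] by (simp only: mult.commute)
  ultimately show ?thesis by (rule that)
qed

text \<open>
  More embeddings than the degree would satisfy a linear relation on a basis of \<open>K\<close>, hence on
  all of \<open>K\<close>, and this contradicts their independence.
\<close>
lemma embeddings_card_le:
  assumes nf: "number_field TYPE('k::field_char_0)"
  shows "finite (embeddings :: ('k \<Rightarrow> complex) set) \<and> card (embeddings :: ('k \<Rightarrow> complex) set) \<le> field_degree TYPE('k)"
proof (rule finite_if_finite_subsets_card_bdd)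
  fix S :: "('k \<Rightarrow> complex) set" assume S: "S \<subseteq> embeddings" "finite S"
  obtain B :: "'k set" where B: "finite B" "rat.independent B" "rat.span B = UNIV" "card B = field_degree TYPE('k)"
    by (rule number_field_basis[OF nf])
  show "card S \<le> field_degree TYPE('k)"
  proof (rule ccontr)
    assume "\<not> ?thesis"
    then have "card B < card S" using B by simp
    then obtain x where x: "\<exists>\<phi>\<in>S. x \<phi> \<noteq> 0" "\<And>b. b \<in> B \<Longrightarrow> (\<Sum>\<phi>\<in>S. \<phi> b * x \<phi>) = 0"
      using underdetermined_system[of B S "\<lambda>b \<phi>. \<phi> b"] B(1) S(2) by blast
    have homS: "field_hom \<phi>" if "\<phi> \<in> S" for \<phi> using S(1) that embeddingsD by blast
    have "(\<Sum>\<phi>\<in>S. x \<phi> * \<phi> z) = 0" for z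
    proof -
      have "z \<in> rat.span B" using B by simp
      then show ?thesis
      proof (induction rule: rat.span_induct_alt)
        case base then show ?case by (simp add: hom_zero[OF homS])
      next
        case (step c b y)
        have "(\<Sum>\<phi>\<in>S. x \<phi> * \<phi> (of_rat c * b + y)) = of_rat c * (\<Sum>\<phi>\<in>S. \<phi> b * x \<phi>) + (\<Sum>\<phi>\<in>S. x \<phi> * \<phi> y)"
          unfolding sum_distrib_left sum.distrib[symmetric]
          by (intro sum.cong) (auto simp: hom_add[OF homS] hom_mult[OF homS] hom_of_rat[OF homS] algebra_simps)
        then show ?case using x(2)[OF step(1)] step(2) by simp
      qed
    qed
    then have "\<forall>\<phi>\<in>S. x \<phi> = 0" using field_homs_independent[OF S(2)] homS by blast
    with x(1) show False by blast
  qed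
qed

text \<open>
  The multiplications by elements of \<open>K\<close> are commuting diagonalizable operators on \<open>Hom\<^sub>\<rat>(K, \<complex>)\<close>.
  Diagonalizing them simultaneously, one basis element at a time, decomposes every map into joint
  eigenfunctions, and these are multiples of embeddings.
\<close>
lemma embeddings_span:
  fixes \<omega> :: "'k::field_char_0 \<Rightarrow> complex"
  assumes nf: "number_field TYPE('k)" and "Q_linear \<omega>"
  obtains c where "\<And>x. \<omega> x = (\<Sum>\<phi>\<in>embeddings. c \<phi> * \<phi> x)"
proof -
  let ?E = "embeddings :: ('k \<Rightarrow> complex) set"
  have finE: "finite ?E" using embeddings_card_le[OF nf] by blast
  obtain B :: "'k set" where B: "finite B" "rat.independent B" "rat.span B = UNIV" "card B = field_degree TYPE('k)"
    by (rule number_field_basis[OF nf])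
  define Sp where "Sp = {\<omega>. \<exists>c. \<forall>x. \<omega> x = (\<Sum>\<phi>\<in>?E. c \<phi> * \<phi> x)}"
  have zero: "(\<lambda>x. 0) \<in> Sp" by (auto simp: Sp_def intro: exI[of _ "\<lambda>_. 0"])
  have add: "(\<lambda>x. \<mu> x + \<nu> x) \<in> Sp" if "\<mu> \<in> Sp" "\<nu> \<in> Sp" for \<mu> \<nu>
  proof -
    obtain c where c: "\<And>x. \<mu> x = (\<Sum>\<phi>\<in>?E. c \<phi> * \<phi> x)" using \<open>\<mu> \<in> Sp\<close> by (auto simp: Sp_def)
    obtain e where e: "\<And>x. \<nu> x = (\<Sum>\<phi>\<in>?E. e \<phi> * \<phi> x)" using \<open>\<nu> \<in> Sp\<close> by (auto simp: Sp_def)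
    show ?thesis unfolding Sp_def
      by (auto simp: c e sum.distrib distrib_right intro!: exI[of _ "\<lambda>\<phi>. c \<phi> + e \<phi>"])
  qed
  have sum: "(\<lambda>x. \<Sum>r\<in>S. \<mu> r x) \<in> Sp" if "finite S" "\<forall>r\<in>S. \<mu> r \<in> Sp" for S :: "complex set" and \<mu>
    using that
  proof (induction S rule: finite_induct)
    case empty then show ?case using zero by simp
  next
    case (insert s S) then show ?case using add[of "\<mu> s" "\<lambda>x. \<Sum>r\<in>S. \<mu> r x"] by simp
  qed
  have "\<mu> \<in> Sp" if "finite A" "Q_linear \<mu>" "\<forall>b\<in>B - A. \<exists>r. \<forall>x. \<mu> (b * x) = r * \<mu> x" for A \<mu>
    using that
  proof (induction A arbitrary: \<mu> rule: finite_induct)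
    case empty
    show ?case
    proof (cases "\<forall>x. \<mu> x = 0")
      case True
      then have "\<mu> = (\<lambda>x. 0)" by auto
      then show ?thesis using zero by simp
    next
      case False
      then obtain x0 where "\<mu> x0 \<noteq> 0" by blast
      then obtain \<phi> where \<phi>: "\<phi> \<in> ?E" "\<And>x. \<mu> x = \<mu> 1 * \<phi> x"
        using joint_eigenfunction_is_embedding[OF nf B(3) empty(1)] empty(2) by auto
      have "(\<Sum>\<psi>\<in>?E. (if \<psi> = \<phi> then \<mu> 1 else 0) * \<psi> x) = (\<Sum>\<psi>\<in>?E. if \<psi> = \<phi> then \<mu> 1 * \<phi> x else 0)" for x
        by (intro sum.cong) auto
      then have S: "(\<Sum>\<psi>\<in>?E. (if \<psi> = \<phi> then \<mu> 1 else 0) * \<psi> x) = \<mu> 1 * \<phi> x" for x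
        using \<phi>(1) finE by simp
      have "\<forall>x. \<mu> x = (\<Sum>\<psi>\<in>?E. (if \<psi> = \<phi> then \<mu> 1 else 0) * \<psi> x)"
        by (intro allI) (rule trans[OF \<phi>(2) S[symmetric]])
      then show ?thesis unfolding Sp_def
        by (intro CollectI exI[of _ "\<lambda>\<psi>. if \<psi> = \<phi> then \<mu> 1 else 0"])
    qed
  next
    case (insert a A)
    obtain S where S: "finite S" "\<And>\<omega> x. Q_linear \<omega> \<Longrightarrow> poly_act (\<Prod>r\<in>S. [:-r, 1:]) a \<omega> x = 0"
      using annihilating_product[OF number_field_algebraic[OF nf]] by blast
    obtain \<rho> where \<rho>: "\<And>b x. b \<in> B - insert a A \<Longrightarrow> \<mu> (b * x) = \<rho> b * \<mu> x"
      using insert.prems(2) by metis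
    define U where "U = {\<nu>. Q_linear \<nu> \<and> (\<forall>b\<in>B - insert a A. \<forall>x. \<nu> (b * x) = \<rho> b * \<nu> x)}"
    have "\<exists>\<kappa>. (\<forall>r\<in>S. \<kappa> r \<in> U \<and> (\<forall>x. \<kappa> r (a * x) = r * \<kappa> r x)) \<and> (\<forall>x. \<mu> x = (\<Sum>r\<in>S. \<kappa> r x))"
    proof (rule eigen_decomposition[OF S(1)])
      show "\<mu> \<in> U" using insert.prems \<rho> by (simp add: U_def)
      show "poly_act (\<Prod>r\<in>S. [:- r, 1:]) a \<mu> x = 0" for x by (rule S(2)[OF insert.prems(1)])
      show "(\<lambda>x. \<nu> x + c * \<kappa> x) \<in> U" if "\<nu> \<in> U" "\<kappa> \<in> U" for \<nu> \<kappa> c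
        using that by (auto simp: U_def Q_linear_def algebra_simps)
      show "(\<lambda>x. \<nu> (a * x)) \<in> U" if \<nu>: "\<nu> \<in> U" for \<nu>
      proof -
        have 1: "a * (of_rat q * x) = of_rat q * (a * x)" "a * (b * x) = b * (a * x)" for q b x
          by (simp_all add: mult_ac)
        show ?thesis using \<nu> unfolding U_def Q_linear_def mem_Collect_eq 1 distrib_left by blast
      qed
    qed
    then obtain \<kappa> where \<kappa>: "\<And>r. r \<in> S \<Longrightarrow> \<kappa> r \<in> U" "\<And>r x. r \<in> S \<Longrightarrow> \<kappa> r (a * x) = r * \<kappa> r x"
      "\<And>x. \<mu> x = (\<Sum>r\<in>S. \<kappa> r x)" by blast
    have "\<kappa> r \<in> Sp" if r: "r \<in> S" for r
    proof (rule insert.IH)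
      show "Q_linear (\<kappa> r)" using \<kappa>(1)[OF r] by (simp add: U_def)
      show "\<forall>b\<in>B - A. \<exists>r'. \<forall>x. \<kappa> r (b * x) = r' * \<kappa> r x"
      proof
        fix b assume "b \<in> B - A"
        then show "\<exists>r'. \<forall>x. \<kappa> r (b * x) = r' * \<kappa> r x"
          using \<kappa>(1)[OF r] \<kappa>(2)[OF r] by (cases "b = a") (auto simp: U_def)
      qed
    qed
    then have "(\<lambda>x. \<Sum>r\<in>S. \<kappa> r x) \<in> Sp" using sum S(1) by blast
    then show ?case using \<kappa>(3) by presburger
  qed
  from this[OF B(1) assms(2)] have "\<omega> \<in> Sp" by simp
  then show ?thesis using that by (auto simp: Sp_def)
qed

lemma Q_linear_coordinate:
  assumes "rat.independent B" "rat.span B = (UNIV :: 'k::field_char_0 set)"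
  shows "Q_linear (\<lambda>x :: 'k. of_rat (rat.representation B x b))"
  using rat.representation_add[OF assms(1)] rat.representation_scale[OF assms(1)] assms(2)
  by (simp add: Q_linear_def of_rat_add of_rat_mult)

text \<open>
  The coordinate functions of a basis \<open>B\<close> are combinations of the embeddings. If there were fewer
  embeddings than basis elements, there would be a nonzero vector \<open>x\<close> indexed by \<open>B\<close> that is orthogonal to all of
  them on \<open>B\<close>, hence orthogonal to the coordinate functions.
\<close>
lemma card_embeddings:
  assumes nf: "number_field TYPE('k::field_char_0)"
  shows "finite (embeddings :: ('k \<Rightarrow> complex) set)" "card (embeddings :: ('k \<Rightarrow> complex) set) = field_degree TYPE('k)"
proof -
  let ?E = "embeddings :: ('k \<Rightarrow> complex) set"
  show finE: "finite ?E" using embeddings_card_le[OF nf] by blast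
  obtain B :: "'k set" where B: "finite B" "rat.independent B" "rat.span B = UNIV" "card B = field_degree TYPE('k)"
    by (rule number_field_basis[OF nf])
  have "\<not> card ?E < card B"
  proof
    assume "card ?E < card B"
    then obtain x where x: "\<exists>b\<in>B. x b \<noteq> 0" "\<And>\<phi>. \<phi> \<in> ?E \<Longrightarrow> (\<Sum>b\<in>B. \<phi> b * x b) = 0"
      using underdetermined_system[of ?E B "\<lambda>\<phi> b. \<phi> b"] finE B(1) by blast
    then obtain b0 where b0: "b0 \<in> B" "x b0 \<noteq> 0" by blast
    obtain c where c: "\<And>z. of_rat (rat.representation B z b0) = (\<Sum>\<phi>\<in>?E. c \<phi> * \<phi> z)"
      using embeddings_span[OF nf Q_linear_coordinate[OF B(2,3), of b0]] by blast
    have "x b0 = (\<Sum>b\<in>B. if b = b0 then x b else 0)" using b0 B(1) by simp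
    also have "\<dots> = (\<Sum>b\<in>B. of_rat (rat.representation B b b0) * x b)"
      by (intro sum.cong refl) (simp add: rat.representation_basis[OF B(2)])
    also have "\<dots> = (\<Sum>\<phi>\<in>?E. c \<phi> * (\<Sum>b\<in>B. \<phi> b * x b))"
      unfolding c sum_distrib_left sum_distrib_right by (subst sum.swap) (simp add: mult_ac)
    also have "\<dots> = 0" using x(2) by simp
    finally show False using b0 by simp
  qed
  then show "card ?E = field_degree TYPE('k)" using embeddings_card_le[OF nf] B(4) by simp
qed

section \<open>Norm and trace\<close>

lemma Rats_eq_range_of_rat: "(\<rat> :: complex set) = range of_rat"
  by (auto elim: Rats_cases)

text \<open>
  Let \<open>q\<close> be the product. Since \<open>q(\<phi>(a)) = 0\<close> for all \<open>\<phi>\<close>, the operator \<open>q(a)\<close> kills the span of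
  the embeddings, which contains the rational coordinate functions of \<open>K\<close>. A rational-linear \<open>\<tau>\<close> with
  \<open>\<tau>(1) = 0\<close> turns this into the same statement for \<open>\<tau>(q)\<close>. But \<open>\<tau>(q)\<close> has smaller degree than the monic \<open>q\<close>
  and all its roots, so it is zero. Since every such \<open>\<tau>\<close> kills the coefficients of \<open>q\<close>, they are rational.
\<close>
lemma conjugates_polynomial_rational:
  fixes a :: "'k::field_char_0"
  assumes nf: "number_field TYPE('k)"
  shows "coeff (\<Prod>r\<in>(\<lambda>\<phi>. \<phi> a) ` embeddings. [:-r, 1:]) i \<in> (\<rat> :: complex set)"
proof (rule ccontr)
  let ?E = "embeddings :: ('k \<Rightarrow> complex) set"
  define R where "R = (\<lambda>\<phi>. \<phi> a) ` ?E"
  define q :: "complex poly" where "q = (\<Prod>r\<in>R. [:-r, 1:])"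
  assume "\<not> ?thesis"
  then have nr: "coeff q i \<notin> range of_rat" by (simp add: q_def R_def Rats_eq_range_of_rat)
  obtain \<tau> :: "complex \<Rightarrow> complex" where \<tau>: "\<And>x y. \<tau> (x + y) = \<tau> x + \<tau> y" "\<And>k z. \<tau> (of_rat k * z) = of_rat k * \<tau> z"
    "\<tau> 1 = 0" "\<tau> (coeff q i) = 1"
    using exists_linear_functional_off_subfield[OF field_hom_of_rat nr] by blast
  have finR: "finite R" using card_embeddings[OF nf] by (simp add: R_def)
  have degq: "degree q = card R" by (simp add: q_def degree_prod_eq_sum_degree)
  have monic: "lead_coeff q = 1" unfolding q_def lead_coeff_prod by simp
  have \<tau>0: "\<tau> 0 = 0" using \<tau>(1)[of 0 0] by simp
  have \<tau>sum: "\<tau> (\<Sum>m\<in>M. g m) = (\<Sum>m\<in>M. \<tau> (g m))" for M :: "nat set" and g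
    by (rule additive.sum) (rule additive.intro, rule \<tau>(1))
  define q' where "q' = map_poly \<tau> q"
  have cq': "coeff q' j = \<tau> (coeff q j)" for j by (simp add: q'_def coeff_map_poly \<tau>0)
  have ne: "q' \<noteq> 0" using cq'[of i] \<tau>(4) by auto
  have "degree q' \<le> degree q" by (simp add: q'_def map_poly_degree_leq)
  moreover have "coeff q' (degree q) = 0" by (simp add: cq' monic \<tau>(3))
  ultimately have deg: "degree q' < card R" using ne degq
    by (metis le_neq_implies_less leading_coeff_0_iff)
  obtain B :: "'k set" where B: "finite B" "rat.independent B" "rat.span B = UNIV" "card B = field_degree TYPE('k)"
    by (rule number_field_basis[OF nf])
  define u where "u b j = rat.representation B (a ^ j) b" for b j
  \<comment> \<open>The \<open>b\<close>-coordinate of \<open>\<tau>(q)(a)\<close> in \<open>K \<otimes> \<complex>\<close> vanishes.\<close>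
  have q0: "(\<Sum>j\<le>degree q. of_rat (u b j) * \<tau> (coeff q j)) = 0" for b
  proof -
    obtain c where c: "\<And>z. of_rat (rat.representation B z b) = (\<Sum>\<phi>\<in>?E. c \<phi> * \<phi> z)"
      using embeddings_span[OF nf Q_linear_coordinate[OF B(2,3), of b]] by blast
    have "(\<Sum>j\<le>degree q. of_rat (u b j) * coeff q j) = (\<Sum>j\<le>degree q. \<Sum>\<phi>\<in>?E. c \<phi> * (coeff q j * \<phi> a ^ j))"
      unfolding u_def c sum_distrib_right
      by (intro sum.cong) (auto simp: hom_power[OF embeddingsD])
    also have "\<dots> = (\<Sum>\<phi>\<in>?E. c \<phi> * poly q (\<phi> a))"
      unfolding poly_altdef sum_distrib_left by (rule sum.swap)
    also have "\<dots> = 0"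
      by (rule sum.neutral) (use finR in \<open>auto simp: q_def poly_prod R_def\<close>)
    finally have "0 = \<tau> (\<Sum>j\<le>degree q. of_rat (u b j) * coeff q j)" by (simp add: \<tau>0)
    then show ?thesis by (simp add: \<tau>sum \<tau>(2))
  qed
  have "poly q' r = 0" if r: "r \<in> R" for r
  proof -
    obtain \<phi> where \<phi>: "\<phi> \<in> ?E" "r = \<phi> a" using r by (auto simp: R_def)
    have hom: "field_hom \<phi>" using \<phi> embeddingsD by blast
    have pw: "\<phi> a ^ j = (\<Sum>b\<in>B. of_rat (u b j) * \<phi> b)" for j
    proof -
      have "a ^ j = (\<Sum>b\<in>B. of_rat (u b j) * b)"
        using rat.sum_representation_eq[OF B(2), of "a ^ j" B] B by (simp add: u_def)
      then have "\<phi> (a ^ j) = \<phi> (\<Sum>b\<in>B. of_rat (u b j) * b)" by simp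
      then show ?thesis
        by (simp add: hom_power[OF hom] hom_sum[OF hom] hom_mult[OF hom] hom_of_rat[OF hom])
    qed
    have "poly q' r = (\<Sum>j\<le>degree q. \<tau> (coeff q j) * \<phi> a ^ j)"
      unfolding \<phi>(2) poly_altdef cq'
      by (rule sum.mono_neutral_left) (use \<open>degree q' \<le> degree q\<close> in \<open>auto simp flip: cq' simp: coeff_eq_0\<close>)
    also have "\<dots> = (\<Sum>b\<in>B. \<phi> b * (\<Sum>j\<le>degree q. of_rat (u b j) * \<tau> (coeff q j)))"
      unfolding pw sum_distrib_left by (subst sum.swap) (simp add: mult_ac)
    also have "\<dots> = 0" by (simp add: q0)
    finally show ?thesis .
  qed
  then have "R \<subseteq> {x. poly q' x = 0}" by blast
  then have "card R \<le> card {x. poly q' x = 0}" by (intro card_mono poly_roots_finite ne)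
  also have "\<dots> \<le> degree q'" by (rule card_poly_roots_bound[OF ne])
  finally show False using deg by simp
qed

text \<open>
  By transitivity every conjugate of \<open>a\<close> is the value of the same number of embeddings, so the norm
  is up to sign a power of the constant term of the polynomial with the conjugates as simple roots.
\<close>
lemma norm_rational:
  fixes a :: "'k::field_char_0"
  assumes nf: "number_field TYPE('k)"
    and trans: "\<And>\<phi> \<psi>. \<phi> \<in> (embeddings :: ('k \<Rightarrow> complex) set) \<Longrightarrow> \<psi> \<in> embeddings \<Longrightarrow> \<exists>\<sigma>\<in>Gal_Qbar. \<sigma> \<circ> \<phi> = \<psi>"
  shows "(\<Prod>\<phi>\<in>embeddings. \<phi> a) \<in> \<rat>"
proof -
  let ?E = "embeddings :: ('k \<Rightarrow> complex) set"
  have finE: "finite ?E" by (rule card_embeddings[OF nf])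
  define R where "R = (\<lambda>\<phi>. \<phi> a) ` ?E"
  have le: "card {\<phi>\<in>?E. \<phi> a = r} \<le> card {\<phi>\<in>?E. \<phi> a = s}" if rs: "r \<in> R" "s \<in> R" for r s
  proof -
    obtain \<phi> \<psi> where \<phi>: "\<phi> \<in> ?E" "\<phi> a = r" and \<psi>: "\<psi> \<in> ?E" "\<psi> a = s" using rs by (auto simp: R_def)
    obtain \<sigma> where \<sigma>: "\<sigma> \<in> Gal_Qbar" "\<sigma> \<circ> \<phi> = \<psi>" using trans \<phi> \<psi> by blast
    have "inj_on (\<lambda>\<theta>. \<sigma> \<circ> \<theta>) {\<theta>\<in>?E. \<theta> a = r}"
    proof (rule inj_onI)
      fix \<theta> \<theta>' assume "\<theta> \<in> {\<theta>\<in>?E. \<theta> a = r}" "\<theta>' \<in> {\<theta>\<in>?E. \<theta> a = r}" and eq: "\<sigma> \<circ> \<theta> = \<sigma> \<circ> \<theta>'"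
      then have Q: "\<theta> x \<in> Qbar" "\<theta>' x \<in> Qbar" for x by (auto simp: embeddings_def)
      show "\<theta> = \<theta>'"
      proof
        fix x
        show "\<theta> x = \<theta>' x" using inj_onD[OF Gal_inj[OF \<sigma>(1)] _ Q] fun_cong[OF eq, of x] by simp
      qed
    qed
    moreover have "(\<lambda>\<theta>. \<sigma> \<circ> \<theta>) ` {\<theta>\<in>?E. \<theta> a = r} \<subseteq> {\<theta>\<in>?E. \<theta> a = s}"
      using Gal_comp_embedding[OF \<sigma>(1)] \<sigma>(2) \<phi> \<psi> by (auto simp: fun_eq_iff)
    ultimately show ?thesis using finE by (intro card_inj_on_le) auto
  qed
  have "\<exists>k. \<forall>r\<in>R. card {\<phi>\<in>?E. \<phi> a = r} = k"
  proof (cases "R = {}")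
    case False
    then obtain s where s: "s \<in> R" by blast
    show ?thesis
      by (intro exI[of _ "card {\<phi>\<in>?E. \<phi> a = s}"] ballI order_antisym le s)
  qed simp
  then obtain k where k: "\<And>r. r \<in> R \<Longrightarrow> card {\<phi>\<in>?E. \<phi> a = r} = k" by blast
  have "(\<Prod>\<phi>\<in>?E. \<phi> a) = (\<Prod>r\<in>R. \<Prod>\<phi>\<in>{\<phi>\<in>?E. \<phi> a = r}. \<phi> a)"
    unfolding R_def by (rule prod.image_gen[OF finE])
  also have "\<dots> = (\<Prod>r\<in>R. r ^ k)" by (intro prod.cong) (auto simp: k)
  also have "\<dots> = (\<Prod>r\<in>R. r) ^ k" by (simp add: prod_power_distrib)
  also have "(\<Prod>r\<in>R. r) = (-1) ^ card R * poly (\<Prod>r\<in>R. [:-r, 1:]) 0"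
    by (simp add: poly_prod prod_uminus)
  finally have "(\<Prod>\<phi>\<in>?E. \<phi> a) = ((-1) ^ card R * poly (\<Prod>r\<in>R. [:-r, 1:]) 0) ^ k" .
  moreover have "poly (\<Prod>r\<in>R. [:-r, 1:]) 0 \<in> \<rat>"
    using conjugates_polynomial_rational[OF nf, of a 0] by (simp add: poly_0_coeff_0 R_def)
  ultimately show ?thesis by simp
qed

lemma univariate_rational_coeffs_if_rational_values:
  fixes p :: "complex poly"
  assumes "\<And>t. poly p (of_rat t) \<in> \<rat>"
  shows "coeff p i \<in> \<rat>"
proof (rule ccontr)
  assume "\<not> ?thesis"
  then have nr: "coeff p i \<notin> range of_rat" by (simp add: Rats_eq_range_of_rat)
  obtain \<tau> :: "complex \<Rightarrow> complex" where \<tau>: "\<And>x y. \<tau> (x + y) = \<tau> x + \<tau> y" "\<And>k z. \<tau> (of_rat k * z) = of_rat k * \<tau> z"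
    "\<tau> 1 = 0" "\<tau> (coeff p i) = 1"
    using exists_linear_functional_off_subfield[OF field_hom_of_rat nr] by blast
  have \<tau>0: "\<tau> 0 = 0" using \<tau>(1)[of 0 0] by simp
  have \<tau>rat: "\<tau> z = 0" if "z \<in> \<rat>" for z
    using that \<tau>(2)[of _ 1] \<tau>(3) by (auto elim!: Rats_cases)
  have \<tau>sum: "\<tau> (\<Sum>m\<in>M. g m) = (\<Sum>m\<in>M. \<tau> (g m))" for M :: "nat set" and g
    by (rule additive.sum) (rule additive.intro, rule \<tau>(1))
  have v: "\<tau> (coeff p j) = 0" if "degree (map_poly \<tau> p) < j" for j
    using coeff_eq_0[OF that] by (simp add: coeff_map_poly \<tau>0)
  have "map_poly \<tau> p = 0"
  proof (rule univariate_zero_if_zero_on_Rats)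
    fix t
    have "poly (map_poly \<tau> p) (of_rat t) = (\<Sum>j\<le>degree p. \<tau> (coeff p j) * of_rat t ^ j)"
      unfolding poly_altdef
      by (rule sum.mono_neutral_cong_left)
         (use map_poly_degree_leq[of \<tau> p] v in \<open>auto simp: coeff_map_poly \<tau>0\<close>)
    also have "\<dots> = (\<Sum>j\<le>degree p. \<tau> (of_rat (t ^ j) * coeff p j))"
      by (simp only: \<tau>(2)) (simp add: of_rat_power mult.commute)
    also have "\<dots> = \<tau> (poly p (of_rat t))"
      by (simp add: poly_altdef \<tau>sum[symmetric] of_rat_power mult.commute)
    also have "\<dots> = 0" using \<tau>rat assms by blast
    finally show "poly (map_poly \<tau> p) (of_rat t) = 0" .
  qed
  then have "coeff (map_poly \<tau> p) i = 0" by simp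
  then show False using \<tau>(4) by (simp add: coeff_map_poly \<tau>0)
qed

text \<open>
  The trace of \<open>a\<close> is the linear coefficient of the norm of \<open>1 + t a\<close> as a polynomial in \<open>t\<close>.
\<close>
lemma trace_rational:
  fixes a :: "'k::field_char_0"
  assumes nf: "number_field TYPE('k)"
    and trans: "\<And>\<phi> \<psi>. \<phi> \<in> (embeddings :: ('k \<Rightarrow> complex) set) \<Longrightarrow> \<psi> \<in> embeddings \<Longrightarrow> \<exists>\<sigma>\<in>Gal_Qbar. \<sigma> \<circ> \<phi> = \<psi>"
  shows "(\<Sum>\<phi>\<in>embeddings. \<phi> a) \<in> \<rat>"
proof -
  let ?E = "embeddings :: ('k \<Rightarrow> complex) set"
  define P where "P = (\<Prod>\<phi>\<in>?E. [:1, \<phi> a:])"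
  have "coeff P i \<in> \<rat>" for i
  proof (rule univariate_rational_coeffs_if_rational_values)
    fix t
    have "poly P (of_rat t) = (\<Prod>\<phi>\<in>?E. \<phi> (1 + of_rat t * a))"
      unfolding P_def poly_prod
      by (intro prod.cong) (auto simp: hom_add[OF embeddingsD] hom_mult[OF embeddingsD]
          hom_one[OF embeddingsD] hom_of_rat[OF embeddingsD])
    then show "poly P (of_rat t) \<in> \<rat>" using norm_rational[OF assms] by simp
  qed
  then have "poly (pderiv P) 0 \<in> \<rat>" by (simp add: poly_0_coeff_0 coeff_pderiv)
  also have "poly (pderiv P) 0 = (\<Sum>\<phi>\<in>?E. \<phi> a)"
    unfolding P_def pderiv_prod by (simp add: poly_sum poly_prod pderiv_pCons)
  finally show ?thesis .
qed

lemma norm_mpoly_complex: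
  fixes l :: "('i::{finite,linorder}, 'k::field_char_0) mpoly"
  assumes nf: "number_field TYPE('k)"
    and trans: "\<And>\<phi> \<psi>. \<phi> \<in> (embeddings :: ('k \<Rightarrow> complex) set) \<Longrightarrow> \<psi> \<in> embeddings \<Longrightarrow> \<exists>\<sigma>\<in>Gal_Qbar. \<sigma> \<circ> \<phi> = \<psi>"
  shows "map_mpoly of_rat (norm_mpoly l) = (\<Prod>\<phi>\<in>embeddings. map_mpoly \<phi> l)"
proof -
  obtain p where p: "(\<Prod>\<phi>\<in>embeddings. map_mpoly \<phi> l) = map_mpoly of_rat p"
  proof (rule rational_coeffs_if_rational_values)
    fix x :: "(rat, 'i) vec"
    have "eval_mpoly (map_mpoly \<phi> l) (\<chi> i. of_rat (x $ i)) = \<phi> (eval_mpoly l (\<chi> i. of_rat (x $ i)))"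
      if "\<phi> \<in> embeddings" for \<phi>
      using eval_map_mpoly[OF embeddingsD[OF that], of l "\<chi> i. of_rat (x $ i)"]
      by (simp add: hom_of_rat[OF embeddingsD[OF that]])
    then have "eval_mpoly (\<Prod>\<phi>\<in>embeddings. map_mpoly \<phi> l) (\<chi> i. of_rat (x $ i)) =
        (\<Prod>\<phi>\<in>embeddings. \<phi> (eval_mpoly l (\<chi> i. of_rat (x $ i))))"
      by (simp add: eval_mpoly_prod)
    then show "eval_mpoly (\<Prod>\<phi>\<in>embeddings. map_mpoly \<phi> l) (\<chi> i. of_rat (x $ i)) \<in> \<rat>"
      using norm_rational[OF assms] by simp
  qed
  then show ?thesis by (simp add: norm_mpoly_def rational_mpoly_map_of_rat)
qed

lemma trace_mpoly_complex:
  fixes h :: "('i::finite, 'k::field_char_0) mpoly"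
  assumes nf: "number_field TYPE('k)"
    and trans: "\<And>\<phi> \<psi>. \<phi> \<in> (embeddings :: ('k \<Rightarrow> complex) set) \<Longrightarrow> \<psi> \<in> embeddings \<Longrightarrow> \<exists>\<sigma>\<in>Gal_Qbar. \<sigma> \<circ> \<phi> = \<psi>"
  shows "map_mpoly of_rat (trace_mpoly h) = (\<Sum>\<phi>\<in>embeddings. map_mpoly \<phi> h)"
proof -
  obtain p where p: "(\<Sum>\<phi>\<in>embeddings. map_mpoly \<phi> h) = map_mpoly of_rat p"
  proof (rule subfield_coeffs_if_functionals_vanish[OF field_hom_of_rat])
    fix \<tau> :: "complex \<Rightarrow> complex" and m
    assume \<tau>: "\<And>k z. \<tau> (of_rat k * z) = of_rat k * \<tau> z" "\<tau> 1 = 0"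
    have "Poly_Mapping.lookup (\<Sum>\<phi>\<in>embeddings. map_mpoly \<phi> h) m = (\<Sum>\<phi>\<in>embeddings. \<phi> (Poly_Mapping.lookup h m))"
      by (simp add: lookup_sum lookup_map_mpoly[OF embeddingsD])
    also have "\<dots> \<in> \<rat>" by (rule trace_rational[OF assms])
    finally obtain r where "Poly_Mapping.lookup (\<Sum>\<phi>\<in>embeddings. map_mpoly \<phi> h) m = of_rat r"
      by (auto elim: Rats_cases)
    then show "\<tau> (Poly_Mapping.lookup (\<Sum>\<phi>\<in>embeddings. map_mpoly \<phi> h) m) = 0"
      using \<tau>(1)[of r 1] \<tau>(2) by simp
  qed
  then show ?thesis by (simp add: trace_mpoly_def rational_mpoly_map_of_rat)
qed

section \<open>Restriction to lines\<close>

text \<open>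
  The only property of polynomial functions on \<open>\<complex>\<^sup>n\<close> that density arguments need. It is stable under
  composition with linear maps without forming the substituted polynomial.
\<close>
definition line_poly :: "(complex ^ 'i \<Rightarrow> complex) \<Rightarrow> bool" where
  "line_poly F \<longleftrightarrow> (\<forall>x y. \<exists>q. \<forall>t. poly q t = F (x + t *s y))"

text \<open>
  In the next three lemmas the bounds on degrees may be strict; the top coefficient is then \<open>0\<close>.
\<close>
lemma coeff_mult_top:
  fixes p q :: "'a::idom poly"
  assumes "degree p \<le> a" "degree q \<le> b"
  shows "degree (p * q) \<le> a + b" "coeff (p * q) (a + b) = coeff p a * coeff q b"
proof -
  show deg: "degree (p * q) \<le> a + b"
    using degree_mult_le[of p q] assms by linarith
  have "coeff (p * q) (a + b) = (\<Sum>i\<le>a+b. if i = a then coeff p a * coeff q b else 0)"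
    unfolding coeff_mult
  proof (intro sum.cong refl)
    fix i assume i: "i \<in> {..a + b}"
    show "coeff p i * coeff q (a + b - i) = (if i = a then coeff p a * coeff q b else 0)"
    proof (cases i a rule: linorder_cases)
      case less
      then have "degree q < a + b - i" using assms by linarith
      then show ?thesis using less by (simp add: coeff_eq_0)
    next
      case greater
      then have "degree p < i" using assms by linarith
      then show ?thesis using greater by (simp add: coeff_eq_0)
    qed simp
  qed
  then show "coeff (p * q) (a + b) = coeff p a * coeff q b" by simp
qed

lemma coeff_power_top:
  fixes p :: "'a::idom poly"
  assumes "degree p \<le> 1"
  shows "degree (p ^ n) \<le> n \<and> coeff (p ^ n) n = coeff p 1 ^ n"
proof (induction n)
  case (Suc n)
  then show ?case using coeff_mult_top[of p 1 "p ^ n" n] assms by simp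
qed simp

lemma coeff_prod_top:
  fixes p :: "'b \<Rightarrow> 'a::idom poly"
  assumes "finite A" "\<And>i. i \<in> A \<Longrightarrow> degree (p i) \<le> n i"
  shows "degree (\<Prod>i\<in>A. p i) \<le> (\<Sum>i\<in>A. n i) \<and> coeff (\<Prod>i\<in>A. p i) (\<Sum>i\<in>A. n i) = (\<Prod>i\<in>A. coeff (p i) (n i))"
  using assms
proof (induction A rule: finite_induct)
  case (insert i A)
  then show ?case using coeff_mult_top[of "p i" "n i" "\<Prod>i\<in>A. p i" "\<Sum>i\<in>A. n i"] by simp
qed simp

text \<open>
  The coefficient of \<open>t\<^sup>k\<close> matters because it vanishes if \<open>P\<close> vanishes in the direction \<open>y\<close>, which
  lowers the possible number of roots.
\<close>
lemma restriction_to_line: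
  fixes P :: "('i::finite, complex) mpoly"
  obtains q where "\<And>t. poly q t = eval_mpoly P (x + t *s y)"
    "\<And>k. homogeneous k P \<Longrightarrow> degree q \<le> k \<and> coeff q k = eval_mpoly P y"
proof -
  define r where "r m = (\<Prod>i\<in>UNIV. [:x $ i, y $ i:] ^ Poly_Mapping.lookup m i)" for m :: "'i \<Rightarrow>\<^sub>0 nat"
  define q where "q = (\<Sum>m\<in>Poly_Mapping.keys P. smult (Poly_Mapping.lookup P m) (r m))"
  have r: "degree (r m) \<le> mdeg m \<and> coeff (r m) (mdeg m) = mval m y" for m
    unfolding r_def mdeg_def mval_def
    using coeff_prod_top[of UNIV "\<lambda>i. [:x $ i, y $ i:] ^ Poly_Mapping.lookup m i" "Poly_Mapping.lookup m"]
      coeff_power_top[of "[:x $ _, y $ _:]"] by simp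
  show ?thesis
  proof (rule that[of q])
    fix t
    have "poly (r m) t = mval m (x + t *s y)" for m
      by (simp add: r_def mval_def poly_prod)
    then show "poly q t = eval_mpoly P (x + t *s y)"
      by (simp add: q_def poly_sum eval_mpoly_superset[OF finite_keys subset_refl])
  next
    fix k assume hom: "homogeneous k P"
    have "degree q \<le> k"
      unfolding q_def
      by (intro degree_sum_le) (use r hom in \<open>auto simp: homogeneous_iff intro: order_trans[OF degree_smult_le]\<close>)
    moreover have "coeff q k = (\<Sum>m\<in>Poly_Mapping.keys P. Poly_Mapping.lookup P m * coeff (r m) (mdeg m))"
      unfolding q_def coeff_sum using hom by (intro sum.cong) (auto simp: homogeneous_iff)
    ultimately show "degree q \<le> k \<and> coeff q k = eval_mpoly P y"
      by (simp add: r eval_mpoly_superset[OF finite_keys subset_refl])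
  qed
qed

lemma line_poly_eval: "line_poly (eval_mpoly P)"
  unfolding line_poly_def using restriction_to_line by metis

lemma line_poly_comp_linear:
  assumes "line_poly F" "\<And>x y t. T (x + t *s y) = T x + t *s T y"
  shows "line_poly (\<lambda>u. F (T u))"
  using assms unfolding line_poly_def by simp

lemma line_poly_zero_if_zero_at_rational_points:
  fixes F :: "complex ^ 'i::finite \<Rightarrow> complex"
  assumes F: "line_poly F" and zero: "\<And>u :: rat ^ 'i. F (\<chi> i. of_rat (u $ i)) = 0"
  shows "F x = 0"
proof -
  have "\<forall>x. (\<forall>i. i \<notin> A \<longrightarrow> x $ i \<in> range of_rat) \<longrightarrow> F x = 0" if "finite A" for A
    using that
  proof (induction A rule: finite_induct)
    case empty
    show ?case
    proof (intro allI impI)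
      fix x :: "complex ^ 'i" assume "\<forall>i. i \<notin> {} \<longrightarrow> x $ i \<in> range of_rat"
      then have "\<forall>i. \<exists>q. x $ i = of_rat q" by auto
      then obtain q where q: "\<And>i. x $ i = of_rat (q i)" by metis
      have "x = (\<chi> i. of_rat ((\<chi> i. q i) $ i))" by (simp add: vec_eq_iff q)
      then show "F x = 0" using zero[of "\<chi> i. q i"] by metis
    qed
  next
    case (insert a A)
    show ?case
    proof (intro allI impI)
      fix x :: "complex ^ 'i" assume x: "\<forall>i. i \<notin> insert a A \<longrightarrow> x $ i \<in> range of_rat"
      define x0 where "x0 = (\<chi> i. if i = a then 0 else x $ i)"
      obtain q where q: "\<And>t. poly q t = F (x0 + t *s axis a 1)"
        using F unfolding line_poly_def by metis
      have "q = 0"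
      proof (rule univariate_zero_if_zero_on_Rats)
        fix r
        have "\<forall>i. i \<notin> A \<longrightarrow> (x0 + of_rat r *s axis a 1) $ i \<in> range of_rat"
          using x by (auto simp: x0_def axis_def)
        then show "poly q (of_rat r) = 0" using insert.IH q by simp
      qed
      moreover have "x0 + x $ a *s axis a 1 = x"
        by (simp add: vec_eq_iff x0_def axis_def)
      ultimately show "F x = 0" using q[of "x $ a"] by simp
    qed
  qed
  from this[of UNIV] show ?thesis by simp
qed

text \<open>
  Nonempty Zariski open subsets of a linear subspace intersect: join a point of one to a point of the
  other by a line, which lies in the subspace.
\<close>
lemma common_nonzero_point:
  fixes U :: "(complex ^ 'i::finite) set"
  assumes U: "vec.subspace U" and "finite I" and "line_poly F0" "\<exists>v\<in>U. F0 v \<noteq> 0"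
    and "\<And>i. i \<in> I \<Longrightarrow> line_poly (F i)" "\<And>i. i \<in> I \<Longrightarrow> \<exists>v\<in>U. F i v \<noteq> 0"
  shows "\<exists>z\<in>U. F0 z \<noteq> 0 \<and> (\<forall>i\<in>I. F i z \<noteq> 0)"
  using assms(2-)
proof (induction I arbitrary: F0 rule: finite_induct)
  case (insert i I)
  obtain x where x: "x \<in> U" "F0 x \<noteq> 0" using insert.prems by blast
  obtain y where y: "y \<in> U" "F i y \<noteq> 0" using insert.prems by blast
  have prod: "line_poly (\<lambda>v. F0 v * F i v)"
    unfolding line_poly_def
  proof (intro allI)
    fix x y
    obtain q q' where "\<And>t. poly q t = F0 (x + t *s y)" "\<And>t. poly q' t = F i (x + t *s y)"
      using insert.prems(1) insert.prems(3)[of i] unfolding line_poly_def by (metis insertI1)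
    then show "\<exists>q. \<forall>t. poly q t = F0 (x + t *s y) * F i (x + t *s y)"
      by (intro exI[of _ "q * q'"]) simp
  qed
  have "\<exists>v\<in>U. F0 v * F i v \<noteq> 0"
  proof -
    obtain q where q: "\<And>t. poly q t = F0 (x + t *s (y - x))"
      using insert.prems(1) unfolding line_poly_def by metis
    obtain q' where q': "\<And>t. poly q' t = F i (x + t *s (y - x))"
      using insert.prems(3)[of i] unfolding line_poly_def by (metis insertI1)
    have "q \<noteq> 0" using q[of 0] x by auto
    moreover have "q' \<noteq> 0" using q'[of 1] y by auto
    ultimately have "q * q' \<noteq> 0" by simp
    then obtain t where "poly (q * q') t \<noteq> 0" using poly_all_0_iff_0 by blast
    then have "F0 (x + t *s (y - x)) * F i (x + t *s (y - x)) \<noteq> 0" by (simp add: q q')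
    moreover have "x + t *s (y - x) \<in> U"
      using x y U by (intro vec.subspace_add vec.subspace_scale vec.subspace_diff)
    ultimately show ?thesis by blast
  qed
  then have "\<exists>z\<in>U. F0 z * F i z \<noteq> 0 \<and> (\<forall>i\<in>I. F i z \<noteq> 0)"
    using insert.IH[OF prod] insert.prems by blast
  then show ?case by auto
qed auto

definition linear_form :: "(complex ^ 'i \<Rightarrow> complex) \<Rightarrow> bool" where
  "linear_form F \<longleftrightarrow> (\<forall>x y. F (x + y) = F x + F y) \<and> (\<forall>c x. F (c *s x) = c * F x)"

lemma linear_form_line_poly: "linear_form F \<Longrightarrow> line_poly F"
  unfolding line_poly_def linear_form_def
  by (intro allI, rule_tac x = "[:F x, F y:]" in exI) simp

text \<open>
  A generic line in \<open>U\<close> with a fixed direction \<open>w\<close> outside the hyperplanes \<open>m j = 0\<close> meets them in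
  distinct points. These are too many roots for a nonzero polynomial of degree \<open>k < card J\<close>. If \<open>k\<close> equals the number of hyperplanes, a zero in the
  direction \<open>w\<close> itself counts as the missing root at infinity.
\<close>
lemma vanishing_on_subspace:
  fixes P :: "('i::finite, complex) mpoly" and U :: "(complex ^ 'i) set"
  assumes U: "vec.subspace U" and J: "finite J" and hom: "homogeneous k P"
    and lin: "\<And>j. j \<in> J \<Longrightarrow> linear_form (m j)"
    and indep: "\<And>j j'. j \<in> J \<Longrightarrow> j' \<in> J \<Longrightarrow> j \<noteq> j' \<Longrightarrow> \<exists>v\<in>U. m j v = 0 \<and> m j' v \<noteq> 0"
    and w: "w \<in> U" "\<And>j. j \<in> J \<Longrightarrow> m j w \<noteq> 0"
    and zero: "\<And>j v. j \<in> J \<Longrightarrow> v \<in> U \<Longrightarrow> m j v = 0 \<Longrightarrow> eval_mpoly P v = 0"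
    and k: "k < card J \<or> k = card J \<and> eval_mpoly P w = 0"
    and v: "v \<in> U"
  shows "eval_mpoly P v = 0"
proof (rule ccontr)
  assume nz: "eval_mpoly P v \<noteq> 0"
  \<comment> \<open>The form \<open>D (j, j')\<close> is nonzero at \<open>z\<close> exactly if the line through \<open>z\<close> in the direction \<open>w\<close>
    meets the hyperplanes \<open>m j = 0\<close> and \<open>m j' = 0\<close> in different points.\<close>
  define I where "I = {(j, j'). j \<in> J \<and> j' \<in> J \<and> j \<noteq> j'}"
  define D where "D = (\<lambda>(j, j') v. m j v * m j' w - m j' v * m j w)"
  have "finite I" by (rule finite_subset[of _ "J \<times> J"]) (auto simp: I_def J)
  moreover have "line_poly (D i)" if "i \<in> I" for i
    using that lin unfolding I_def D_def
    by (intro linear_form_line_poly) (auto simp: linear_form_def algebra_simps)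
  moreover have "\<exists>v\<in>U. D i v \<noteq> 0" if i: "i \<in> I" for i
  proof -
    obtain j j' where ij: "i = (j, j')" "j \<in> J" "j' \<in> J" "j \<noteq> j'" using i by (auto simp: I_def)
    then obtain v where "v \<in> U" "m j v = 0" "m j' v \<noteq> 0" using indep by blast
    then have "v \<in> U \<and> D i v \<noteq> 0" using ij w(2)[of j] by (simp add: D_def)
    then show ?thesis by blast
  qed
  ultimately obtain z where z: "z \<in> U" "eval_mpoly P z \<noteq> 0" "\<And>i. i \<in> I \<Longrightarrow> D i z \<noteq> 0"
    using common_nonzero_point[OF U _ line_poly_eval[of P], of I D] nz v by blast
  obtain q where q: "\<And>t. poly q t = eval_mpoly P (z + t *s w)"
    and top: "degree q \<le> k \<and> coeff q k = eval_mpoly P w"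
    using restriction_to_line[of P z w] hom by metis
  have "q \<noteq> 0" using q[of 0] z(2) by auto
  define T where "T j = - m j z / m j w" for j
  have "poly q (T j) = 0" if j: "j \<in> J" for j
  proof -
    have "m j (z + T j *s w) = m j z + T j * m j w"
      using lin[OF j] unfolding linear_form_def by presburger
    then have "m j (z + T j *s w) = 0" using w(2)[OF j] by (simp add: T_def)
    moreover have "z + T j *s w \<in> U"
      using U z(1) w(1) by (intro vec.subspace_add vec.subspace_scale)
    ultimately show ?thesis using zero[OF j] q by simp
  qed
  then have "T ` J \<subseteq> {t. poly q t = 0}" by blast
  then have "card (T ` J) \<le> card {t. poly q t = 0}"
    using poly_roots_finite[OF \<open>q \<noteq> 0\<close>] by (rule card_mono[rotated])
  also have "\<dots> \<le> degree q" using \<open>q \<noteq> 0\<close> by (rule card_poly_roots_bound)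
  finally have "card (T ` J) \<le> degree q" .
  moreover have "inj_on T J"
  proof (rule inj_onI, rule ccontr)
    fix j j' assume j: "j \<in> J" "j' \<in> J" "T j = T j'" "j \<noteq> j'"
    then have "D (j, j') z \<noteq> 0" using z(3) by (auto simp: I_def)
    then show False using j w(2)[OF j(1)] w(2)[OF j(2)] by (simp add: D_def T_def field_simps)
  qed
  ultimately have "card J \<le> degree q" by (simp add: card_image)
  with top k have "degree q = k" "coeff q k = 0" by auto
  with \<open>q \<noteq> 0\<close> show False by (metis leading_coeff_0_iff)
qed

section \<open>Linear forms and general position\<close>

lemma eval_homogeneous_1:
  assumes "homogeneous 1 (p :: ('i::finite, 'a::comm_semiring_1) mpoly)"
  shows "eval_mpoly p v = (\<Sum>i\<in>UNIV. Poly_Mapping.lookup p (Poly_Mapping.single i 1) * v $ i)"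
proof -
  define X where "X i = (Poly_Mapping.single i 1 :: 'i \<Rightarrow>\<^sub>0 nat)" for i
  have "m \<in> range X" if "m \<in> Poly_Mapping.keys p" for m
  proof -
    have "(\<Sum>i\<in>UNIV. Poly_Mapping.lookup m i) = 1" using assms that by (simp add: homogeneous_def)
    then have "\<exists>i\<in>UNIV. Poly_Mapping.lookup m i = 1 \<and> (\<forall>j\<in>UNIV. i \<noteq> j \<longrightarrow> Poly_Mapping.lookup m j = 0)"
      by (subst (asm) sum_eq_1_iff) auto
    then obtain i where "Poly_Mapping.lookup m i = 1" "\<forall>j. i \<noteq> j \<longrightarrow> Poly_Mapping.lookup m j = 0"
      by blast
    then have "m = X i" by (intro poly_mapping_eqI) (auto simp: X_def lookup_single when_def)
    then show ?thesis by blast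
  qed
  then have sub: "Poly_Mapping.keys p \<subseteq> range X" by blast
  have inj: "inj X"
  proof (rule injI)
    fix i j assume "X i = X j"
    then have "Poly_Mapping.lookup (X i) i = Poly_Mapping.lookup (X j) i" by simp
    then show "i = j" by (simp add: X_def lookup_single when_def split: if_splits)
  qed
  have "mval (X i) v = v $ i" for i
  proof -
    have "mval (X i) v = (\<Prod>j\<in>UNIV. if j = i then v $ i else 1)"
      unfolding mval_def by (intro prod.cong) (auto simp: X_def lookup_single when_def)
    then show ?thesis by simp
  qed
  then have "eval_mpoly p v = (\<Sum>i\<in>UNIV. Poly_Mapping.lookup p (X i) * v $ i)"
    using eval_mpoly_superset[OF _ sub, of v] by (simp add: sum.reindex[OF inj])
  then show ?thesis by (simp add: X_def)
qed

lemma linear_form_eval: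
  assumes "homogeneous 1 (p :: ('i::finite, complex) mpoly)"
  shows "linear_form (eval_mpoly p)"
  unfolding linear_form_def eval_homogeneous_1[OF assms]
  by (simp add: algebra_simps sum.distrib sum_distrib_left)

text \<open>
  Otherwise adding the hyperplane of \<open>\<psi>\<close> would leave the intersection, and so its codimension,
  unchanged.
\<close>
lemma general_position_witness:
  fixes H :: "'e \<Rightarrow> ('i::finite, complex) mpoly"
  assumes gp: "general_position E (\<lambda>\<phi>. proj_zeros (H \<phi>))"
    and S: "finite S" "insert \<psi> S \<subseteq> E" "\<psi> \<notin> S" "card S < CARD('i)"
  shows "\<exists>v. (\<forall>\<phi>\<in>S. eval_mpoly (H \<phi>) v = 0) \<and> eval_mpoly (H \<psi>) v \<noteq> 0"
proof (rule ccontr)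
  assume "\<not> ?thesis"
  then have all: "eval_mpoly (H \<psi>) v = 0" if "\<forall>\<phi>\<in>S. eval_mpoly (H \<phi>) v = 0" for v
    using that by blast
  let ?X = "\<lambda>S. proj_points \<inter> (\<Inter>\<phi>\<in>S. proj_zeros (H \<phi>))"
  have "?X (insert \<psi> S) = ?X S"
    using all by (auto simp: proj_zeros_def)
  moreover have "proj_codim (?X S) = card S"
    using gp[unfolded general_position_def, rule_format, of S] S by simp
  moreover have "proj_codim (?X (insert \<psi> S)) = card (insert \<psi> S)"
    using gp[unfolded general_position_def, rule_format, of "insert \<psi> S"] S by simp
  ultimately show False using S by simp
qed

section \<open>Zeros on intersections of two conjugate hyperplanes\<close>

lemma Gal_eval_linear_form:
  fixes l :: "('i::finite, 'k::field_char_0) mpoly"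
  assumes \<sigma>: "\<sigma> \<in> Gal_Qbar" and \<phi>: "\<phi> \<in> embeddings" and hom: "homogeneous 1 l" and w: "\<And>i. w $ i \<in> Qbar"
  shows "\<sigma> (eval_mpoly (map_mpoly \<phi> l) w) = eval_mpoly (map_mpoly (\<sigma> \<circ> \<phi>) l) (\<chi> i. \<sigma> (w $ i))"
proof -
  have h: "field_hom \<phi>" "field_hom (\<sigma> \<circ> \<phi>)"
    using embeddingsD[OF \<phi>] embeddingsD[OF Gal_comp_embedding[OF \<sigma> \<phi>]] by auto
  have Q: "\<phi> x \<in> Qbar" for x using \<phi> by (auto simp: embeddings_def)
  have hom': "homogeneous 1 (map_mpoly \<phi> l)" "homogeneous 1 (map_mpoly (\<sigma> \<circ> \<phi>) l)"
    using hom by (simp_all only: homogeneous_map_mpoly[OF h(1)] homogeneous_map_mpoly[OF h(2)])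
  show ?thesis
    unfolding eval_homogeneous_1[OF hom'(1)] eval_homogeneous_1[OF hom'(2)]
    by (simp add: lookup_map_mpoly[OF h(1)] lookup_map_mpoly[OF h(2)]
        Gal_sum[OF \<sigma>] Gal_mult[OF \<sigma>] Qbar_mult Q w)
qed

text \<open>
  An automorphism acts only on points with algebraic coordinates, where it maps the intersection for
  \<open>\<phi>, \<psi>\<close> to that for \<open>\<sigma>\<phi>, \<sigma>\<psi>\<close> and fixes the coefficients of \<open>G\<close>. Algebraic points are dense in the
  intersection: it is the image of a linear map \<open>T\<close> with algebraic coefficients, which is obtained
  by Cramer's rule from a nonzero minor \<open>\<Delta>\<close> of the two linear forms and maps rational points to
  algebraic ones.
\<close>
lemma vanishing_transported_by_Gal:
  fixes l :: "('i::finite, 'k::field_char_0) mpoly" and G :: "('i, rat) mpoly"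
  assumes \<sigma>: "\<sigma> \<in> Gal_Qbar" and emb: "\<phi> \<in> embeddings" "\<psi> \<in> embeddings" and hom: "homogeneous 1 l"
    and zero: "\<And>u. eval_mpoly (map_mpoly (\<sigma> \<circ> \<phi>) l) u = 0 \<Longrightarrow> eval_mpoly (map_mpoly (\<sigma> \<circ> \<psi>) l) u = 0 \<Longrightarrow>
      eval_mpoly (map_mpoly of_rat G) u = 0"
    and indep: "eval_mpoly (map_mpoly \<phi> l) x = 0" "eval_mpoly (map_mpoly \<psi> l) x \<noteq> 0"
      "eval_mpoly (map_mpoly \<phi> l) y \<noteq> 0"
    and u: "eval_mpoly (map_mpoly \<phi> l) u = 0" "eval_mpoly (map_mpoly \<psi> l) u = 0"
  shows "eval_mpoly (map_mpoly of_rat G) u = 0"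
proof -
  define A where "A = eval_mpoly (map_mpoly \<phi> l)"
  define B where "B = eval_mpoly (map_mpoly \<psi> l)"
  define a where "a i = \<phi> (Poly_Mapping.lookup l (Poly_Mapping.single i 1))" for i
  define b where "b i = \<psi> (Poly_Mapping.lookup l (Poly_Mapping.single i 1))" for i
  have h: "field_hom \<phi>" "field_hom \<psi>" using emb embeddingsD by blast+
  have homs: "homogeneous 1 (map_mpoly \<phi> l)" "homogeneous 1 (map_mpoly \<psi> l)"
    using hom by (simp_all only: homogeneous_map_mpoly[OF h(1)] homogeneous_map_mpoly[OF h(2)])
  have A: "A v = (\<Sum>i\<in>UNIV. a i * v $ i)" for v
    by (simp add: A_def a_def eval_homogeneous_1[OF homs(1)] lookup_map_mpoly[OF h(1)])
  have B: "B v = (\<Sum>i\<in>UNIV. b i * v $ i)" for v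
    by (simp add: B_def b_def eval_homogeneous_1[OF homs(2)] lookup_map_mpoly[OF h(2)])
  have linA: "linear_form A" and linB: "linear_form B"
    unfolding A_def B_def by (intro linear_form_eval homs)+
  have A1: "A (v + v') = A v + A v'" "A (c *s v) = c * A v" "A (v - v') = A v - A v'" for v v' c
    using linA by (simp_all add: A algebra_simps sum.distrib sum_distrib_left sum_subtractf)
  have B1: "B (v + v') = B v + B v'" "B (c *s v) = c * B v" "B (v - v') = B v - B v'" for v v' c
    using linB by (simp_all add: B algebra_simps sum.distrib sum_distrib_left sum_subtractf)
  have ax: "(\<Sum>k\<in>UNIV. e k * axis i 1 $ k) = (e i :: complex)" for e i
  proof -
    have "(\<Sum>k\<in>UNIV. e k * axis i 1 $ k) = (\<Sum>k\<in>UNIV. if k = i then e i else 0)"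
      by (intro sum.cong) (auto simp: axis_def)
    then show ?thesis by simp
  qed
  have Aax: "A (axis i 1) = a i" and Bax: "B (axis i 1) = b i" for i
    by (simp_all add: A B ax)
  have "\<exists>i j. a i * b j - a j * b i \<noteq> 0"
  proof (rule ccontr)
    assume "\<not> ?thesis"
    then have eq: "a i * b j = a j * b i" for i j by simp
    have "\<exists>i. a i \<noteq> 0"
    proof (rule ccontr)
      assume "\<not> ?thesis"
      then have "A y = 0" by (simp add: A)
      then show False using indep(3) by (simp add: A_def)
    qed
    then obtain i where i: "a i \<noteq> 0" by blast
    have "a i * B x = (\<Sum>k\<in>UNIV. a k * b i * x $ k)"
      unfolding B sum_distrib_left by (intro sum.cong) (auto simp: eq[symmetric] mult.assoc[symmetric])
    also have "\<dots> = b i * A x"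
      unfolding A sum_distrib_left by (intro sum.cong) (auto simp: mult_ac)
    also have "\<dots> = 0" using indep(1) by (simp add: A_def)
    finally show False using i indep(2) by (simp add: B_def)
  qed
  then obtain i j where ij: "a i * b j - a j * b i \<noteq> 0" by blast
  \<comment> \<open>On the intersection of the two hyperplanes \<open>T\<close> is multiplication by \<open>\<Delta>\<close>.\<close>
  define \<Delta> where "\<Delta> = a i * b j - a j * b i"
  define T where "T u = \<Delta> *s u - A u *s (b j *s axis i 1 - b i *s axis j 1)
     - B u *s (a i *s axis j 1 - a j *s axis i 1)" for u
  have AT: "A (T u) = 0" and BT: "B (T u) = 0" for u
    unfolding T_def A1 B1 Aax Bax \<Delta>_def by (simp_all add: algebra_simps)
  have linT: "T (x + t *s y) = T x + t *s T y" for x y t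
    unfolding T_def A1 B1 by (simp add: vec_eq_iff algebra_simps)
  have aQ: "a k \<in> Qbar" "b k \<in> Qbar" for k using emb by (auto simp: a_def b_def embeddings_def)
  have "eval_mpoly (map_mpoly of_rat G) (T u) = 0" for u
  proof (rule line_poly_zero_if_zero_at_rational_points[of "\<lambda>u. eval_mpoly (map_mpoly of_rat G) (T u)"])
    show "line_poly (\<lambda>u. eval_mpoly (map_mpoly of_rat G) (T u))"
      by (rule line_poly_comp_linear[OF line_poly_eval linT])
    fix v :: "rat ^ 'i"
    define w where "w = T (\<chi> i. of_rat (v $ i))"
    have "A (\<chi> i. of_rat (v $ i)) \<in> Qbar" "B (\<chi> i. of_rat (v $ i)) \<in> Qbar"
      unfolding A B by (auto intro!: Qbar_sum Qbar_mult aQ Qbar_of_rat)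
    moreover have "axis k (1::complex) $ k' \<in> Qbar" for k k' :: 'i
      by (simp add: axis_def Qbar_0 Qbar_1)
    ultimately have w: "w $ k \<in> Qbar" for k
      unfolding w_def T_def \<Delta>_def vector_minus_component vector_smult_component
      by (intro Qbar_diff Qbar_mult aQ) (simp_all add: Qbar_of_rat)
    have "eval_mpoly (map_mpoly (\<sigma> \<circ> \<phi>) l) (\<chi> i. \<sigma> (w $ i)) = 0"
      using Gal_eval_linear_form[OF \<sigma> emb(1) hom w] AT by (simp add: w_def Gal_0[OF \<sigma>] flip: A_def)
    moreover have "eval_mpoly (map_mpoly (\<sigma> \<circ> \<psi>) l) (\<chi> i. \<sigma> (w $ i)) = 0"
      using Gal_eval_linear_form[OF \<sigma> emb(2) hom w] BT by (simp add: w_def Gal_0[OF \<sigma>] flip: B_def)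
    ultimately have "\<sigma> (eval_mpoly (map_mpoly of_rat G) w) = \<sigma> 0"
      using zero by (simp add: Gal_eval_rational[OF \<sigma> w] Gal_0[OF \<sigma>])
    moreover have "eval_mpoly (map_mpoly of_rat G) w \<in> Qbar"
      unfolding eval_mpoly_def lookup_map_mpoly[OF field_hom_of_rat]
      by (intro Qbar_sum Qbar_mult Qbar_prod Qbar_power Qbar_of_rat w)
    ultimately have "eval_mpoly (map_mpoly of_rat G) w = 0"
      using inj_onD[OF Gal_inj[OF \<sigma>]] Qbar_0 by blast
    then show "eval_mpoly (map_mpoly of_rat G) (T (\<chi> i. of_rat (v $ i))) = 0" by (simp add: w_def)
  qed
  from this[of "(1 / \<Delta>) *s u"] have "eval_mpoly (map_mpoly of_rat G) (T ((1 / \<Delta>) *s u)) = 0" .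
  moreover have "T ((1 / \<Delta>) *s u) = u"
    using u ij unfolding T_def A1 B1 by (simp add: A_def B_def \<Delta>_def vec_eq_iff)
  ultimately show ?thesis by simp
qed

text \<open>
  The subspace is stable under complex conjugation, so with \<open>u\<close> it contains the real vectors \<open>x\<close> and
  \<open>y\<close> of real and imaginary parts. The polynomial \<open>G \<nu>\<close> vanishes at the real points \<open>x + t y\<close>, because the
  squares sum to zero there. Hence it vanishes for \<open>t = \<i>\<close>.
\<close>
lemma vanishing_on_conjugate_pair:
  fixes l :: "('i::finite, 'k::field_char_0) mpoly" and G :: "'n \<Rightarrow> ('i, rat) mpoly"
  assumes fin: "finite N" and \<nu>: "\<nu> \<in> N" and eq: "(\<Sum>\<nu>\<in>N. (G \<nu>)\<^sup>2) = f * h"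
    and \<phi>: "field_hom \<phi>"
    and f: "\<And>v. eval_mpoly (map_mpoly \<phi> l) v = 0 \<Longrightarrow> eval_mpoly (map_mpoly of_rat f) v = 0"
    and hom: "homogeneous 1 l"
    and u: "eval_mpoly (map_mpoly \<phi> l) u = 0" "eval_mpoly (map_mpoly (cnj \<circ> \<phi>) l) u = 0"
  shows "eval_mpoly (map_mpoly of_rat (G \<nu>)) u = 0"
proof -
  have hc: "field_hom cnj" by (simp add: field_hom_def)
  have h': "field_hom (cnj \<circ> \<phi>)" using \<phi> by (simp add: field_hom_def)
  define A where "A = eval_mpoly (map_mpoly \<phi> l)"
  have lin: "linear_form A"
    unfolding A_def by (rule linear_form_eval) (use hom homogeneous_map_mpoly[OF \<phi>] in blast)
  have "map_mpoly cnj (map_mpoly (cnj \<circ> \<phi>) l) = map_mpoly \<phi> l"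
    by (rule poly_mapping_eqI) (simp add: lookup_map_mpoly[OF hc] lookup_map_mpoly[OF h'] lookup_map_mpoly[OF \<phi>])
  then have Acu: "A (\<chi> i. cnj (u $ i)) = 0"
    using eval_map_mpoly[OF hc, of "map_mpoly (cnj \<circ> \<phi>) l" u] u(2) by (simp add: A_def)
  define x :: "complex ^ 'i" where "x = (\<chi> i. of_real (Re (u $ i)))"
  define y :: "complex ^ 'i" where "y = (\<chi> i. of_real (Im (u $ i)))"
  have x: "x = (1/2) *s (u + (\<chi> i. cnj (u $ i)))"
    by (simp add: x_def vec_eq_iff complex_eq_iff)
  have y: "y = (1 / (2 * \<i>)) *s (u + (-1) *s (\<chi> i. cnj (u $ i)))"
    by (simp add: y_def vec_eq_iff complex_diff_cnj field_simps)
  have uxy: "u = x + \<i> *s y"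
    by (simp add: vec_eq_iff x_def y_def complex_eq mult.commute)
  have A1: "A (v + v') = A v + A v'" "A (c *s v) = c * A v" for v v' c
    using lin by (simp_all add: linear_form_def)
  have Ax: "A x = 0" and Ay: "A y = 0"
    unfolding x y A1 by (simp_all add: Acu u(1)[folded A_def])
  have or: "field_hom (of_real :: real \<Rightarrow> complex)" by (simp add: field_hom_def)
  have real0: "eval_mpoly (map_mpoly of_rat (G \<nu>)) (x + of_real t *s y) = 0" for t
  proof -
    define z :: "real ^ 'i" where "z = (\<chi> i. Re (u $ i) + t * Im (u $ i))"
    have z: "x + of_real t *s y = (\<chi> i. of_real (z $ i))"
      by (simp add: vec_eq_iff x_def y_def z_def)
    have ev: "eval_mpoly (map_mpoly of_rat p) (x + of_real t *s y) = of_real (eval_mpoly (map_mpoly of_rat p) z)" for p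
      using eval_map_mpoly[OF or, of "map_mpoly of_rat p" z] by (simp only: z map_mpoly_of_rat[OF or])
    have "A (x + of_real t *s y) = 0" using lin Ax Ay by (simp add: linear_form_def)
    then have "of_real (eval_mpoly (map_mpoly of_rat f) z) = (0 :: complex)"
      using f[of "x + of_real t *s y"] unfolding ev A_def by blast
    then have "eval_mpoly (map_mpoly of_rat (f * h)) z = 0"
      by (simp add: map_mpoly_mult[OF field_hom_of_rat] eval_mpoly_mult)
    then have "(\<Sum>\<nu>\<in>N. (eval_mpoly (map_mpoly of_rat (G \<nu>)) z)\<^sup>2) = 0"
      unfolding eq[symmetric]
      by (simp add: map_mpoly_sum[OF field_hom_of_rat] map_mpoly_power2[OF field_hom_of_rat] eval_mpoly_sum eval_mpoly_power)
    then have "eval_mpoly (map_mpoly of_rat (G \<nu>)) z = 0"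
      using fin \<nu> by (simp add: sum_nonneg_eq_0_iff)
    then show ?thesis by (simp add: ev)
  qed
  obtain q where q: "\<And>t. poly q t = eval_mpoly (map_mpoly of_rat (G \<nu>)) (x + t *s y)"
    using restriction_to_line[of "map_mpoly of_rat (G \<nu>)" x y] by metis
  have "q = 0"
  proof (rule univariate_zero_if_zero_on_Rats)
    fix r
    show "poly q (of_rat r) = 0" using real0[of "of_rat r"] q[of "of_rat r"] by (simp add: hom_of_rat[OF or])
  qed
  then show ?thesis using q[of \<i>] uxy by simp
qed

section \<open>The cofactors of the norm and the trace forms\<close>

locale conjugate_hyperplanes =
  fixes l :: "('i::{finite,linorder}, 'k::field_char_0) mpoly"
    and f :: "('i, rat) mpoly"
  assumes nf: "number_field TYPE('k)" and card_E: "2 \<le> card (embeddings :: ('k \<Rightarrow> complex) set)"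
    and card_I: "3 \<le> CARD('i)"
    and imag: "totally_imaginary TYPE('k)"
    and trans2: "two_transitive (\<circ>) Gal_Qbar (embeddings :: ('k \<Rightarrow> complex) set)"
    and lin: "homogeneous 1 l"
    and gp: "general_position (embeddings :: ('k \<Rightarrow> complex) set) (\<lambda>\<phi>. proj_zeros (map_mpoly \<phi> l))"
    and f_norm: "f = norm_mpoly l"
begin

abbreviation E :: "('k \<Rightarrow> complex) set" where "E \<equiv> embeddings"

lemma fin_E: "finite E"
  by (rule card_embeddings[OF nf])

lemma hom_E: "\<phi> \<in> E \<Longrightarrow> field_hom \<phi>"
  by (rule embeddingsD)

lemma exists_other_embedding: "\<phi> \<in> E \<Longrightarrow> \<exists>\<psi>\<in>E. \<psi> \<noteq> \<phi>"
proof (rule ccontr)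
  assume "\<not> ?thesis" and "\<phi> \<in> E"
  then have "E = {\<phi>}" by blast
  then have "card E = card {\<phi>}" by (rule arg_cong)
  then show False using card_E by simp
qed

lemma transitive: "\<phi> \<in> E \<Longrightarrow> \<psi> \<in> E \<Longrightarrow> \<exists>\<sigma>\<in>Gal_Qbar. \<sigma> \<circ> \<phi> = \<psi>"
proof -
  assume a: "\<phi> \<in> E" "\<psi> \<in> E"
  obtain \<phi>' \<psi>' where "\<phi>' \<in> E" "\<phi>' \<noteq> \<phi>" "\<psi>' \<in> E" "\<psi>' \<noteq> \<psi>"
    using exists_other_embedding[OF a(1)] exists_other_embedding[OF a(2)] by blast
  then show ?thesis using trans2 a unfolding two_transitive_def by metis
qed

abbreviation L :: "('k \<Rightarrow> complex) \<Rightarrow> ('i, complex) mpoly" where "L \<phi> \<equiv> map_mpoly \<phi> l"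

definition cofactor :: "('k \<Rightarrow> complex) \<Rightarrow> ('i, complex) mpoly" where
  "cofactor \<phi> = (\<Prod>\<psi>\<in>E - {\<phi>}. L \<psi>)"

lemma homogeneous_L: "\<phi> \<in> E \<Longrightarrow> homogeneous 1 (L \<phi>)"
  using lin by (simp only: homogeneous_map_mpoly[OF hom_E])

lemma linear_form_L: "\<phi> \<in> E \<Longrightarrow> linear_form (eval_mpoly (L \<phi>))"
  by (intro linear_form_eval homogeneous_L)

lemma f_complex: "map_mpoly of_rat f = (\<Prod>\<phi>\<in>E. L \<phi>)"
  unfolding f_norm by (rule norm_mpoly_complex[OF nf transitive])

lemma f_factor: "\<phi> \<in> E \<Longrightarrow> map_mpoly of_rat f = L \<phi> * cofactor \<phi>"
  unfolding f_complex cofactor_def by (rule prod.remove[OF fin_E])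

lemma cofactor_factor: "\<phi> \<in> E \<Longrightarrow> \<psi> \<in> E \<Longrightarrow> \<phi> \<noteq> \<psi> \<Longrightarrow> cofactor \<phi> = L \<psi> * (\<Prod>\<theta>\<in>E - {\<phi>} - {\<psi>}. L \<theta>)"
  unfolding cofactor_def by (rule prod.remove) (auto simp: fin_E)

lemma cofactor_zero: "\<phi> \<in> E \<Longrightarrow> \<psi> \<in> E \<Longrightarrow> \<phi> \<noteq> \<psi> \<Longrightarrow> eval_mpoly (L \<psi>) v = 0 \<Longrightarrow> eval_mpoly (cofactor \<phi>) v = 0"
  by (simp add: cofactor_factor eval_mpoly_mult)

lemma homogeneous_cofactor: "\<phi> \<in> E \<Longrightarrow> homogeneous (card E - 1) (cofactor \<phi>)"
  unfolding cofactor_def using homogeneous_prod[of "E - {\<phi>}" L] homogeneous_L fin_E by simp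

text \<open>
  The proof uses general position in the form of these three consequences: the hyperplanes are proper, they
  are pairwise distinct, and in each of them the others cut out pairwise distinct proper subspaces.
\<close>
lemma hyperplane_proper: "\<phi> \<in> E \<Longrightarrow> \<exists>v. eval_mpoly (L \<phi>) v \<noteq> 0"
  using general_position_witness[OF gp, of "{}" \<phi>] card_I by simp

lemma hyperplanes_distinct: "\<phi> \<in> E \<Longrightarrow> \<psi> \<in> E \<Longrightarrow> \<phi> \<noteq> \<psi> \<Longrightarrow> \<exists>v. eval_mpoly (L \<phi>) v = 0 \<and> eval_mpoly (L \<psi>) v \<noteq> 0"
  using general_position_witness[OF gp, of "{\<phi>}" \<psi>] card_I by auto

lemma hyperplanes_distinct_inside_hyperplane: "\<phi> \<in> E \<Longrightarrow> \<psi> \<in> E \<Longrightarrow> \<theta> \<in> E \<Longrightarrow> \<phi> \<noteq> \<psi> \<Longrightarrow> \<theta> \<noteq> \<phi> \<Longrightarrow> \<theta> \<noteq> \<psi> \<Longrightarrow>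
    \<exists>v. eval_mpoly (L \<phi>) v = 0 \<and> eval_mpoly (L \<psi>) v = 0 \<and> eval_mpoly (L \<theta>) v \<noteq> 0"
  using general_position_witness[OF gp, of "{\<phi>, \<psi>}" \<theta>] card_I by auto

lemma E_nonempty: obtains \<phi> where "\<phi> \<in> E"
proof -
  have "E \<noteq> {}" using card_E by auto
  then show ?thesis using that by blast
qed

lemma L_nonzero: "\<phi> \<in> E \<Longrightarrow> L \<phi> \<noteq> 0"
  using hyperplane_proper by force

lemma l_nonzero: "l \<noteq> 0"
proof -
  obtain \<phi> where "\<phi> \<in> E" by (rule E_nonempty)
  then show ?thesis using L_nonzero map_mpoly_eq_0_iff[OF hom_E] by blast
qed

lemma f_nonzero: "f \<noteq> 0"
proof
  assume "f = 0"
  then have "(\<Prod>\<phi>\<in>E. L \<phi>) = 0" by (simp flip: f_complex add: map_mpoly_zero[OF field_hom_of_rat])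
  then show False using L_nonzero fin_E by simp
qed

text \<open>
  The polynomial \<open>f / l\<close> over \<open>K\<close>: the division can be carried out over \<open>\<complex>\<close> after a choice of an
  embedding, and the quotient descends.
\<close>
lemma cofactor_over_field:
  obtains h where "h * l = map_mpoly of_rat f" "\<And>\<phi>. \<phi> \<in> E \<Longrightarrow> map_mpoly \<phi> h = cofactor \<phi>"
proof -
  obtain \<phi>0 where \<phi>0: "\<phi>0 \<in> E" by (rule E_nonempty)
  have "cofactor \<phi>0 * L \<phi>0 = map_mpoly \<phi>0 (map_mpoly of_rat f)"
    by (simp add: map_mpoly_of_rat[OF hom_E[OF \<phi>0]] f_factor[OF \<phi>0] mult.commute)
  then obtain h where h: "h * l = map_mpoly of_rat f"
    using divisibility_descends[OF hom_E[OF \<phi>0] l_nonzero] by metis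
  have "map_mpoly \<phi> h = cofactor \<phi>" if \<phi>: "\<phi> \<in> E" for \<phi>
  proof -
    have "map_mpoly \<phi> h * L \<phi> = map_mpoly \<phi> (map_mpoly of_rat f)"
      by (simp flip: map_mpoly_mult[OF hom_E[OF \<phi>]] add: h)
    also have "\<dots> = cofactor \<phi> * L \<phi>"
      by (simp add: map_mpoly_of_rat[OF hom_E[OF \<phi>]] f_factor[OF \<phi>] mult.commute)
    finally show ?thesis using L_nonzero[OF \<phi>] by simp
  qed
  with h show ?thesis using that by blast
qed

definition trace_form :: "'k \<Rightarrow> ('i, rat) mpoly" where
  "trace_form a = trace_mpoly (mpoly_quot (const_mpoly a * map_mpoly of_rat f) l)"

lemma trace_form_complex:
  "map_mpoly of_rat (trace_form a) = (\<Sum>\<phi>\<in>E. const_mpoly (\<phi> a) * cofactor \<phi>)"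
proof -
  obtain h where h: "h * l = map_mpoly of_rat f" "\<And>\<phi>. \<phi> \<in> E \<Longrightarrow> map_mpoly \<phi> h = cofactor \<phi>"
    by (rule cofactor_over_field) blast
  have "mpoly_quot (const_mpoly a * map_mpoly of_rat f) l = const_mpoly a * h"
    unfolding mpoly_quot_def
  proof (rule the_equality)
    show "const_mpoly a * h * l = const_mpoly a * map_mpoly of_rat f" by (simp add: mult.assoc h)
    then show "h' = const_mpoly a * h" if "h' * l = const_mpoly a * map_mpoly of_rat f" for h'
      using that l_nonzero by (metis mult_right_cancel)
  qed
  moreover have "map_mpoly \<phi> (const_mpoly a * h) = const_mpoly (\<phi> a) * cofactor \<phi>" if "\<phi> \<in> E" for \<phi>
    by (simp add: map_mpoly_mult[OF hom_E[OF that]] map_mpoly_single[OF hom_E[OF that]] h(2)[OF that])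
  moreover have "map_mpoly of_rat (trace_mpoly p) = (\<Sum>\<phi>\<in>E. map_mpoly \<phi> p)" for p :: "('i, 'k) mpoly"
    by (rule trace_mpoly_complex[OF nf transitive])
  ultimately show ?thesis by (simp add: trace_form_def)
qed

lemma homogeneous_trace_form: "homogeneous (card E - 1) (trace_form a)"
proof -
  have "homogeneous (0 + (card E - 1)) (const_mpoly (\<phi> a) * cofactor \<phi>)" if "\<phi> \<in> E" for \<phi>
    by (intro homogeneous_mult homogeneous_const homogeneous_cofactor that)
  then have "homogeneous (card E - 1) (map_mpoly of_rat (trace_form a) :: ('i, complex) mpoly)"
    unfolding trace_form_complex by (intro homogeneous_sum) simp
  then show ?thesis by (simp only: homogeneous_map_mpoly[OF field_hom_of_rat])
qed

lemma f_dvd_if_complex_dvd: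
  assumes "map_mpoly of_rat f dvd (map_mpoly of_rat g :: ('i, complex) mpoly)"
  shows "f dvd g"
proof -
  obtain h where "map_mpoly of_rat g = map_mpoly of_rat f * (h :: ('i, complex) mpoly)"
    using assms by blast
  then have "h * map_mpoly of_rat f = map_mpoly of_rat g" by (simp add: mult.commute)
  then obtain h' where "h' * f = g"
    using divisibility_descends[OF field_hom_of_rat f_nonzero] by metis
  then show ?thesis by (metis dvd_triv_right)
qed

text \<open>
  When the squares are expanded, \<open>f\<close> divides the mixed products of cofactors, and the square of the
  cofactor of \<open>\<phi>\<close> has the coefficient \<open>\<phi>(\<Sum>\<^sub>\<nu> a\<^sub>\<nu>\<^sup>2)\<close>.
\<close>
lemma f_dvd_sum_trace_form_squares:
  fixes a :: "'n \<Rightarrow> 'k"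
  assumes "(\<Sum>\<nu>\<in>N. (a \<nu>)\<^sup>2) = 0"
  shows "f dvd (\<Sum>\<nu>\<in>N. (trace_form (a \<nu>))\<^sup>2)"
proof (rule f_dvd_if_complex_dvd)
  let ?F = "map_mpoly of_rat f :: ('i, complex) mpoly"
  have "map_mpoly of_rat (\<Sum>\<nu>\<in>N. (trace_form (a \<nu>))\<^sup>2) =
      (\<Sum>\<nu>\<in>N. (\<Sum>\<phi>\<in>E. const_mpoly (\<phi> (a \<nu>)) * cofactor \<phi>)\<^sup>2)"
    by (simp only: map_mpoly_sum[OF field_hom_of_rat] map_mpoly_power2[OF field_hom_of_rat] trace_form_complex)
  also have "\<dots> = (\<Sum>\<nu>\<in>N. \<Sum>\<phi>\<in>E. \<Sum>\<psi>\<in>E. const_mpoly (\<phi> (a \<nu>) * \<psi> (a \<nu>)) * (cofactor \<phi> * cofactor \<psi>))"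
    by (intro sum.cong refl) (simp add: power2_eq_square sum_product mult_ac mult_single[of 0 _ 0, simplified, symmetric])
  also have "\<dots> = (\<Sum>\<phi>\<in>E. \<Sum>\<psi>\<in>E. (\<Sum>\<nu>\<in>N. const_mpoly (\<phi> (a \<nu>) * \<psi> (a \<nu>))) * (cofactor \<phi> * cofactor \<psi>))"
    unfolding sum_distrib_right
    by (subst sum.swap) (intro sum.cong refl sum.swap)
  also have "?F dvd \<dots>"
  proof (intro dvd_sum)
    fix \<phi> \<psi> assume \<phi>: "\<phi> \<in> E" and \<psi>: "\<psi> \<in> E"
    show "?F dvd (\<Sum>\<nu>\<in>N. const_mpoly (\<phi> (a \<nu>) * \<psi> (a \<nu>))) * (cofactor \<phi> * cofactor \<psi>)"
    proof (cases "\<phi> = \<psi>")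
      case True
      have const_sum: "(\<Sum>\<nu>\<in>N. const_mpoly (c \<nu>)) = (const_mpoly (\<Sum>\<nu>\<in>N. c \<nu>) :: ('i, complex) mpoly)" for c
        by (induction N rule: infinite_finite_induct) (auto simp: single_add)
      have "(\<Sum>\<nu>\<in>N. \<phi> (a \<nu>) * \<phi> (a \<nu>)) = \<phi> (\<Sum>\<nu>\<in>N. (a \<nu>)\<^sup>2)"
        by (simp add: hom_sum[OF hom_E[OF \<phi>]] hom_mult[OF hom_E[OF \<phi>]] power2_eq_square)
      then show ?thesis by (simp add: True[symmetric] assms const_sum hom_zero[OF hom_E[OF \<phi>]])
    next
      case False
      then have "cofactor \<phi> * cofactor \<psi> = (L \<psi> * (\<Prod>\<theta>\<in>E - {\<phi>} - {\<psi>}. L \<theta>)) * cofactor \<psi>"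
        using \<phi> \<psi> by (simp add: cofactor_factor)
      also have "\<dots> = ?F * (\<Prod>\<theta>\<in>E - {\<phi>} - {\<psi>}. L \<theta>)"
        by (simp add: f_factor[OF \<psi>] mult_ac)
      finally show ?thesis by simp
    qed
  qed
  finally show "?F dvd map_mpoly of_rat (\<Sum>\<nu>\<in>N. (trace_form (a \<nu>))\<^sup>2)" .
qed

section \<open>Recovering the coefficients of a sum of squares\<close>

lemma subspace_kernel: "\<phi> \<in> E \<Longrightarrow> vec.subspace {v. eval_mpoly (L \<phi>) v = 0}"
  using linear_form_L[of \<phi>] unfolding linear_form_def
  by (intro vec.subspaceI) (auto, metis mult_zero_left vector_smult_lzero)

text \<open>
  Points over \<open>K\<close> of the hyperplane \<open>l = 0\<close> are obtained from rational vectors by a projection along a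
  coordinate axis on which \<open>l\<close> is nonzero. Their images under \<open>\<phi>\<close> are Zariski dense in \<open>l\<^sub>\<phi> = 0\<close>, where
  the cofactor of \<open>\<phi>\<close> is not identically zero.
\<close>
lemma exists_separating_point:
  assumes h: "\<And>\<phi>. \<phi> \<in> E \<Longrightarrow> map_mpoly \<phi> h = cofactor \<phi>"
  obtains v :: "('k, 'i) vec" where "eval_mpoly l v = 0" "eval_mpoly h v \<noteq> 0"
proof -
  obtain \<phi> where \<phi>: "\<phi> \<in> E" by (rule E_nonempty)
  have hom: "field_hom \<phi>" by (rule hom_E[OF \<phi>])
  define A where "A = eval_mpoly (L \<phi>)"
  have linA: "linear_form A" unfolding A_def by (rule linear_form_L[OF \<phi>])
  have A1: "A (v + v') = A v + A v'" "A (c *s v) = c * A v" for v v' c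
    using linA by (simp_all add: linear_form_def)
  have A2: "A (v - v') = A v - A v'" for v v'
    using A1(1)[of "v - v'" v'] by simp
  define c where "c i = eval_mpoly l (axis i 1)" for i
  have ax: "(\<chi> j. \<phi> (axis i 1 $ j)) = axis i 1" for i
    by (simp add: vec_eq_iff axis_def hom_one[OF hom] hom_zero[OF hom])
  have c: "\<phi> (c i) = A (axis i 1)" for i
    using eval_map_mpoly[OF hom, of l "axis i 1"] by (simp add: c_def A_def ax)
  obtain i where i: "A (axis i 1) \<noteq> 0"
  proof -
    obtain x where x: "A x \<noteq> 0" using hyperplane_proper[OF \<phi>] by (auto simp: A_def)
    have "\<exists>i. A (axis i 1) \<noteq> 0"
    proof (rule ccontr)
      assume z: "\<not> ?thesis"
      have sum: "A (\<Sum>i\<in>S. x $ i *s axis i 1) = (\<Sum>i\<in>S. x $ i * A (axis i 1))" if "finite S" for S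
        using that
      proof (induction S rule: finite_induct)
        case empty
        show ?case using A1(2)[of 0 0] by simp
      qed (simp add: A1)
      have "x = (\<Sum>i\<in>UNIV. x $ i *s axis i 1)" by (simp add: basis_expansion)
      then have "A x = 0" using sum[of UNIV] z by simp
      with x show False by simp
    qed
    then show ?thesis using that by blast
  qed
  \<comment> \<open>The projection over \<open>\<complex>\<close>, scaled by \<open>A (axis i 1)\<close>; below \<open>V\<close> is its counterpart over \<open>K\<close>.\<close>
  define T where "T u = A (axis i 1) *s u - A u *s axis i 1" for u
  have AT: "A (T u) = 0" for u by (simp add: T_def A1 A2)
  have linT: "T (x + t *s y) = T x + t *s T y" for x y t
    by (simp add: T_def A1 vec_eq_iff algebra_simps)
  obtain z where z: "A z = 0" "\<And>\<psi>. \<psi> \<in> E - {\<phi>} \<Longrightarrow> eval_mpoly (L \<psi>) z \<noteq> 0"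
  proof -
    have "\<exists>z\<in>{v. A v = 0}. (1::complex) \<noteq> 0 \<and> (\<forall>\<psi>\<in>E - {\<phi>}. eval_mpoly (L \<psi>) z \<noteq> 0)"
    proof (rule common_nonzero_point)
      show "vec.subspace {v. A v = 0}" unfolding A_def by (rule subspace_kernel[OF \<phi>])
      show "line_poly (\<lambda>v. 1)" unfolding line_poly_def by (intro allI exI[of _ 1]) simp
      show "\<exists>v\<in>{v. A v = 0}. (1::complex) \<noteq> 0" by (intro bexI[of _ "T 0"]) (simp_all add: AT)
      show "\<exists>v\<in>{v. A v = 0}. eval_mpoly (L \<psi>) v \<noteq> 0" if "\<psi> \<in> E - {\<phi>}" for \<psi>
        using hyperplanes_distinct[OF \<phi>, of \<psi>] that by (auto simp: A_def)
    qed (use fin_E line_poly_eval in auto)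
    then show ?thesis using that by blast
  qed
  define V :: "(rat, 'i) vec \<Rightarrow> ('k, 'i) vec" where
    "V u = c i *s (\<chi> j. of_rat (u $ j)) - eval_mpoly l (\<chi> j. of_rat (u $ j)) *s axis i 1" for u
  have V: "(\<chi> j. \<phi> (V u $ j)) = T (\<chi> j. of_rat (u $ j))" for u
  proof -
    have "\<phi> (eval_mpoly l (\<chi> j. of_rat (u $ j))) = A (\<chi> j. of_rat (u $ j))"
      using eval_map_mpoly[OF hom, of l "\<chi> j. of_rat (u $ j)"] by (simp add: A_def hom_of_rat[OF hom])
    then show ?thesis
      by (simp add: V_def T_def vec_eq_iff hom_diff[OF hom] hom_mult[OF hom] hom_of_rat[OF hom] c axis_def
          hom_one[OF hom] hom_zero[OF hom])
  qed
  have "\<exists>u. eval_mpoly h (V u) \<noteq> 0"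
  proof (rule ccontr)
    assume no: "\<not> ?thesis"
    have "eval_mpoly (cofactor \<phi>) (T u) = 0" for u
    proof (rule line_poly_zero_if_zero_at_rational_points[of "\<lambda>u. eval_mpoly (cofactor \<phi>) (T u)"])
      show "line_poly (\<lambda>u. eval_mpoly (cofactor \<phi>) (T u))"
        by (rule line_poly_comp_linear[OF line_poly_eval linT])
      fix u :: "(rat, 'i) vec"
      show "eval_mpoly (cofactor \<phi>) (T (\<chi> j. of_rat (u $ j))) = 0"
        using eval_map_mpoly[OF hom, of h "V u"] no by (simp add: V h[OF \<phi>] hom_zero[OF hom])
    qed
    moreover have "T ((1 / A (axis i 1)) *s z) = z"
      using i z(1) by (simp add: T_def A1 vec_eq_iff)
    ultimately have "eval_mpoly (cofactor \<phi>) z = 0" by metis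
    then show False using z(2) fin_E by (simp add: cofactor_def eval_mpoly_prod)
  qed
  then obtain u where "eval_mpoly h (V u) \<noteq> 0" by blast
  moreover have "\<phi> (eval_mpoly l (V u)) = 0"
    using eval_map_mpoly[OF hom, of l "V u"] AT by (simp add: V A_def)
  ultimately show ?thesis using that by (simp add: hom_eq_0_iff[OF hom])
qed

text \<open>
  The pair of \<open>\<theta>\<close> and its complex conjugate consists of distinct embeddings as the image of \<open>\<theta>\<close> is not
  real, so some automorphism maps \<open>\<phi>, \<psi>\<close> to this pair.
\<close>
lemma vanishes_on_pairwise_intersections:
  fixes G :: "'n \<Rightarrow> ('i, rat) mpoly"
  assumes "finite N" "\<nu> \<in> N" "f dvd (\<Sum>\<nu>\<in>N. (G \<nu>)\<^sup>2)"
    and \<phi>: "\<phi> \<in> E" "\<psi> \<in> E" "\<phi> \<noteq> \<psi>" and u: "eval_mpoly (L \<phi>) u = 0" "eval_mpoly (L \<psi>) u = 0"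
  shows "eval_mpoly (map_mpoly of_rat (G \<nu>)) u = 0"
proof -
  obtain h where h: "(\<Sum>\<nu>\<in>N. (G \<nu>)\<^sup>2) = f * h" using assms(3) by blast
  obtain \<theta> where \<theta>: "\<theta> \<in> E" by (rule E_nonempty)
  have homc: "field_hom (cnj \<circ> \<theta>)" using hom_E[OF \<theta>] by (simp add: field_hom_def)
  then have cE: "cnj \<circ> \<theta> \<in> E" by (rule field_hom_in_embeddings[OF nf])
  have "cnj \<circ> \<theta> \<noteq> \<theta>"
  proof
    assume "cnj \<circ> \<theta> = \<theta>"
    then have "cnj (\<theta> x) = \<theta> x" for x by (metis comp_apply)
    then have "range \<theta> \<subseteq> \<real>" by (auto simp: Reals_cnj_iff)
    then show False using imag hom_E[OF \<theta>] by (auto simp: totally_imaginary_def)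
  qed
  then obtain \<sigma> where \<sigma>: "\<sigma> \<in> Gal_Qbar" "\<sigma> \<circ> \<phi> = \<theta>" "\<sigma> \<circ> \<psi> = cnj \<circ> \<theta>"
    using trans2 \<phi> \<theta> cE unfolding two_transitive_def by metis
  have zero: "eval_mpoly (map_mpoly of_rat (G \<nu>)) u = 0"
    if "eval_mpoly (L \<theta>) u = 0" "eval_mpoly (L (cnj \<circ> \<theta>)) u = 0" for u
    using vanishing_on_conjugate_pair[OF assms(1,2) h hom_E[OF \<theta>] _ lin that]
    by (simp add: f_factor[OF \<theta>] eval_mpoly_mult)
  obtain x where x: "eval_mpoly (L \<phi>) x = 0" "eval_mpoly (L \<psi>) x \<noteq> 0" using hyperplanes_distinct[OF \<phi>] by blast
  obtain y where y: "eval_mpoly (L \<phi>) y \<noteq> 0" using hyperplane_proper[OF \<phi>(1)] by blast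
  show ?thesis
    by (rule vanishing_transported_by_Gal[OF \<sigma>(1) _ _ lin _ x y u])
       (use \<phi> zero in \<open>auto simp: \<sigma>\<close>)
qed

text \<open>
  The point \<open>w = \<phi>(v)\<close> lies on \<open>l\<^sub>\<phi> = 0\<close> and on no other conjugate hyperplane. The coefficient \<open>\<phi>(a)\<close> is
  chosen such that \<open>G\<close> and \<open>\<phi>(a) p\<^sub>\<phi>\<close> agree at \<open>w\<close>. Hence they agree on all of \<open>l\<^sub>\<phi> = 0\<close>, since
  their difference has degree \<open>d - 1\<close> and vanishes on \<open>d - 1\<close> hyperplanes of \<open>l\<^sub>\<phi> = 0\<close> and at \<open>w\<close>.
  Then \<open>G - \<Sum>\<^sub>\<phi> \<phi>(a) p\<^sub>\<phi>\<close>, of degree \<open>d - 1\<close>, vanishes on \<open>d\<close> hyperplanes.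
\<close>
lemma trace_form_if_zero_on_intersections:
  fixes G :: "('i, rat) mpoly"
  assumes h: "\<And>\<phi>. \<phi> \<in> E \<Longrightarrow> map_mpoly \<phi> h = cofactor \<phi>"
    and v: "eval_mpoly l v = 0" "eval_mpoly h v \<noteq> 0"
    and hom: "homogeneous (card E - 1) G"
    and zero: "\<And>\<phi> \<psi> u. \<phi> \<in> E \<Longrightarrow> \<psi> \<in> E \<Longrightarrow> \<phi> \<noteq> \<psi> \<Longrightarrow> eval_mpoly (L \<phi>) u = 0 \<Longrightarrow> eval_mpoly (L \<psi>) u = 0 \<Longrightarrow>
      eval_mpoly (map_mpoly of_rat G) u = 0"
  shows "G = trace_form (eval_mpoly (map_mpoly of_rat G) v / eval_mpoly h v)"
proof -
  let ?G = "map_mpoly of_rat G :: ('i, complex) mpoly"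
  define a where "a = eval_mpoly (map_mpoly of_rat G) v / eval_mpoly h v"
  have homG: "homogeneous (card E - 1) ?G" using hom by (simp only: homogeneous_map_mpoly[OF field_hom_of_rat])
  have hom_term: "homogeneous (card E - 1) (const_mpoly (\<phi> a) * cofactor \<phi>)" if "\<phi> \<in> E" for \<phi>
    using homogeneous_mult[OF homogeneous_const homogeneous_cofactor[OF that]] by simp
  have on_hyperplane: "eval_mpoly ?G x = \<phi> a * eval_mpoly (cofactor \<phi>) x"
    if \<phi>: "\<phi> \<in> E" and x: "eval_mpoly (L \<phi>) x = 0" for \<phi> x
  proof -
    have hm: "field_hom \<phi>" by (rule hom_E[OF \<phi>])
    define w where "w = (\<chi> i. \<phi> (v $ i))"
    have wl: "eval_mpoly (L \<phi>) w = 0"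
      using eval_map_mpoly[OF hm, of l v] v(1) by (simp add: w_def hom_zero[OF hm])
    have wh: "eval_mpoly (cofactor \<phi>) w = \<phi> (eval_mpoly h v)"
      using eval_map_mpoly[OF hm, of h v] by (simp add: w_def h[OF \<phi>])
    have wG: "eval_mpoly ?G w = \<phi> (eval_mpoly (map_mpoly of_rat G) v)"
      using eval_map_mpoly[OF hm, of "map_mpoly of_rat G" v] by (simp add: w_def map_mpoly_of_rat[OF hm])
    have wnz: "eval_mpoly (cofactor \<phi>) w \<noteq> 0" using v(2) by (simp add: wh hom_eq_0_iff[OF hm])
    have "eval_mpoly (?G - const_mpoly (\<phi> a) * cofactor \<phi>) x = 0"
    proof (rule vanishing_on_subspace[where J = "E - {\<phi>}" and m = "\<lambda>\<psi>. eval_mpoly (L \<psi>)" and w = w and k = "card E - 1"])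
      show "vec.subspace {v. eval_mpoly (L \<phi>) v = 0}" by (rule subspace_kernel[OF \<phi>])
      show "homogeneous (card E - 1) (?G - const_mpoly (\<phi> a) * cofactor \<phi>)"
        by (intro homogeneous_diff homG hom_term \<phi>)
      show "\<exists>v\<in>{v. eval_mpoly (L \<phi>) v = 0}. eval_mpoly (L \<psi>) v = 0 \<and> eval_mpoly (L \<psi>') v \<noteq> 0"
        if "\<psi> \<in> E - {\<phi>}" "\<psi>' \<in> E - {\<phi>}" "\<psi> \<noteq> \<psi>'" for \<psi> \<psi>'
        using hyperplanes_distinct_inside_hyperplane[OF \<phi>, of \<psi> \<psi>'] that by auto
      show "eval_mpoly (L \<psi>) w \<noteq> 0" if "\<psi> \<in> E - {\<phi>}" for \<psi>
        using wnz that fin_E by (auto simp: cofactor_def eval_mpoly_prod)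
      show "eval_mpoly (?G - const_mpoly (\<phi> a) * cofactor \<phi>) v = 0"
        if "\<psi> \<in> E - {\<phi>}" "v \<in> {v. eval_mpoly (L \<phi>) v = 0}" "eval_mpoly (L \<psi>) v = 0" for \<psi> v
        using that zero[OF \<phi>, of \<psi> v] cofactor_zero[OF \<phi>, of \<psi> v] by (auto simp: eval_mpoly_diff eval_mpoly_mult)
      have "eval_mpoly (?G - const_mpoly (\<phi> a) * cofactor \<phi>) w = 0"
        using v(2) by (simp add: eval_mpoly_diff eval_mpoly_mult wh wG a_def hom_divide[OF hm] hom_eq_0_iff[OF hm])
      then show "card E - 1 < card (E - {\<phi>}) \<or>
          card E - 1 = card (E - {\<phi>}) \<and> eval_mpoly (?G - const_mpoly (\<phi> a) * cofactor \<phi>) w = 0"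
        using \<phi> fin_E by simp
    qed (use fin_E x wl linear_form_L in auto)
    then show ?thesis by (simp add: eval_mpoly_diff eval_mpoly_mult)
  qed
  let ?D = "?G - (\<Sum>\<phi>\<in>E. const_mpoly (\<phi> a) * cofactor \<phi>)"
  have D_zero: "eval_mpoly ?D x = 0" for x
  proof -
    obtain w where w: "\<And>\<phi>. \<phi> \<in> E \<Longrightarrow> eval_mpoly (L \<phi>) w \<noteq> 0"
    proof -
      have "\<exists>z\<in>UNIV. (1::complex) \<noteq> 0 \<and> (\<forall>\<psi>\<in>E. eval_mpoly (L \<psi>) z \<noteq> 0)"
      proof (rule common_nonzero_point)
        show "line_poly (\<lambda>v :: (complex, 'i) vec. 1)" unfolding line_poly_def by (intro allI exI[of _ 1]) simp
      qed (use fin_E line_poly_eval hyperplane_proper in auto)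
      then show ?thesis using that by blast
    qed
    show ?thesis
    proof (rule vanishing_on_subspace[where J = E and U = UNIV and m = "\<lambda>\<psi>. eval_mpoly (L \<psi>)" and w = w and k = "card E - 1"])
      show "homogeneous (card E - 1) ?D"
        by (intro homogeneous_diff homG homogeneous_sum hom_term)
      show "eval_mpoly ?D v = 0" if \<phi>: "\<phi> \<in> E" and v: "eval_mpoly (L \<phi>) v = 0" for \<phi> v
      proof -
        have "(\<Sum>\<psi>\<in>E. \<psi> a * eval_mpoly (cofactor \<psi>) v) = (\<Sum>\<psi>\<in>E. if \<psi> = \<phi> then \<phi> a * eval_mpoly (cofactor \<phi>) v else 0)"
          using cofactor_zero[OF _ \<phi> _ v] by (intro sum.cong) auto
        also have "\<dots> = \<phi> a * eval_mpoly (cofactor \<phi>) v" using \<phi> fin_E by simp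
        finally show ?thesis
          using on_hyperplane[OF \<phi> v] by (simp add: eval_mpoly_diff eval_mpoly_sum eval_mpoly_mult)
      qed
      show "card E - 1 < card E \<or> card E - 1 = card E \<and> eval_mpoly ?D w = 0" using card_E by simp
    qed (use fin_E w linear_form_L hyperplanes_distinct in auto)
  qed
  have "?D = 0" by (rule mpoly_zero_if_zero_at_rational_points) (rule D_zero)
  then have "?G = map_mpoly of_rat (trace_form a)" by (simp add: trace_form_complex)
  then show ?thesis by (simp only: map_mpoly_inj[OF field_hom_of_rat] a_def)
qed

lemma sum_of_squares_representation:
  fixes G :: "'n \<Rightarrow> ('i, rat) mpoly"
  assumes fin: "finite N" and dvd: "f dvd (\<Sum>\<nu>\<in>N. (G \<nu>)\<^sup>2)"
    and hom: "homogeneous (2 * (card E - 1)) (\<Sum>\<nu>\<in>N. (G \<nu>)\<^sup>2)"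
  obtains a where "(\<Sum>\<nu>\<in>N. (a \<nu>)\<^sup>2) = 0" "\<And>\<nu>. \<nu> \<in> N \<Longrightarrow> G \<nu> = trace_form (a \<nu>)"
proof -
  obtain h where h: "h * l = map_mpoly of_rat f" "\<And>\<phi>. \<phi> \<in> E \<Longrightarrow> map_mpoly \<phi> h = cofactor \<phi>"
    by (rule cofactor_over_field) blast
  obtain v where v: "eval_mpoly l v = 0" "eval_mpoly h v \<noteq> 0"
    using exists_separating_point[OF h(2)] by blast
  define a where "a \<nu> = eval_mpoly (map_mpoly of_rat (G \<nu>)) v / eval_mpoly h v" for \<nu>
  have rep: "G \<nu> = trace_form (a \<nu>)" if "\<nu> \<in> N" for \<nu>
    unfolding a_def
    by (rule trace_form_if_zero_on_intersections[OF h(2) v])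
       (use vanishes_on_pairwise_intersections[OF fin that dvd] sum_of_squares_summands_homogeneous[OF fin hom that] in auto)
  obtain q where q: "(\<Sum>\<nu>\<in>N. (G \<nu>)\<^sup>2) = f * q" using dvd by blast
  have "(\<Sum>\<nu>\<in>N. (eval_mpoly (map_mpoly of_rat (G \<nu>)) v)\<^sup>2) = eval_mpoly (map_mpoly of_rat (\<Sum>\<nu>\<in>N. (G \<nu>)\<^sup>2)) v"
    by (simp add: map_mpoly_sum[OF field_hom_of_rat] map_mpoly_power2[OF field_hom_of_rat] eval_mpoly_sum eval_mpoly_power)
  also have "\<dots> = 0"
    unfolding q map_mpoly_mult[OF field_hom_of_rat] eval_mpoly_mult
    by (simp flip: h(1) add: eval_mpoly_mult v(1))
  finally have "(\<Sum>\<nu>\<in>N. (a \<nu>)\<^sup>2) = 0"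
    unfolding a_def power_divide sum_divide_distrib[symmetric] by simp
  with rep show ?thesis using that by blast
qed

end

section \<open>The equivalence\<close>

theorem proposition3p4:
  fixes n d :: nat
    and l :: "('i::{finite,linorder}, 'k::field_char_0) mpoly"
    and f g :: "('i, rat) mpoly"
  assumes "n \<ge> 2" and "CARD('i) = n + 1"
    and "number_field TYPE('k)" and "field_degree TYPE('k) = d" and "d \<ge> 4"
    and "totally_imaginary TYPE('k)"
    and "two_transitive (\<circ>) Gal_Qbar (embeddings :: ('k \<Rightarrow> complex) set)"
    and "homogeneous 1 l"
    and "general_position (embeddings :: ('k \<Rightarrow> complex) set) (\<lambda>\<phi>. proj_zeros (map_mpoly \<phi> l))"
    and "f = norm_mpoly l"
    and "homogeneous (2 * d - 2) g"
  defines "cond_i \<equiv> f dvd g \<and>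
      (\<exists>(r::nat) G. (\<forall>\<nu>\<in>{1..r}. is_form (G \<nu>)) \<and> g = (\<Sum>\<nu>=1..r. (G \<nu>)\<^sup>2))"
    and "cond_ii \<equiv> (\<exists>(r::nat) (a :: nat \<Rightarrow> 'k). r \<ge> 1 \<and> (\<Sum>\<nu>=1..r. (a \<nu>)\<^sup>2) = 0 \<and>
      g = (\<Sum>\<nu>=1..r. (trace_mpoly (mpoly_quot (const_mpoly (a \<nu>) * map_mpoly of_rat f) l))\<^sup>2))"
  shows "(cond_i \<longleftrightarrow> cond_ii) \<and>
    (cond_i \<and> cond_ii \<longrightarrow>
      (\<forall>(r::nat) (G :: nat \<Rightarrow> ('i, rat) mpoly). g = (\<Sum>\<nu>=1..r. (G \<nu>)\<^sup>2) \<longrightarrow>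
        (\<exists>a :: nat \<Rightarrow> 'k. (\<Sum>\<nu>=1..r. (a \<nu>)\<^sup>2) = 0 \<and>
          (\<forall>\<nu>\<in>{1..r}. G \<nu> =
            trace_mpoly (mpoly_quot (const_mpoly (a \<nu>) * map_mpoly of_rat f) l)))))"
proof -
  have card: "card (embeddings :: ('k \<Rightarrow> complex) set) = d"
    using card_embeddings(2)[OF assms(3)] assms(4) by simp
  interpret H: conjugate_hyperplanes l f
    unfolding conjugate_hyperplanes_def
    using assms(1-3,5-10) card by simp
  have tf: "trace_mpoly (mpoly_quot (const_mpoly a * map_mpoly of_rat f) l) = H.trace_form a" for a
    by (simp add: H.trace_form_def)
  have deg: "homogeneous (2 * (card (embeddings :: ('k \<Rightarrow> complex) set) - 1)) g"
    using assms(11) by (simp add: card diff_mult_distrib2)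
  have repr: "\<exists>a. (\<Sum>\<nu>=1..r. (a \<nu>)\<^sup>2) = 0 \<and> (\<forall>\<nu>\<in>{1..r}. G \<nu> = H.trace_form (a \<nu>))"
    if "f dvd g" and g: "g = (\<Sum>\<nu>=1..r. (G \<nu>)\<^sup>2)" for r :: nat and G
    using H.sum_of_squares_representation[of "{1..r}" G] deg that by (metis finite_atLeastAtMost)
  have "cond_ii" if c: "cond_i"
  proof -
    obtain r :: nat and G where dvd: "f dvd g" and g: "g = (\<Sum>\<nu>=1..r. (G \<nu>)\<^sup>2)"
      using c unfolding cond_i_def by blast
    obtain a where a: "(\<Sum>\<nu>=1..r. (a \<nu>)\<^sup>2) = 0" "\<And>\<nu>. \<nu> \<in> {1..r} \<Longrightarrow> G \<nu> = H.trace_form (a \<nu>)"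
      using repr[OF dvd g] by blast
    \<comment> \<open>A zero coefficient is appended because \<open>r\<close> may be \<open>0\<close>.\<close>
    define b where "b \<nu> = (if \<nu> \<le> r then a \<nu> else 0)" for \<nu>
    have tf0: "H.trace_form 0 = 0"
    proof -
      have "map_mpoly of_rat (H.trace_form 0) = (0 :: ('i, complex) mpoly)"
        unfolding H.trace_form_complex by (intro sum.neutral) (auto simp: hom_zero[OF H.hom_E])
      then show ?thesis by (simp add: map_mpoly_eq_0_iff[OF field_hom_of_rat])
    qed
    have "(\<Sum>\<nu>=1..Suc r. (b \<nu>)\<^sup>2) = (\<Sum>\<nu>=1..r. (a \<nu>)\<^sup>2)"
      by (simp add: b_def)
    moreover have "(\<Sum>\<nu>=1..Suc r. (H.trace_form (b \<nu>))\<^sup>2) = (\<Sum>\<nu>=1..r. (G \<nu>)\<^sup>2)"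
      using a(2) by (simp add: b_def tf0)
    ultimately show ?thesis
      unfolding cond_ii_def tf using a(1) g by (intro exI[of _ "Suc r"] exI[of _ b]) simp
  qed
  moreover have "cond_i" if c: "cond_ii"
  proof -
    obtain r :: nat and a where a: "(\<Sum>\<nu>=1..r. (a \<nu>)\<^sup>2) = 0" and g: "g = (\<Sum>\<nu>=1..r. (H.trace_form (a \<nu>))\<^sup>2)"
      using c unfolding cond_ii_def tf by blast
    have "f dvd g" unfolding g by (rule H.f_dvd_sum_trace_form_squares[OF a])
    moreover have "is_form (H.trace_form x)" for x
      unfolding is_form_def using H.homogeneous_trace_form by blast
    ultimately show ?thesis
      unfolding cond_i_def using g by (intro conjI exI[of _ r] exI[of _ "\<lambda>\<nu>. H.trace_form (a \<nu>)"]) auto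
  qed
  moreover have "f dvd g" if cond_i using that by (simp add: cond_i_def)
  ultimately show ?thesis using repr unfolding tf by blast
qed

end
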